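(* Let $\Gamma$ be a finite simple graph, $A_\Gamma$ the associated right-angled Artin group, and let $\phi\in\mathrm{Aut}(A_\Gamma)$ be a composition of inversions. Then the $\phi$-twisted conjugacy problem $\mathrm{TCP}_\phi(A_\Gamma)$ is solvable in linear time.
   Context: The right-angled Artin group is $A_\Gamma = \langle V(\Gamma) \mid [s,t]=1 \text{ for all } \{s,t\}\in E(\Gamma)\rangle$, with $X=V(\Gamma)\cup V(\Gamma)^{-1}$. An inversion is the automorphism sending one vertex $x\in V(\Gamma)$ to $x^{-1}$ and fixing all other vertices. Elements $u,v\in A_\Gamma$ are $\phi$-twisted conjugate if $v=\phi(w)^{-1}uw$ for some $w\in A_\Gamma$; $\mathrm{TCP}_\phi(A_\Gamma)$ asks for an algorithm that, given two words over $X$, decides whether they represent $\phi$-twisted conjugate elements. Time is measured in the total length of the input words on a random access machine (basic integer arithmetic operations take constant time). *)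

theory Defs
  imports Main
begin

text \<open>The graph Gamma has vertex set {0..<n} and adjacency relation E
(assumed symmetric and irreflexive in the theorem).  A letter (x, True)
stands for the generator x, and (x, False) for its inverse.\<close>

type_synonym letter = "nat \<times> bool"

definition letters :: "nat \<Rightarrow> letter set" where
  "letters n = {l. fst l < n}"

definition inv_letter :: "letter \<Rightarrow> letter" where
  "inv_letter l = (fst l, \<not> snd l)"

definition inv_word :: "letter list \<Rightarrow> letter list" where
  "inv_word w = rev (map inv_letter w)"

inductive raag_step :: "nat \<Rightarrow> (nat \<Rightarrow> nat \<Rightarrow> bool) \<Rightarrow> letter list \<Rightarrow> letter list \<Rightarrow> bool"
  for n E where
  cancel: "fst a < n \<Longrightarrow> raag_step n E (p @ [a, inv_letter a] @ q) (p @ q)"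
| commute: "fst a < n \<Longrightarrow> fst b < n \<Longrightarrow> E (fst a) (fst b) \<Longrightarrow>
     raag_step n E (p @ [a, b] @ q) (p @ [b, a] @ q)"

definition raag_eq :: "nat \<Rightarrow> (nat \<Rightarrow> nat \<Rightarrow> bool) \<Rightarrow> letter list \<Rightarrow> letter list \<Rightarrow> bool" where
  "raag_eq n E = equivclp (raag_step n E)"

text \<open>The inversion at vertex x, acting letterwise on words (this induces the
automorphism x |-> x^-1 fixing all other vertices).\<close>
definition inversion :: "nat \<Rightarrow> letter list \<Rightarrow> letter list" where
  "inversion x w = map (\<lambda>(y, b). if y = x then (y, \<not> b) else (y, b)) w"

definition compose_inversions :: "nat list \<Rightarrow> letter list \<Rightarrow> letter list" where
  "compose_inversions xs = foldr (\<lambda>x f. inversion x \<circ> f) xs id"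

definition twisted_conj ::
  "nat \<Rightarrow> (nat \<Rightarrow> nat \<Rightarrow> bool) \<Rightarrow> (letter list \<Rightarrow> letter list) \<Rightarrow> letter list \<Rightarrow> letter list \<Rightarrow> bool" where
  "twisted_conj n E phi u v \<longleftrightarrow>
     (\<exists>w. set w \<subseteq> letters n \<and> raag_eq n E v (inv_word (phi w) @ u @ w))"

datatype instr =
    LoadC nat int
  | Add nat nat nat
  | Sub nat nat nat
  | Mul nat nat nat
  | Div nat nat nat
  | Mod nat nat nat
  | LoadI nat nat
  | StoreI nat nat
  | Jz nat nat
  | Jneg nat nat
  | Jmp nat
  | Halt

type_synonym config = "nat \<times> (nat \<Rightarrow> int)"

definition ram_halted :: "instr list \<Rightarrow> config \<Rightarrow> bool" where
  "ram_halted P c \<longleftrightarrow> fst c \<ge> length P \<or> P ! fst c = Halt"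

fun exec :: "instr \<Rightarrow> config \<Rightarrow> config" where
  "exec (LoadC r k) (pc, M) = (Suc pc, M(r := k))"
| "exec (Add r a b) (pc, M) = (Suc pc, M(r := M a + M b))"
| "exec (Sub r a b) (pc, M) = (Suc pc, M(r := M a - M b))"
| "exec (Mul r a b) (pc, M) = (Suc pc, M(r := M a * M b))"
| "exec (Div r a b) (pc, M) = (Suc pc, M(r := M a div M b))"
| "exec (Mod r a b) (pc, M) = (Suc pc, M(r := M a mod M b))"
| "exec (LoadI r a) (pc, M) = (Suc pc, M(r := M (nat (M a))))"
| "exec (StoreI a r) (pc, M) = (Suc pc, M(nat (M a) := M r))"
| "exec (Jz r l) (pc, M) = (if M r = 0 then l else Suc pc, M)"
| "exec (Jneg r l) (pc, M) = (if M r < 0 then l else Suc pc, M)"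
| "exec (Jmp l) (pc, M) = (l, M)"
| "exec Halt (pc, M) = (pc, M)"

definition ram_step :: "instr list \<Rightarrow> config \<Rightarrow> config" where
  "ram_step P c = (if ram_halted P c then c else exec (P ! fst c) c)"

definition ram_halts_within :: "instr list \<Rightarrow> (nat \<Rightarrow> int) \<Rightarrow> nat \<Rightarrow> (nat \<Rightarrow> int) \<Rightarrow> bool" where
  "ram_halts_within P M0 t M \<longleftrightarrow>
     ram_halted P ((ram_step P ^^ t) (0, M0)) \<and> snd ((ram_step P ^^ t) (0, M0)) = M"

definition enc_letter :: "letter \<Rightarrow> int" where
  "enc_letter l = (if snd l then int (fst l) + 1 else - (int (fst l) + 1))"

definition ram_input :: "letter list \<Rightarrow> letter list \<Rightarrow> nat \<Rightarrow> int" where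
  "ram_input u v i =
     (if i = 0 then int (length u)
      else if i = 1 then int (length v)
      else if i < 2 + length u then enc_letter (u ! (i - 2))
      else if i < 2 + length u + length v then enc_letter (v ! (i - 2 - length u))
      else 0)"

definition decides_TCP_linear_time ::
  "nat \<Rightarrow> (nat \<Rightarrow> nat \<Rightarrow> bool) \<Rightarrow> (letter list \<Rightarrow> letter list) \<Rightarrow> instr list \<Rightarrow> nat \<Rightarrow> bool" where
  "decides_TCP_linear_time n E phi P C \<longleftrightarrow>
     (\<forall>u v. set u \<subseteq> letters n \<longrightarrow> set v \<subseteq> letters n \<longrightarrow>
        (\<exists>t M. t \<le> C * (length u + length v) + C \<and> ram_halts_within P (ram_input u v) t M \<and>
               M 0 = (if twisted_conj n E phi u v then 1 else 0)))"

end

theory Submission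
  imports Defs "HOL-Library.Confluence" "HOL-Library.Multiset"
begin

text \<open>Write \<open>\<phi>\<close> for the composition of inversions. Twisted conjugacy of words is generated by
  commutations, twisted rotations \<open>a p \<rightarrow> p \<phi>(a)\<close> and cancellations. Modulo commutations and rotations,
  cancellation is confluent: two cancelling pairs of letters are either disjoint or share a letter, and
  then deleting either pair gives the same class. Hence two words without reducts are twisted
  conjugate iff they differ by commutations and twisted rotations only. A word has no reducts as soon
  as it is reduced and no letter that can be moved to its front cancels, after twisting, with one that
  can be moved to its end, so such words are found by a linear number of deletions.

  Rotations are decided separately on every connected component of the non-commutation graph of the
  support. Rotate letters other than a fixed root as long as possible, and the root only if no other
  letter can be moved to the front. The positions where only the root can be moved form a
  periodic orbit, with period twice the length, which contains these positions for every word of the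
  class and which is reached after linearly many steps; so one searches the orbit of one word for one
  such position of the other.

  A word is stored as its piling, one stack over \<open>{0, 1, 2}\<close> for every vertex. Since the machine
  has unit-cost arithmetic on unbounded integers, every stack is a single integer in base 3, and
  every elementary step on pilings takes constant time.\<close>

section \<open>Twisted conjugacy as a confluent rewriting system\<close>

text \<open>Confluence rests on a one-step diamond on classes, so no termination argument enters it.
  The obstacle is that equal letters cannot be told apart after commutations and rotations.
  Numbering the positions makes overlapping pairs comparable, and the cyclic order of three pairwise
  non-commuting tokens decides every overlap.

  The linear bound comes from non-commuting vertices blocking each other. While the root is not
  rotated, each edge away from it allows at most one further turn of the letters of a vertex, so the
  number of rotations is at most the largest distance \<open>\<kappa>\<close> times the length. The
  period is two turns because one turn twists every letter once.

  The components depend on the support of the input, the program does not. Hence all pairs of a root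
  and a connected vertex set are compiled in and filtered at run time. Every loop runs for one
  common number of rounds, fixed before the start, and is designed so that surplus rounds do no
  harm.

  A stack is used at both ends and may begin with spacers, so its integer is stored together with a
  power of 3 that records the height.\<close>

lemma equivclp_invariant:
  assumes "equivclp r x y" and "\<And>a b. r a b \<Longrightarrow> P a = P b"
  shows "P x = P y"
  using assms(1) by induction (auto dest: assms(2))

lemma equivclp_map:
  assumes "equivclp r x y" and "\<And>a b. r a b \<Longrightarrow> equivclp s (g a) (g b)"
  shows "equivclp s (g x) (g y)"
  using assms(1)
proof induction
  case (step y z)
  then show ?case using assms(2) by (meson equivclp_sym equivclp_trans)
qed simp

lemma inv_letter_simps [simp]:
  "inv_letter (inv_letter l) = l" "fst (inv_letter l) = fst l" "inv_letter l \<noteq> l" "l \<noteq> inv_letter l"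
  by (auto simp: inv_letter_def prod_eq_iff)

locale raag =
  fixes E :: "nat \<Rightarrow> nat \<Rightarrow> bool" and S :: "nat set"
  assumes E_sym: "E x y \<Longrightarrow> E y x" and E_irrefl [simp]: "\<not> E x x"
begin

lemma E_commute: "E x y = E y x"
  using E_sym by blast

text \<open>\<open>S\<close> is the set of inverted vertices; for a list of inversions these are the
  vertices that occur in it an odd number of times.\<close>

definition tw :: "letter \<Rightarrow> letter" where
  "tw l = (if fst l \<in> S then inv_letter l else l)"

lemma tw_simps [simp]: "fst (tw l) = fst l" "tw (tw l) = l" "inv_letter (tw l) = tw (inv_letter l)"
  by (auto simp: tw_def)

lemma tw_inject [simp]: "tw a = tw b \<longleftrightarrow> a = b"
  by (metis tw_simps(2))

text \<open>Polymorphic in the vertex map \<open>v\<close>, so that one definition serves plain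
  letters (\<open>fst\<close>) and tokens (\<open>vt\<close>).\<close>

inductive swap :: "('a \<Rightarrow> nat) \<Rightarrow> 'a list \<Rightarrow> 'a list \<Rightarrow> bool" for v where
  swapI: "E (v a) (v b) \<Longrightarrow> swap v (p @ [a, b] @ q) (p @ [b, a] @ q)"

inductive cyc :: "('a \<Rightarrow> nat) \<Rightarrow> ('a \<Rightarrow> 'a) \<Rightarrow> 'a list \<Rightarrow> 'a list \<Rightarrow> bool" for v f where
  cyc_swap: "swap v x y \<Longrightarrow> cyc v f x y"
| cyc_rot: "cyc v f (a # p) (p @ [f a])"

lemma swap_sym: "swap v x y \<Longrightarrow> swap v y x"
  by (induction rule: swap.induct) (rule swapI, rule E_sym)

lemma swap_filter: "swap v x y \<Longrightarrow> equivclp (swap v) (filter Q x) (filter Q y)"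
  by (induction rule: swap.induct) (auto intro!: r_into_equivclp swapI[of v _ _ _ _, simplified])

text \<open>Deletion is compatible with rotation because the twist cannot change whether a letter is
  kept. This restricts classes to a few tokens (\<open>keep\<close>) as well as to a set of vertices
  (\<open>restr\<close>).\<close>

lemma cyc_filter:
  assumes "\<And>a. Q (f a) = Q a" "cyc v f x y"
  shows "equivclp (cyc v f) (filter Q x) (filter Q y)"
  using assms(2)
proof induction
  case (cyc_swap x y)
  then show ?case
    by (rule equivclp_map[OF swap_filter, where g = id, simplified])
       (auto intro: r_into_equivclp cyc.cyc_swap)
next
  case (cyc_rot a p)
  then show ?case by (auto simp: assms(1) intro: r_into_equivclp cyc.cyc_rot)
qed

lemma equivclp_cyc_filter:
  assumes "\<And>a. Q (f a) = Q a" "equivclp (cyc v f) x y"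
  shows "equivclp (cyc v f) (filter Q x) (filter Q y)"
  using equivclp_map[OF assms(2) cyc_filter] assms(1) .

abbreviation teq :: "letter list \<Rightarrow> letter list \<Rightarrow> bool" (infix "\<equiv>\<^sub>t" 50) where
  "teq \<equiv> equivclp (swap fst)"

abbreviation ceq :: "letter list \<Rightarrow> letter list \<Rightarrow> bool" (infix "\<approx>" 50) where
  "ceq \<equiv> equivclp (cyc fst tw)"

text \<open>Words whose letters carry an identity, so that single occurrences can be followed through
  commutations and twisted rotations.\<close>

type_synonym token = "letter \<times> nat"

abbreviation vt :: "token \<Rightarrow> nat" where "vt t \<equiv> fst (fst t)"

abbreviation tceq :: "token list \<Rightarrow> token list \<Rightarrow> bool" where
  "tceq \<equiv> equivclp (cyc vt (apfst tw))"

lemma teq_ceq: "x \<equiv>\<^sub>t y \<Longrightarrow> x \<approx> y"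
  using equivclp_map[of "swap fst" x y "cyc fst tw" id] by (auto intro: r_into_equivclp cyc_swap)

lemma swap_ctxt: "swap v x y \<Longrightarrow> swap v (A @ x @ B) (A @ y @ B)"
proof (induction rule: swap.induct)
  case (swapI a b p q)
  then show ?case using swap.swapI[of v a b "A @ p" "q @ B"] by simp
qed

lemma teq_ctxt: "equivclp (swap v) x y \<Longrightarrow> equivclp (swap v) (A @ x @ B) (A @ y @ B)"
  using equivclp_map[of "swap v" x y "swap v" "\<lambda>x. A @ x @ B"]
  by (auto intro: r_into_equivclp swap_ctxt)

lemma swap_past: "\<forall>m\<in>set M. E (v a) (v m) \<Longrightarrow> equivclp (swap v) (a # M) (M @ [a])"
proof (induction M)
  case (Cons m M)
  have "equivclp (swap v) (a # m # M) (m # a # M)"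
    using swapI[of v a m "[]" M] Cons.prems by auto
  moreover have "equivclp (swap v) (m # a # M) (m # M @ [a])"
    using teq_ctxt[OF Cons.IH, of "[m]" "[]"] Cons.prems by simp
  ultimately show ?case by (auto intro: equivclp_trans)
qed simp

lemma swap_past':
  assumes "\<forall>m\<in>set M. E (v a) (v m)"
  shows "equivclp (swap v) (A @ a # M @ B) (A @ M @ a # B)"
  using teq_ctxt[OF swap_past[OF assms], of A B] by simp

lemma cyc_map_fst: "cyc vt (apfst tw) X Y \<Longrightarrow> cyc fst tw (map fst X) (map fst Y)"
proof (induction rule: cyc.induct)
  case (cyc_swap x y)
  then show ?case
    by (induction rule: swap.induct) (auto intro!: cyc.cyc_swap swapI[simplified])
next
  case (cyc_rot a p)
  then show ?case using cyc.cyc_rot[of fst tw "fst a" "map fst p"] by simp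
qed

lemma tceq_map_fst: "tceq X Y \<Longrightarrow> map fst X \<approx> map fst Y"
  using equivclp_map[of "cyc vt (apfst tw)" X Y "cyc fst tw" "map fst"]
  by (auto intro: r_into_equivclp cyc_map_fst)

lemma swap_ids: "swap v x y \<Longrightarrow> mset x = mset y"
  by (induction rule: swap.induct) (auto simp: add_mset_commute)

text \<open>The sign of a token is left out, since a rotation flips it over vertices in
  \<open>S\<close>.\<close>

lemma tceq_ids: "tceq X Y \<Longrightarrow>
  mset (map (\<lambda>t. (vt t, snd t)) X) = mset (map (\<lambda>t. (vt t, snd t)) Y)"
proof (erule equivclp_invariant)
  show "mset (map (\<lambda>t. (vt t, snd t)) a) = mset (map (\<lambda>t. (vt t, snd t)) b)"
    if "cyc vt (apfst tw) a b" for a b :: "token list"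
    using that
  proof induction
    case (cyc_swap x y)
    from swap_ids[OF this] show ?case by simp
  qed simp
qed

lemma tceq_distinct: "tceq X Y \<Longrightarrow> distinct (map snd X) = distinct (map snd Y)"
proof -
  assume "tceq X Y"
  from arg_cong[OF tceq_ids[OF this], of "image_mset snd"]
  have "mset (map snd X) = mset (map snd Y)" by (simp add: multiset.map_comp comp_def)
  then show ?thesis by (rule mset_eq_imp_distinct_iff)
qed

lemma swap_lift:
  assumes "swap fst (map fst X) y"
  shows "\<exists>Y. map fst Y = y \<and> swap vt X Y"
proof -
  from assms obtain a b p q where *: "E (fst a) (fst b)" "map fst X = p @ a # b # q" "y = p @ b # a # q"
    by (rule swap.cases) (rule that; simp)
  then obtain P a' b' Q where "X = P @ a' # b' # Q" "map fst P = p" "fst a' = a" "fst b' = b"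
    "map fst Q = q"
    by (auto simp: map_eq_append_conv map_eq_Cons_conv)
  with * show ?thesis
    by (intro exI[of _ "P @ b' # a' # Q"]) (auto intro!: swapI[of vt a' b' P Q, simplified])
qed

lemma cyc_lift:
  assumes "cyc fst tw (map fst X) y"
  shows "\<exists>Y. map fst Y = y \<and> tceq X Y"
  using assms
proof cases
  case cyc_swap
  then show ?thesis using swap_lift by (blast intro: r_into_equivclp cyc.cyc_swap)
next
  case (cyc_rot a p)
  then obtain a' P where "X = a' # P" "fst a' = a" "map fst P = p" by auto
  with cyc_rot show ?thesis
    by (intro exI[of _ "P @ [apfst tw a']"]) (auto intro!: r_into_equivclp cyc.cyc_rot)
qed

text \<open>\<open>equivclp\<close> also takes steps backwards and \<open>cyc_rot\<close> is not
  symmetric, so rotations must be lifted against their direction too.\<close>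

lemma cyc_lift_back:
  assumes "cyc fst tw x (map fst Y)"
  shows "\<exists>X. map fst X = x \<and> tceq X Y"
  using assms
proof cases
  case cyc_swap
  then show ?thesis using swap_lift[OF swap_sym, of x Y] swap_sym[of vt]
    by (blast intro: r_into_equivclp cyc.cyc_swap)
next
  case (cyc_rot a p)
  then obtain i P where "Y = P @ [(tw a, i)]" "map fst P = p"
    by (auto simp: map_eq_append_conv)
  with cyc_rot show ?thesis
    using cyc.cyc_rot[of vt "apfst tw" "(a, i)" P]
    by (intro exI[of _ "(a, i) # P"]) (auto intro!: r_into_equivclp)
qed

lemma ceq_lift: "x \<approx> y \<Longrightarrow> map fst X = x \<Longrightarrow> \<exists>Y. map fst Y = y \<and> tceq X Y"
proof (induction rule: equivclp_induct)
  case (step y z)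
  then obtain Y where Y: "map fst Y = y" "tceq X Y" by blast
  have "\<exists>Z. map fst Z = z \<and> tceq Y Z"
    using step.hyps(2) Y(1) cyc_lift[of Y z] cyc_lift_back[of z Y] by (auto intro: equivclp_sym)
  then show ?case using Y(2) equivclp_trans by metis
qed auto

text \<open>Two tokens at the same vertex, or three pairwise non-commuting ones, can only be rotated among
  themselves. This determines which tokens may lie between two that cancel in some word of the class.\<close>

definition pair_inv :: "nat \<Rightarrow> nat \<Rightarrow> token list \<Rightarrow> bool" where
  "pair_inv i j Z \<longleftrightarrow> (\<exists>s t. Z = [s, t] \<and> vt s = vt t \<and>
     (snd s = i \<and> snd t = j \<and> fst t = inv_letter (fst s) \<or>
      snd s = j \<and> snd t = i \<and> fst t = inv_letter (tw (fst s))))"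

text \<open>The three orders are the cyclic shifts of \<open>i, j, k\<close>. A rotation preserves
  the cyclic order and no swap applies, so \<open>k\<close> never comes to lie behind
  \<open>i\<close> and before \<open>j\<close>.\<close>

definition trip_inv :: "nat \<Rightarrow> nat \<Rightarrow> nat \<Rightarrow> token list \<Rightarrow> bool" where
  "trip_inv i j k Z \<longleftrightarrow> (\<exists>s t r. Z = [s, t, r] \<and> \<not> E (vt s) (vt t) \<and> \<not> E (vt s) (vt r) \<and> \<not> E (vt t) (vt r)
     \<and> [snd s, snd t, snd r] \<in> {[i, j, k], [j, k, i], [k, i, j]})"

lemma trip_inv_ids: "trip_inv i j k Z \<Longrightarrow> map snd Z \<in> {[i, j, k], [j, k, i], [k, i, j]}"
  unfolding trip_inv_def by (elim exE conjE) simp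

lemma swap_two: "swap v [s, t] y \<Longrightarrow> E (v s) (v t)"
  by (auto elim!: swap.cases simp: Cons_eq_append_conv append_eq_Cons_conv)

lemma swap_three: "swap v [s, t, r] y \<Longrightarrow> E (v s) (v t) \<or> E (v t) (v r)"
  by (auto elim!: swap.cases simp: Cons_eq_append_conv append_eq_Cons_conv)

lemma pair_inv_tceq: "tceq X Y \<Longrightarrow> pair_inv i j X = pair_inv i j Y"
proof (erule equivclp_invariant)
  show "pair_inv i j a = pair_inv i j b" if "cyc vt (apfst tw) a b" for a b :: "token list"
    using that
  proof induction
    case (cyc_swap x y)
    then have "\<not> pair_inv i j x" "\<not> pair_inv i j y"
      by (auto simp: pair_inv_def dest!: swap_two swap_two[OF swap_sym])
    then show ?case by simp
  next
    case (cyc_rot a p)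
    show ?case
    proof (cases p)
      case (Cons b p')
      then show ?thesis
        by (cases p'; cases a; cases b) (fastforce simp: pair_inv_def dest: arg_cong[of _ _ inv_letter])+
    qed (auto simp: pair_inv_def)
  qed
qed

lemma trip_inv_tceq: "tceq X Y \<Longrightarrow> trip_inv i j k X = trip_inv i j k Y"
proof (erule equivclp_invariant)
  show "trip_inv i j k a = trip_inv i j k b" if "cyc vt (apfst tw) a b" for a b :: "token list"
    using that
  proof induction
    case (cyc_swap x y)
    then have "\<not> trip_inv i j k x" "\<not> trip_inv i j k y"
      by (auto simp: trip_inv_def dest!: swap_three swap_three[OF swap_sym])
    then show ?case by simp
  next
    case (cyc_rot a p)
    show ?case
    proof (cases "\<exists>b c. p = [b, c]")
      case True
      then show ?thesis
        by (cases a) (auto simp: trip_inv_def E_commute)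
    qed (auto simp: trip_inv_def append_eq_Cons_conv Cons_eq_append_conv)
  qed
qed

section \<open>Restriction to two or three tokens, and the shape of cancelling pairs\<close>

abbreviation keep :: "nat set \<Rightarrow> token list \<Rightarrow> token list" where
  "keep I \<equiv> filter (\<lambda>t. snd t \<in> I)"

lemma keep_tceq: "tceq X Y \<Longrightarrow> tceq (keep I X) (keep I Y)"
  by (rule equivclp_cyc_filter) auto

lemma keep_three:
  assumes "distinct (map snd (A @ x # B @ y # C @ z # D))"
  shows "keep {snd x, snd y, snd z} (A @ x # B @ y # C @ z # D) = [x, y, z]"
proof -
  have "keep {snd x, snd y, snd z} L = []"
    if "snd x \<notin> snd ` set L" "snd y \<notin> snd ` set L" "snd z \<notin> snd ` set L" for L :: "token list"
    unfolding filter_empty_conv using that by (metis imageI insertE singletonD)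
  with assms show ?thesis by simp
qed

lemma keep_two:
  assumes "distinct (map snd (A @ x # B @ y # C))"
  shows "keep {snd x, snd y} (A @ x # B @ y # C) = [x, y]"
proof -
  have "keep {snd x, snd y} L = []"
    if "snd x \<notin> snd ` set L" "snd y \<notin> snd ` set L" for L :: "token list"
    unfolding filter_empty_conv using that by (metis imageI insertE singletonD)
  with assms show ?thesis by simp
qed

lemma filter_eq_two:
  assumes "filter P X = [s, t]"
  shows "\<exists>A M B. X = A @ s # M @ t # B"
proof -
  obtain A R where "X = A @ s # R" "[t] = filter P R"
    using filter_eq_ConsD[OF assms] by blast
  moreover obtain M B where "R = M @ t # B"
    using filter_eq_ConsD[OF \<open>[t] = filter P R\<close>[symmetric]] by blast
  ultimately show ?thesis by blast
qed

text \<open>An ordered pair: \<open>i\<close> is the left token. Which role a shared token plays in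
  two pairs decides how they overlap.\<close>

definition canc :: "token list \<Rightarrow> nat \<Rightarrow> nat \<Rightarrow> bool" where
  "canc X i j \<longleftrightarrow> (\<exists>C D p q. tceq X (C @ p # q # D) \<and> snd p = i \<and> snd q = j \<and>
     fst q = inv_letter (fst p))"

lemma canc_tceq: "canc X i j \<Longrightarrow> tceq X Y \<Longrightarrow> canc Y i j"
  unfolding canc_def using equivclp_trans[OF equivclp_sym[of _ X Y]] by blast

lemma canc_pair_inv:
  assumes "canc X i j" "distinct (map snd X)"
  shows "pair_inv i j (keep {i, j} X)"
proof -
  obtain C D p q where *: "tceq X (C @ p # q # D)" "snd p = i" "snd q = j" "fst q = inv_letter (fst p)"
    using assms(1) unfolding canc_def by blast
  have "distinct (map snd (C @ p # q # D))" using tceq_distinct[OF *(1)] assms(2) by simp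
  then have "keep {i, j} (C @ p # q # D) = [p, q]" using keep_two[of C p "[]" q D] * by simp
  then have "pair_inv i j (keep {i, j} (C @ p # q # D))" using * by (auto simp: pair_inv_def)
  then show ?thesis using pair_inv_tceq[OF keep_tceq[OF *(1)]] by blast
qed

text \<open>In the word where \<open>i\<close> and \<open>j\<close> are adjacent, a token that does
  not commute with them stands before or behind both, so the cyclic order is \<open>i, j, k\<close>.
  Invariance carries this back to \<open>X\<close>.\<close>

lemma canc_trip_inv:
  assumes "canc X i j" "distinct (map snd X)" and k: "k \<in> set X" "snd k \<noteq> i" "snd k \<noteq> j"
    and s: "s \<in> set X" "snd s = i" "\<not> E (vt s) (vt k)"
  shows "trip_inv i j (snd k) (keep {i, j, snd k} X)"
proof -
  obtain C D p q where *: "tceq X (C @ p # q # D)" "snd p = i" "snd q = j" "fst q = inv_letter (fst p)"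
    using assms(1) unfolding canc_def by blast
  let ?Y = "C @ p # q # D"
  have dist: "distinct (map snd ?Y)" using tceq_distinct[OF *(1)] assms(2) by simp
  have "(\<lambda>t. (vt t, snd t)) ` set X = (\<lambda>t. (vt t, snd t)) ` set ?Y"
    using mset_eq_setD[OF tceq_ids[OF *(1)]] by (simp only: set_map)
  then obtain k' s' where k': "k' \<in> set ?Y" "vt k' = vt k" "snd k' = snd k"
    and s': "s' \<in> set ?Y" "vt s' = vt s" "snd s' = i"
    using imageI[OF k(1), of "\<lambda>t. (vt t, snd t)"] imageI[OF s(1), of "\<lambda>t. (vt t, snd t)"] s(2)
    by (auto simp del: set_append)
  have "inj_on snd (set ?Y)" using dist by (simp only: distinct_map)
  then have "s' = p" by (rule inj_onD) (use s' * in auto)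
  then have np: "\<not> E (vt p) (vt k')" "\<not> E (vt q) (vt k')" using s' s(3) k' * by auto
  have "trip_inv i j (snd k) (keep {i, j, snd k} ?Y)"
  proof (cases "k' \<in> set C")
    case True
    then obtain C1 C2 where C: "C = C1 @ k' # C2" by (meson split_list)
    have "keep {i, j, snd k} ?Y = [k', p, q]"
      using keep_three[of C1 k' C2 p "[]" q D] dist C * k' by (simp add: insert_commute)
    with np * k' show ?thesis by (simp add: trip_inv_def E_commute[of "vt k"])
  next
    case False
    then have "k' \<in> set D" using k' * k by auto
    then obtain C1 C2 where C: "D = C1 @ k' # C2" by (meson split_list)
    have "keep {i, j, snd k} ?Y = [p, q, k']"
      using keep_three[of C p "[]" q C1 k' C2] dist C * k' by (simp add: insert_commute)
    with np * k' show ?thesis by (simp add: trip_inv_def)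
  qed
  then show ?thesis using trip_inv_tceq[OF keep_tceq[OF *(1)]] by blast
qed

text \<open>A non-commuting token on the wrong side of the pair would violate the cyclic order of
  \<open>canc_trip_inv\<close>. So the pair is visible in \<open>X\<close> itself: it encloses
  commuting tokens only, or it cancels around the end of the word, after a twist.\<close>

lemma canc_cases:
  assumes "canc X i j" "distinct (map snd X)"
  obtains (inner) A p M q B where "X = A @ p # M @ q # B" "snd p = i" "snd q = j"
      "fst q = inv_letter (fst p)" "\<forall>m\<in>set M. E (vt p) (vt m)"
    | (outer) A q M p B where "X = A @ q # M @ p # B" "snd p = i" "snd q = j"
      "fst p = inv_letter (tw (fst q))" "\<forall>m\<in>set A \<union> set B. E (vt p) (vt m)"
proof -
  obtain s t where st: "keep {i, j} X = [s, t]" "vt s = vt t"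
    "snd s = i \<and> snd t = j \<and> fst t = inv_letter (fst s) \<or>
      snd s = j \<and> snd t = i \<and> fst t = inv_letter (tw (fst s))"
    using canc_pair_inv[OF assms] unfolding pair_inv_def by blast
  then obtain A M B where X: "X = A @ s # M @ t # B"
    using filter_eq_two[OF st(1)] by blast
  have ne: "i \<noteq> j" using st(3) assms(2) X by auto
  from st(3) show thesis
  proof (elim disjE conjE)
    assume ij: "snd s = i" "snd t = j" "fst t = inv_letter (fst s)"
    have "E (vt s) (vt m)" if m: "m \<in> set M" for m
    proof (rule ccontr)
      assume nE: "\<not> E (vt s) (vt m)"
      obtain M1 M2 where M: "M = M1 @ m # M2" using m by (meson split_list)
      have d: "snd m \<noteq> i" "snd m \<noteq> j" using assms(2) X M ij by auto
      have k: "keep {i, j, snd m} X = [s, m, t]"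
        using keep_three[of A s M1 m M2 t B] assms(2) X M ij by (simp add: insert_commute)
      have tr: "trip_inv i j (snd m) (keep {i, j, snd m} X)"
        by (rule canc_trip_inv[OF assms, of m s]) (use X M d ij nE in auto)
      show False using trip_inv_ids[OF tr, unfolded k list.map ij(1,2)] d ne by simp
    qed
    then show thesis using inner[OF X] ij by blast
  next
    assume ij: "snd s = j" "snd t = i" "fst t = inv_letter (tw (fst s))"
    have "E (vt t) (vt m)" if m: "m \<in> set A \<union> set B" for m
    proof (rule ccontr)
      assume nE: "\<not> E (vt t) (vt m)"
      have "snd m \<in> snd ` set A \<union> snd ` set B" using m by blast
      moreover have "i \<notin> snd ` set A \<union> snd ` set B" "j \<notin> snd ` set A \<union> snd ` set B"
        using assms(2) X ij(1,2) by simp_all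
      ultimately have d: "snd m \<noteq> i" "snd m \<noteq> j" by metis+
      have tr: "trip_inv i j (snd m) (keep {i, j, snd m} X)"
        by (rule canc_trip_inv[OF assms, of m t]) (use X m d ij nE in auto)
      show False
      proof (cases "m \<in> set A")
        case True
        obtain M1 M2 where M: "A = M1 @ m # M2" using True by (meson split_list)
        have k: "keep {i, j, snd m} X = [m, s, t]"
          using keep_three[of M1 m M2 s M t B] assms(2) X M ij by (simp add: insert_commute)
        show False using trip_inv_ids[OF tr, unfolded k list.map ij(1,2)] d ne by simp
      next
        case False
        then have "m \<in> set B" using m by simp
        then obtain M1 M2 where M: "B = M1 @ m # M2" by (meson split_list)
        have k: "keep {i, j, snd m} X = [s, t, m]"
          using keep_three[of A s M t M1 m M2] assms(2) X M ij by (simp add: insert_commute)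
        show False using trip_inv_ids[OF tr, unfolded k list.map ij(1,2)] d ne by simp
      qed
    qed
    then show thesis using outer[OF X] ij by blast
  qed
qed

lemma canc_tokens:
  assumes "canc X i j" "distinct (map snd X)"
  obtains s t where "s \<in> set X" "t \<in> set X" "snd s = i" "snd t = j" "vt s = vt t" "i \<noteq> j"
  using assms
proof (cases rule: canc_cases)
  case (inner A p M q B)
  with assms(2) show thesis by (intro that[of p q]) auto
next
  case (outer A q M p B)
  with assms(2) show thesis by (intro that[of p q]) auto
qed

text \<open>All three tokens lie over one vertex, so none of them commute. Cancelling
  \<open>i\<close> with \<open>j\<close> forces the cyclic order \<open>i, j, k\<close>, cancelling
  it with \<open>k\<close> forces \<open>i, k, j\<close>.\<close>

lemma canc_right_unique:
  assumes X: "canc X i j" "canc X i k" and dist: "distinct (map snd X)"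
  shows "j = k"
proof (rule ccontr)
  assume jk: "j \<noteq> k"
  obtain s t where s: "s \<in> set X" "t \<in> set X" "snd s = i" "snd t = j" "vt s = vt t" "i \<noteq> j"
    using canc_tokens[OF X(1) dist] .
  obtain s' t' where s': "s' \<in> set X" "t' \<in> set X" "snd s' = i" "snd t' = k" "vt s' = vt t'" "i \<noteq> k"
    using canc_tokens[OF X(2) dist] .
  have "inj_on snd (set X)" using dist by (simp only: distinct_map)
  then have ss: "s = s'" by (rule inj_onD) (use s s' in auto)
  have "trip_inv i j (snd t') (keep {i, j, snd t'} X)"
    by (rule canc_trip_inv[OF X(1) dist, of t' s]) (use s s' jk ss in auto)
  moreover have "trip_inv i k (snd t) (keep {i, k, snd t} X)"
    by (rule canc_trip_inv[OF X(2) dist, of t s']) (use s s' jk ss in auto)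
  ultimately have tr: "trip_inv i j k (keep {i, j, k} X)" "trip_inv i k j (keep {i, j, k} X)"
    using s s' by (simp_all add: insert_commute)
  show False using trip_inv_ids[OF tr(1)] trip_inv_ids[OF tr(2)] s(6) s'(6) jk by auto
qed

lemma canc_left_unique:
  assumes X: "canc X i k" "canc X j k" and dist: "distinct (map snd X)"
  shows "i = j"
proof (rule ccontr)
  assume ij: "i \<noteq> j"
  obtain s t where s: "s \<in> set X" "t \<in> set X" "snd s = i" "snd t = k" "vt s = vt t" "i \<noteq> k"
    using canc_tokens[OF X(1) dist] .
  obtain s' t' where s': "s' \<in> set X" "t' \<in> set X" "snd s' = j" "snd t' = k" "vt s' = vt t'" "j \<noteq> k"
    using canc_tokens[OF X(2) dist] .
  have "inj_on snd (set X)" using dist by (simp only: distinct_map)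
  then have tt: "t = t'" by (rule inj_onD) (use s s' in auto)
  have "trip_inv i k (snd s') (keep {i, k, snd s'} X)"
    by (rule canc_trip_inv[OF X(1) dist, of s' s]) (use s s' ij tt in auto)
  moreover have "trip_inv j k (snd s) (keep {j, k, snd s} X)"
    by (rule canc_trip_inv[OF X(2) dist, of s s']) (use s s' ij tt in auto)
  ultimately have tr: "trip_inv i k j (keep {i, j, k} X)" "trip_inv j k i (keep {i, j, k} X)"
    using s s' by (simp_all add: insert_commute)
  show False using trip_inv_ids[OF tr(1)] trip_inv_ids[OF tr(2)] s(6) s'(6) ij by auto
qed

lemma keep_compl_two:
  assumes "distinct (map snd (A @ x # B @ y # C))"
  shows "keep (- {snd x, snd y}) (A @ x # B @ y # C) = A @ B @ C"
proof -
  have "keep (- {snd x, snd y}) L = L"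
    if "snd x \<notin> snd ` set L" "snd y \<notin> snd ` set L" for L :: "token list"
    unfolding filter_id_conv using that by (metis imageI insertE singletonD ComplI)
  with assms show ?thesis by simp
qed

lemma ceq_rotate: "a # p \<approx> p @ [tw a]"
  by (intro r_into_equivclp cyc_rot)

text \<open>This is the overlap \<open>a a^-1 a\<close>: \<open>i\<close> and \<open>k\<close> carry
  the same letter up to the twist. Once \<open>j\<close> and one of them are deleted, the survivor
  can be moved to the place of the other, past commuting letters or around the end of the
  word.\<close>

lemma canc_chain:
  assumes X: "canc X i j" "canc X j k" and dist: "distinct (map snd X)" and ik: "i \<noteq> k"
  shows "map fst (keep (- {i, j}) X) \<approx> map fst (keep (- {j, k}) X)"
proof -
  obtain C D p q where *: "tceq X (C @ p # q # D)" "snd p = i" "snd q = j" "fst q = inv_letter (fst p)"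
    using X(1) unfolding canc_def by blast
  let ?Y = "C @ p # q # D"
  have distY: "distinct (map snd ?Y)" using tceq_distinct[OF *(1)] dist by simp
  have distinct: "distinct ?Y" using distY unfolding distinct_map by (rule conjunct1)
  have Y1: "keep (- {i, j}) ?Y = C @ D"
    using keep_compl_two[of C p "[]" q D] distY * by simp
  have "map fst (C @ D) \<approx> map fst (keep (- {j, k}) ?Y)"
    using canc_tceq[OF X(2) *(1)] distY
  proof (cases rule: canc_cases)
    case (inner A q' M r B)
    have "inj_on snd (set ?Y)" using distY by (simp only: distinct_map)
    moreover have "q' \<in> set ?Y" unfolding inner(1) by simp
    ultimately have "q' = q" using inj_onD[of snd "set ?Y" q' q] inner(2) *(3) by simp
    moreover have "q \<notin> set A" "q \<notin> set (M @ r # B)"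
      using distinct inner(1) \<open>q' = q\<close> by auto
    ultimately have CD: "A = C @ [p]" "D = M @ r # B"
      using inner(1) append_Cons_eq_iff[of q A "M @ r # B" "C @ [p]" D] by simp_all
    have 1: "keep (- {j, k}) ?Y = C @ p # M @ B"
      using keep_compl_two[of A q' M r B] distY inner CD by simp
    have "fst r = fst p" using inner(4) * \<open>q' = q\<close> by simp
    moreover have "map fst C @ fst p # map fst M @ map fst B \<equiv>\<^sub>t map fst C @ map fst M @ fst p # map fst B"
      by (rule swap_past') (use inner(5) * \<open>q' = q\<close> in auto)
    ultimately show ?thesis unfolding 1 unfolding CD
      using teq_ceq[THEN equivclp_sym] by simp
  next
    case (outer A r M q' B)
    have "inj_on snd (set ?Y)" using distY by (simp only: distinct_map)
    moreover have "q' \<in> set ?Y" unfolding outer(1) by simp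
    ultimately have "q' = q" using inj_onD[of snd "set ?Y" q' q] outer(2) *(3) by simp
    moreover have "q \<notin> set (A @ r # M)" "q \<notin> set B"
      using distinct outer(1) \<open>q' = q\<close> by auto
    ultimately have CD: "A @ r # M = C @ [p]" "D = B"
      using outer(1) append_Cons_eq_iff[of q "A @ r # M" B "C @ [p]" D]
      by simp_all
    have "p \<noteq> r" using outer ik * by auto
    then obtain M' where M: "M = M' @ [p]" "C = A @ r # M'"
      using CD(1) by (cases M rule: rev_cases) auto
    have 1: "keep (- {j, k}) ?Y = A @ M' @ p # B"
      using keep_compl_two[of A r M q' B] distY outer M by (simp add: insert_commute)
    have pr: "fst p = tw (fst r)" using outer(4) * \<open>q' = q\<close>
      by (metis inv_letter_simps(1) tw_simps(3))
    let ?A = "map fst A" and ?M = "map fst M'" and ?B = "map fst B"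
    have comm: "\<forall>m\<in>set A \<union> set B. E (vt r) (vt m)"
      using outer(5) pr * \<open>q' = q\<close> by simp
    \<comment> \<open>The survivor \<open>r\<close> moves to the front, is rotated, which turns its
      letter into that of \<open>p\<close>, and moves back from the end; it only passes letters of
      \<open>A\<close> and \<open>B\<close>.\<close>
    have "?A @ fst r # ?M @ ?B \<equiv>\<^sub>t fst r # ?A @ ?M @ ?B"
      using equivclp_sym[OF swap_past'[of ?A fst "fst r" "[]" "?M @ ?B"]] comm by simp
    moreover have "fst r # ?A @ ?M @ ?B \<approx> ?A @ ?M @ ?B @ [fst p]"
      using ceq_rotate[of "fst r" "?A @ ?M @ ?B"] pr by simp
    moreover have "?A @ ?M @ ?B @ [fst p] \<equiv>\<^sub>t ?A @ ?M @ fst p # ?B"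
      using equivclp_sym[OF swap_past'[of ?B fst "fst p" "?A @ ?M" "[]"]] comm pr by simp
    ultimately have "?A @ fst r # ?M @ ?B \<approx> ?A @ ?M @ fst p # ?B"
      by (meson equivclp_trans teq_ceq)
    then show ?thesis unfolding 1 unfolding CD M by simp
  qed
  moreover have "map fst (keep (- {i, j}) X) \<approx> map fst (C @ D)"
    using tceq_map_fst[OF keep_tceq[OF *(1), of "- {i, j}"]] unfolding Y1 .
  moreover have "map fst (keep (- {j, k}) X) \<approx> map fst (keep (- {j, k}) ?Y)"
    using tceq_map_fst[OF keep_tceq[OF *(1), of "- {j, k}"]] .
  ultimately show ?thesis by (meson equivclp_sym equivclp_trans)
qed

text \<open>Filtering the word in which \<open>i'\<close> and \<open>j'\<close> are adjacent leaves
  them adjacent.\<close>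

lemma canc_disjoint:
  assumes X: "canc X i j" "canc X i' j'" and dist: "distinct (map snd X)"
    and "{i, j} \<inter> {i', j'} = {}"
  shows "canc (keep (- {i, j}) X) i' j'"
proof -
  obtain C D p q where *: "tceq X (C @ p # q # D)" "snd p = i'" "snd q = j'" "fst q = inv_letter (fst p)"
    using X(2) unfolding canc_def by blast
  have "tceq (keep (- {i, j}) X) (keep (- {i, j}) C @ p # q # keep (- {i, j}) D)"
    using keep_tceq[OF *(1), of "- {i, j}"] assms(4) * by simp
  then show ?thesis unfolding canc_def using * by blast
qed

section \<open>Cancellation on classes and its confluence\<close>

definition cred :: "letter list \<Rightarrow> letter list \<Rightarrow> bool" where
  "cred x y \<longleftrightarrow> (\<exists>C a D. x \<approx> C @ a # inv_letter a # D \<and> y \<approx> C @ D)"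

lemma cred_cancD:
  assumes "cred (map fst X) y" "distinct (map snd X)"
  obtains i j where "canc X i j" "y \<approx> map fst (keep (- {i, j}) X)"
proof -
  obtain C a D where *: "map fst X \<approx> C @ a # inv_letter a # D" "y \<approx> C @ D"
    using assms(1) unfolding cred_def by blast
  obtain Y where Y: "map fst Y = C @ a # inv_letter a # D" "tceq X Y"
    using ceq_lift[OF *(1)] by blast
  then obtain C' R where R: "Y = C' @ R" "map fst C' = C" "map fst R = a # inv_letter a # D"
    using map_eq_append_conv[THEN iffD1, OF Y(1)] by metis
  then obtain p R' where R': "R = p # R'" "fst p = a" "map fst R' = inv_letter a # D"
    by (cases R) auto
  then obtain q D' where D': "R' = q # D'" "fst q = inv_letter a" "map fst D' = D"
    by (cases R') auto
  have Y': "Y = C' @ p # q # D'" "map fst C' = C" "fst p = a" "fst q = inv_letter a" "map fst D' = D"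
    using R R' D' by simp_all
  have distY: "distinct (map snd Y)" using tceq_distinct[OF Y(2)] assms(2) by simp
  have "canc X (snd p) (snd q)" unfolding canc_def using Y Y' by blast
  moreover have "keep (- {snd p, snd q}) Y = C' @ D'"
    using keep_compl_two[of C' p "[]" q D'] distY Y' by simp
  then have "map fst (keep (- {snd p, snd q}) X) \<approx> C @ D"
    using tceq_map_fst[OF keep_tceq[OF Y(2)]] Y' by (metis map_append)
  with *(2) have "y \<approx> map fst (keep (- {snd p, snd q}) X)"
    by (meson equivclp_sym equivclp_trans)
  ultimately show thesis by (rule that)
qed

lemma canc_cred:
  assumes "canc X i j" "distinct (map snd X)"
  shows "cred (map fst X) (map fst (keep (- {i, j}) X))"
proof -
  obtain C D p q where *: "tceq X (C @ p # q # D)" "snd p = i" "snd q = j" "fst q = inv_letter (fst p)"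
    using assms(1) unfolding canc_def by blast
  let ?Y = "C @ p # q # D"
  have distY: "distinct (map snd ?Y)" using tceq_distinct[OF *(1)] assms(2) by simp
  have "keep (- {i, j}) ?Y = C @ D"
    using keep_compl_two[of C p "[]" q D] distY * by simp
  then have "map fst (keep (- {i, j}) X) \<approx> map fst C @ map fst D"
    using tceq_map_fst[OF keep_tceq[OF *(1)]] by (metis map_append)
  then show ?thesis unfolding cred_def using tceq_map_fst[OF *(1)] *
    by (intro exI[of _ "map fst C"] exI[of _ "fst p"] exI[of _ "map fst D"]) simp
qed

lemma cred_ceq: "cred x y \<Longrightarrow> x \<approx> x' \<Longrightarrow> y \<approx> y' \<Longrightarrow> cred x' y'"
  unfolding cred_def by (meson equivclp_sym equivclp_trans)

lemma cred_diamond: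
  assumes "cred x y" "cred x z"
  shows "y \<approx> z \<or> (\<exists>w. cred y w \<and> cred z w)"
proof -
  define X where "X = zip x [0..<length x]"
  have X: "map fst X = x" "distinct (map snd X)" by (simp_all add: X_def)
  obtain i j where ij: "canc X i j" "y \<approx> map fst (keep (- {i, j}) X)"
    using cred_cancD[of X y] assms X by blast
  obtain i' j' where ij': "canc X i' j'" "z \<approx> map fst (keep (- {i', j'}) X)"
    using cred_cancD[of X z] assms X by blast
  show ?thesis
  proof (cases "{i, j} \<inter> {i', j'} = {}")
    case True
    let ?Y = "keep (- {i, j}) X" and ?Z = "keep (- {i', j'}) X"
    have "cred (map fst ?Y) (map fst (keep (- {i', j'}) ?Y))"
      by (intro canc_cred canc_disjoint[OF ij(1) ij'(1) X(2) True] distinct_map_filter X(2))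
    moreover have "cred (map fst ?Z) (map fst (keep (- {i, j}) ?Z))"
      by (intro canc_cred canc_disjoint[OF ij'(1) ij(1) X(2)] distinct_map_filter X(2))
         (use True in auto)
    moreover have "keep (- {i, j}) ?Z = keep (- {i', j'}) ?Y"
      by (auto intro!: filter_cong)
    ultimately have "cred y (map fst (keep (- {i', j'}) ?Y))" "cred z (map fst (keep (- {i', j'}) ?Y))"
      using cred_ceq[OF _ equivclp_sym[OF ij(2)] equivclp_refl] cred_ceq[OF _ equivclp_sym[OF ij'(2)] equivclp_refl]
      by simp_all
    then show ?thesis by blast
  next
    case False
    have "map fst (keep (- {i, j}) X) \<approx> map fst (keep (- {i', j'}) X)"
    proof -
      \<comment> \<open>A shared token in the same role makes the pairs equal by uniqueness of the
        partner. In different roles the two pairs form a chain, or are the same two tokens in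
        opposite order.\<close>
      consider "i = i'" | "j = j'" | "j = i'" | "i = j'" using False by auto
      then show ?thesis
      proof cases
        case 1
        then show ?thesis using canc_right_unique[OF ij(1) _ X(2)] ij'(1) by auto
      next
        case 2
        then show ?thesis using canc_left_unique[OF ij(1) _ X(2)] ij'(1) by auto
      next
        case 3
        with ij'(1) have "canc X j j'" by simp
        with 3 canc_chain[OF ij(1) this X(2)] show ?thesis
          by (cases "i = j'") (simp_all add: insert_commute)
      next
        case 4
        with ij(1) have "canc X j' j" by simp
        with 4 equivclp_sym[OF canc_chain[OF ij'(1) this X(2)]] show ?thesis
          by (cases "i' = j") (simp_all add: insert_commute)
      qed
    qed
    then show ?thesis using ij(2) ij'(2) by (meson equivclp_sym equivclp_trans)
  qed
qed

text \<open>Counting \<open>\<approx>\<close> itself as a step turns both alternatives of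
  \<open>cred_diamond\<close> into a common one-step successor, which is strong confluence.\<close>

definition conj_step :: "letter list \<Rightarrow> letter list \<Rightarrow> bool" where
  "conj_step x y \<longleftrightarrow> x \<approx> y \<or> cred x y"

lemma confluentp_conj_step: "confluentp conj_step"
proof (rule strong_confluentp_imp_confluentp, rule strong_confluentpI)
  fix x y z
  assume "conj_step x y" "conj_step x z"
  then have "\<exists>u. conj_step y u \<and> conj_step z u"
    unfolding conj_step_def
  proof (elim disjE)
    assume "x \<approx> y" "x \<approx> z"
    then show "\<exists>u. (y \<approx> u \<or> cred y u) \<and> (z \<approx> u \<or> cred z u)"
      by (metis equivclp_sym)
  next
    assume "x \<approx> y" "cred x z"
    then show "\<exists>u. (y \<approx> u \<or> cred y u) \<and> (z \<approx> u \<or> cred z u)"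
      using cred_ceq equivclp_refl by metis
  next
    assume "cred x y" "x \<approx> z"
    then show "\<exists>u. (y \<approx> u \<or> cred y u) \<and> (z \<approx> u \<or> cred z u)"
      using cred_ceq equivclp_refl by metis
  next
    assume "cred x y" "cred x z"
    then show "\<exists>u. (y \<approx> u \<or> cred y u) \<and> (z \<approx> u \<or> cred z u)"
      using cred_diamond equivclp_refl by metis
  qed
  then show "\<exists>u. conj_step\<^sup>*\<^sup>* y u \<and> conj_step\<^sup>=\<^sup>= z u" by blast
qed

lemma irreducible_conj:
  assumes "equivclp conj_step x y" "\<nexists>z. cred x z" "\<nexists>z. cred y z"
  shows "x \<approx> y"
proof -
  have irr: "x \<approx> z" if "conj_step\<^sup>*\<^sup>* x z" "\<nexists>z. cred x z" for x z
    using that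
  proof induction
    case (step y z)
    then have "x \<approx> y" by simp
    with step.prems cred_ceq[OF _ equivclp_sym[of _ x y] equivclp_refl] have "\<not> cred y z" by blast
    with step.hyps(2) have "y \<approx> z" unfolding conj_step_def by simp
    with \<open>x \<approx> y\<close> show ?case by (rule equivclp_trans)
  qed simp
  have "(conj_step\<^sup>*\<^sup>* OO conj_step\<inverse>\<inverse>\<^sup>*\<^sup>*) x y"
    using assms(1) semiconfluentp_equivclp confluentp_conj_step
    by (metis confluentp_imp_semiconfluentp)
  then obtain z where "conj_step\<^sup>*\<^sup>* x z" "conj_step\<^sup>*\<^sup>* y z"
    by (auto simp: rtranclp_conversep)
  then show ?thesis using irr assms(2,3) by (meson equivclp_sym equivclp_trans)
qed

end

section \<open>Twisted conjugacy classes and pilings\<close>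

lemma inv_word_simps [simp]:
  "inv_word [] = []" "inv_word (x @ y) = inv_word y @ inv_word x"
  "inv_word (l # x) = inv_word x @ [inv_letter l]" "inv_word (inv_word x) = x"
  by (simp_all add: inv_word_def rev_map comp_def)

lemma set_inv_word: "set (inv_word x) = inv_letter ` set x"
  by (simp add: inv_word_def)

lemma letters_inv_letter [simp]: "inv_letter l \<in> letters n \<longleftrightarrow> l \<in> letters n"
  by (simp add: letters_def)

lemma letters_inv_word [simp]: "set (inv_word x) \<subseteq> letters n \<longleftrightarrow> set x \<subseteq> letters n"
  by (auto simp: set_inv_word)

lemma raag_step_ctxt:
  assumes "raag_step n E x y"
  shows "raag_step n E (A @ x @ B) (A @ y @ B)"
  using assms
proof induction
  case (cancel a p q)
  then show ?case using raag_step.cancel[of a n E "A @ p" "q @ B"] by simp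
next
  case (commute a b p q)
  then show ?case using raag_step.commute[of a n b E "A @ p" "q @ B"] by simp
qed

lemma raag_eq_ctxt: "raag_eq n E x y \<Longrightarrow> raag_eq n E (A @ x @ B) (A @ y @ B)"
  unfolding raag_eq_def
  using equivclp_map[of "raag_step n E" x y "raag_step n E" "\<lambda>x. A @ x @ B"]
  by (auto intro: r_into_equivclp raag_step_ctxt)

lemma raag_eq_refl [simp]: "raag_eq n E x x"
  by (simp add: raag_eq_def)

lemma raag_eq_sym: "raag_eq n E x y \<Longrightarrow> raag_eq n E y x"
  unfolding raag_eq_def by (rule equivclp_sym)

lemma raag_eq_trans: "raag_eq n E x y \<Longrightarrow> raag_eq n E y z \<Longrightarrow> raag_eq n E x z"
  unfolding raag_eq_def by (rule equivclp_trans)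

lemma raag_eq_inverse_right:
  "set w \<subseteq> letters n \<Longrightarrow> raag_eq n E (A @ w @ inv_word w @ B) (A @ B)"
proof (induction w arbitrary: A B)
  case (Cons l w)
  have "raag_eq n E ((A @ [l]) @ w @ inv_word w @ (inv_letter l # B)) ((A @ [l]) @ inv_letter l # B)"
    by (rule Cons.IH) (use Cons.prems in simp)
  moreover have "raag_eq n E (A @ [l, inv_letter l] @ B) (A @ B)"
    unfolding raag_eq_def using Cons.prems
    by (intro r_into_equivclp raag_step.cancel) (auto simp: letters_def)
  ultimately have "raag_eq n E ((A @ [l]) @ w @ inv_word w @ (inv_letter l # B)) (A @ B)"
    by (auto intro: raag_eq_trans)
  then show ?case by simp
qed simp

lemma raag_eq_inverse_left:
  "set w \<subseteq> letters n \<Longrightarrow> raag_eq n E (A @ inv_word w @ w @ B) (A @ B)"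
  using raag_eq_inverse_right[of "inv_word w"] by simp

section \<open>Twisted conjugacy as the equivalence generated by \<open>conj_step\<close>\<close>

context raag
begin

lemma letters_map_tw [simp]: "set (map tw x) \<subseteq> letters n \<longleftrightarrow> set x \<subseteq> letters n"
  by (auto simp: letters_def)

lemma map_tw_inv_word [simp]: "inv_word (map tw x) = map tw (inv_word x)"
  by (simp add: inv_word_def rev_map comp_def)

lemma map_tw_map_tw [simp]: "map tw (map tw x) = x" "map (tw \<circ> tw) x = x"
  by (simp_all add: comp_def)

abbreviation tconj :: "nat \<Rightarrow> letter list \<Rightarrow> letter list \<Rightarrow> bool" where
  "tconj n \<equiv> twisted_conj n E (map tw)"

lemma tconj_raag_eq: "raag_eq n E v u \<Longrightarrow> tconj n u v"
  unfolding twisted_conj_def by (intro exI[of _ "[]"]) simp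

lemma tconj_sym:
  assumes "tconj n u v"
  shows "tconj n v u"
proof -
  obtain w where w: "set w \<subseteq> letters n" "raag_eq n E v (inv_word (map tw w) @ u @ w)"
    using assms unfolding twisted_conj_def by blast
  have 1: "raag_eq n E (map tw w @ v @ inv_word w) (map tw w @ (inv_word (map tw w) @ u @ w) @ inv_word w)"
    by (rule raag_eq_ctxt[OF w(2)])
  have 2: "raag_eq n E ([] @ map tw w @ inv_word (map tw w) @ (u @ w @ inv_word w)) ([] @ (u @ w @ inv_word w))"
    by (rule raag_eq_inverse_right) (simp only: letters_map_tw w(1))
  have 3: "raag_eq n E (u @ w @ inv_word w @ []) (u @ [])"
    by (rule raag_eq_inverse_right[OF w(1)])
  have "raag_eq n E (map tw w @ v @ inv_word w) u"
    using raag_eq_trans[OF 1] raag_eq_trans[OF 2] 3 by simp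
  then show ?thesis unfolding twisted_conj_def
    by (intro exI[of _ "inv_word w"]) (use w(1) in \<open>auto intro: raag_eq_sym\<close>)
qed

lemma tconj_trans:
  assumes "tconj n u v" "tconj n v z"
  shows "tconj n u z"
proof -
  obtain w where w: "set w \<subseteq> letters n" "raag_eq n E v (inv_word (map tw w) @ u @ w)"
    using assms(1) unfolding twisted_conj_def by blast
  obtain w' where w': "set w' \<subseteq> letters n" "raag_eq n E z (inv_word (map tw w') @ v @ w')"
    using assms(2) unfolding twisted_conj_def by blast
  have "raag_eq n E z (inv_word (map tw (w @ w')) @ u @ (w @ w'))"
    using raag_eq_trans[OF w'(2) raag_eq_ctxt[OF w(2)]] by simp
  then show ?thesis unfolding twisted_conj_def using w(1) w'(1)
    by (intro exI[of _ "w @ w'"]) simp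
qed

text \<open>The conjugator is \<open>tw a\<close>: its twist is \<open>a\<close>, whose inverse
  removes the leading letter.\<close>

lemma tconj_rot: "a \<in> letters n \<Longrightarrow> tconj n (a # p) (p @ [tw a])"
  unfolding twisted_conj_def
  using raag_eq_inverse_left[of "[a]" n E "[]" "p @ [tw a]"]
  by (intro exI[of _ "[tw a]"]) (auto simp: letters_def raag_eq_sym)

lemma swap_letters: "swap fst x y \<Longrightarrow> set x = set y"
  by (induction rule: swap.induct) auto

lemma swap_raag_eq: "swap fst x y \<Longrightarrow> set x \<subseteq> letters n \<Longrightarrow> raag_eq n E x y"
proof (induction rule: swap.induct)
  case (swapI a b p q)
  then show ?case unfolding raag_eq_def
    by (intro r_into_equivclp raag_step.commute) (auto simp: letters_def)
qed

lemma cyc_letters: "cyc fst tw x y \<Longrightarrow> set x \<subseteq> letters n \<longleftrightarrow> set y \<subseteq> letters n"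
  by (induction rule: cyc.induct) (auto simp: letters_def dest: swap_letters)

lemma ceq_letters: "x \<approx> y \<Longrightarrow> set x \<subseteq> letters n \<longleftrightarrow> set y \<subseteq> letters n"
  by (erule equivclp_invariant) (rule cyc_letters)

lemma cyc_tconj: "cyc fst tw x y \<Longrightarrow> set x \<subseteq> letters n \<Longrightarrow> tconj n x y"
proof (induction rule: cyc.induct)
  case (cyc_swap x y)
  then show ?case by (rule tconj_raag_eq[OF raag_eq_sym[OF swap_raag_eq]])
qed (auto intro: tconj_rot)

lemma ceq_tconj: "x \<approx> y \<Longrightarrow> set x \<subseteq> letters n \<Longrightarrow> tconj n x y"
proof (induction rule: equivclp_induct)
  case base
  show ?case by (rule tconj_raag_eq) simp
next
  case (step y z)
  have "set y \<subseteq> letters n" "set z \<subseteq> letters n"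
    using ceq_letters[OF step.hyps(1)] cyc_letters step.hyps(2) step.prems by blast+
  then have "tconj n y z" using step.hyps(2) cyc_tconj tconj_sym by blast
  with step show ?case using tconj_trans by blast
qed

lemma ceq_rotate_word: "A @ x \<approx> x @ map tw A"
proof (induction A arbitrary: x)
  case (Cons a A)
  have "a # A @ x \<approx> A @ x @ [tw a]" using ceq_rotate[of a "A @ x"] by simp
  also have "A @ x @ [tw a] \<approx> (x @ [tw a]) @ map tw A" using Cons .
  finally (equivclp_trans) show ?case by simp
qed simp

lemma conj_step_ceq: "x \<approx> y \<Longrightarrow> equivclp conj_step x y"
  by (intro r_into_equivclp) (simp add: conj_step_def)

lemma conj_step_cred: "equivclp conj_step (C @ a # inv_letter a # D) (C @ D)"
proof -
  have "cred (C @ a # inv_letter a # D) (C @ D)"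
    unfolding cred_def by (intro exI[of _ C] exI[of _ a] exI[of _ D] conjI equivclp_refl)
  then show ?thesis by (intro r_into_equivclp) (simp add: conj_step_def)
qed

lemma raag_eq_conj_step: "raag_eq n E x y \<Longrightarrow> equivclp conj_step x y"
  unfolding raag_eq_def
proof (rule equivclp_map[where g = id, simplified])
  fix a b assume "raag_step n E a b"
  then show "equivclp conj_step a b"
  proof induction
    case (cancel a p q)
    then show ?case using conj_step_cred by simp
  next
    case (commute a b p q)
    then show ?case using swapI[of fst a b p q]
      by (intro conj_step_ceq teq_ceq r_into_equivclp) simp
  qed
qed

lemma conj_step_inverse: "equivclp conj_step (u @ w @ inv_word w) u"
proof (induction w arbitrary: u)
  case (Cons l w)
  \<comment> \<open>The induction hypothesis allows a context on the left only, so the last letter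
    is rotated to the front, and rotated back after \<open>w\<close> has collapsed.\<close>
  have "(u @ [l]) @ w @ inv_word w @ [inv_letter l] \<approx> [tw (inv_letter l)] @ (u @ [l]) @ w @ inv_word w"
    using equivclp_sym[OF ceq_rotate_word[of "[tw (inv_letter l)]" "(u @ [l]) @ w @ inv_word w"]]
    by simp
  then have "equivclp conj_step ((u @ [l]) @ w @ inv_word w @ [inv_letter l])
    ([tw (inv_letter l)] @ (u @ [l]) @ w @ inv_word w)" by (rule conj_step_ceq)
  also have "equivclp conj_step ([tw (inv_letter l)] @ (u @ [l]) @ w @ inv_word w) ([tw (inv_letter l)] @ u @ [l])"
    using Cons.IH[of "[tw (inv_letter l)] @ u @ [l]"] by simp
  also have "equivclp conj_step ([tw (inv_letter l)] @ u @ [l]) (u @ [l, inv_letter l])"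
    using ceq_rotate_word[of "[tw (inv_letter l)]" "u @ [l]"] by (intro conj_step_ceq) simp
  also have "equivclp conj_step (u @ [l, inv_letter l]) u"
    using conj_step_cred[of u l "[]"] by simp
  finally (equivclp_trans) show ?case by simp
qed simp

text \<open>Rotating the prefix \<open>inv_word (map tw w)\<close> to the end undoes its twist and
  yields \<open>u @ w @ inv_word w\<close>, which collapses by cancellations.\<close>

lemma tconj_conj_step:
  assumes "tconj n u v"
  shows "equivclp conj_step u v"
proof -
  obtain w where w: "set w \<subseteq> letters n" "raag_eq n E v (inv_word (map tw w) @ u @ w)"
    using assms unfolding twisted_conj_def by blast
  have "inv_word (map tw w) @ u @ w \<approx> u @ w @ inv_word w"
    using ceq_rotate_word[of "inv_word (map tw w)" "u @ w"] by simp
  then show ?thesis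
    using raag_eq_conj_step[OF w(2)] conj_step_ceq conj_step_inverse
    by (meson equivclp_sym equivclp_trans)
qed

definition red :: "letter list \<Rightarrow> bool" where
  "red w \<longleftrightarrow> \<not> (\<exists>A p M B. w = A @ p # M @ inv_letter p # B \<and> (\<forall>m\<in>set M. E (fst p) (fst m)))"

text \<open>Here \<open>q\<close> can be moved to the front and \<open>inv_letter (tw q)\<close> to
  the end; rotating \<open>q\<close> then places \<open>tw q\<close> directly behind its
  inverse.\<close>

definition end_pair :: "nat \<Rightarrow> letter list \<Rightarrow> bool" where
  "end_pair b w \<longleftrightarrow> (\<exists>A q M B. fst q = b \<and> w = A @ q # M @ inv_letter (tw q) # B \<and>
     (\<forall>m\<in>set A \<union> set B. E (fst q) (fst m)))"

definition end_red :: "letter list \<Rightarrow> bool" where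
  "end_red w \<longleftrightarrow> (\<forall>b. \<not> end_pair b w)"

text \<open>Suppose a cancelling pair of \<open>A @ M\<close> surrounds the place of
  \<open>x\<close>. One member lies on the side that \<open>x\<close> commutes with, so
  \<open>x\<close> commutes with the vertex of the pair, and the pair already violates
  \<open>red\<close> before the deletion.\<close>

lemma red_remove:
  assumes "red (A @ x # M)" "(\<forall>m\<in>set M. E (fst x) (fst m)) \<or> (\<forall>m\<in>set A. E (fst x) (fst m))"
  shows "red (A @ M)"
  unfolding red_def
proof (intro notI, elim exE conjE)
  fix C p N D
  assume eq: "A @ M = C @ p # N @ inv_letter p # D" and N: "\<forall>m\<in>set N. E (fst p) (fst m)"
  have no: "A @ x # M \<noteq> C' @ p # N' @ inv_letter p # D'" if "\<forall>m\<in>set N'. E (fst p) (fst m)" for C' N' D'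
    using assms(1) that unfolding red_def by blast
  show False
    using eq
  proof (elim append_eq_append_conv2[THEN iffD1, THEN exE] disjE conjE)
    fix us assume us: "A = C @ us" "us @ M = p # N @ inv_letter p # D"
    show False
    proof (cases us)
      case Nil
      with us no[OF N, of "C @ [x]" D] show False by simp
    next
      case (Cons p' us')
      then have us': "A = C @ p # us'" "us' @ M = N @ inv_letter p # D" using us by auto
      from us'(2) show False
      proof (elim append_eq_append_conv2[THEN iffD1, THEN exE] disjE conjE)
        fix vs assume vs: "us' = N @ vs" "vs @ M = inv_letter p # D"
        show False
        proof (cases vs)
          case Nil
          with vs have M: "M = inv_letter p # D" "us' = N" by auto
          then have "E (fst p) (fst x)" using assms(2) us'(1) E_sym by auto
          then show False using no[of "N @ [x]" C D] N M us' by auto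
        next
          case (Cons q vs')
          then show False using vs us' no[OF N, of C "vs' @ x # M"] by auto
        qed
      next
        fix vs assume vs: "us' @ vs = N" "M = vs @ inv_letter p # D"
        then have "E (fst p) (fst x)" using assms(2) us'(1) E_sym by auto
        then show False using no[of "us' @ x # vs" C D] N vs us' by auto
      qed
    qed
  next
    fix us assume us: "A @ us = C" "M = us @ p # N @ inv_letter p # D"
    with no[OF N, of "A @ x # us" D] show False by simp
  qed
qed

text \<open>The two alternatives of \<open>canc_cases\<close> are exactly what \<open>red\<close>
  and \<open>end_red\<close> exclude.\<close>

lemma irreducible_if_red:
  assumes "red w" "end_red w"
  shows "\<not> cred w z"
proof
  assume "cred w z"
  define X where "X = zip w [0..<length w]"
  have X: "map fst X = w" "distinct (map snd X)" by (simp_all add: X_def)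
  obtain i j where "canc X i j" using cred_cancD[of X z] \<open>cred w z\<close> X by blast
  then show False
    using X(2)
  proof (cases rule: canc_cases)
    case (inner A p M q B)
    then have "w = map fst A @ fst p # map fst M @ inv_letter (fst p) # map fst B"
      using X(1) by auto
    moreover have "\<forall>m\<in>set (map fst M). E (fst (fst p)) (fst m)" using inner(5) by simp
    ultimately show False using assms(1) unfolding red_def by blast
  next
    case (outer A q M p B)
    then have "w = map fst A @ fst q # map fst M @ inv_letter (tw (fst q)) # map fst B"
      using X(1) by auto
    moreover have "fst (fst p) = fst (fst q)" using outer(4) by simp
    then have "\<forall>m\<in>set (map fst A) \<union> set (map fst B). E (fst (fst q)) (fst m)"
      using outer(5) by (simp add: ball_Un)
    ultimately show False using assms(2) unfolding end_red_def end_pair_def by blast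
  qed
qed

text \<open>0 stays free for spacers, and inverting a letter becomes \<open>3 - d\<close>.\<close>

definition dg :: "bool \<Rightarrow> nat" where
  "dg b = (if b then 1 else 2)"

lemma dg_simps [simp]: "dg b \<noteq> 0" "dg b < 3" "dg (\<not> b) = 3 - dg b" "dg a = dg b \<longleftrightarrow> a = b"
  by (auto simp: dg_def)

text \<open>The stack over vertex \<open>a\<close> in the piling of Crisp, Godelle and Wiest, with spacers 0.
  Non-commutation includes \<open>a\<close> itself, as \<open>E\<close> is irreflexive.\<close>

definition proj :: "nat \<Rightarrow> letter list \<Rightarrow> nat list" where
  "proj a w = map (\<lambda>l. if fst l = a then dg (snd l) else 0) (filter (\<lambda>l. \<not> E a (fst l)) w)"

lemma proj_simps [simp]:
  "proj a [] = []" "proj a (x @ y) = proj a x @ proj a y"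
  "proj a (l # x) = (if E a (fst l) then proj a x else (if fst l = a then dg (snd l) else 0) # proj a x)"
  by (simp_all add: proj_def)

lemma proj_teq: "x \<equiv>\<^sub>t y \<Longrightarrow> proj a x = proj a y"
proof (erule equivclp_invariant)
  show "proj a x = proj a y" if "swap fst x y" for x y :: "letter list"
    using that
  proof induction
    case (swapI b c p q)
    then have "b = c \<or> fst b \<noteq> fst c" by auto
    with swapI show ?case by (auto dest: E_sym)
  qed
qed

text \<open>A letter before \<open>l\<close> that does not commute with \<open>a\<close> would have
  left a digit on top of \<open>d\<close>.\<close>

lemma proj_first:
  assumes "proj a w = d # r" "d \<noteq> 0"
  shows "\<exists>A l B. w = A @ l # B \<and> fst l = a \<and> dg (snd l) = d \<and> (\<forall>m\<in>set A. E a (fst m))"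
  using assms
proof (induction w)
  case (Cons l w)
  show ?case
  proof (cases "E a (fst l)")
    case True
    with Cons obtain A l' B where "w = A @ l' # B \<and> fst l' = a \<and> dg (snd l') = d \<and> (\<forall>m\<in>set A. E a (fst m))"
      by auto
    with True show ?thesis by (intro exI[of _ "l # A"] exI[of _ l'] exI[of _ B]) auto
  next
    case False
    with Cons show ?thesis by (intro exI[of _ "[]"] exI[of _ l] exI[of _ w]) (auto split: if_splits)
  qed
qed simp

lemma proj_last:
  assumes "proj a w = r @ [d]" "d \<noteq> 0"
  shows "\<exists>A l B. w = A @ l # B \<and> fst l = a \<and> dg (snd l) = d \<and> (\<forall>m\<in>set B. E a (fst m))"
  using assms
proof (induction w rule: rev_induct)
  case (snoc l w)
  show ?case
  proof (cases "E a (fst l)")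
    case True
    with snoc obtain A l' B where "w = A @ l' # B \<and> fst l' = a \<and> dg (snd l') = d \<and> (\<forall>m\<in>set B. E a (fst m))"
      by auto
    with True show ?thesis by (intro exI[of _ A] exI[of _ l'] exI[of _ "B @ [l]"]) auto
  next
    case False
    with snoc show ?thesis by (intro exI[of _ w] exI[of _ l] exI[of _ "[]"]) (auto split: if_splits)
  qed
qed simp

text \<open>Pilings are faithful: the first letter of \<open>x\<close> is on top of its own stack,
  hence can be moved to the front of \<open>y\<close> as well, and induction handles the
  rest.\<close>

lemma teq_if_proj:
  assumes "fst ` set x \<subseteq> D" "fst ` set y \<subseteq> D" "\<And>a. a \<in> D \<Longrightarrow> proj a x = proj a y"
  shows "x \<equiv>\<^sub>t y"
  using assms
proof (induction x arbitrary: y)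
  case Nil
  show ?case
  proof (cases y)
    case (Cons l z)
    with Nil.prems(2) Nil.prems(3)[of "fst l"] show ?thesis by simp
  qed simp
next
  case (Cons l x)
  have "proj (fst l) y = dg (snd l) # proj (fst l) x"
    using Cons.prems(1) Cons.prems(3)[of "fst l"] by auto
  from proj_first[OF this] obtain A l' B where y: "y = A @ l' # B" "fst l' = fst l" "dg (snd l') = dg (snd l)"
    "\<forall>m\<in>set A. E (fst l) (fst m)" by auto
  then have l': "l' = l" by (simp add: prod_eq_iff)
  have eq: "y \<equiv>\<^sub>t l # A @ B"
    using equivclp_sym[OF swap_past'[of A fst l "[]" B]] y l' by simp
  have "x \<equiv>\<^sub>t A @ B"
  proof (rule Cons.IH)
    show "fst ` set x \<subseteq> D" "fst ` set (A @ B) \<subseteq> D" using Cons.prems y by auto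
    show "proj a x = proj a (A @ B)" if "a \<in> D" for a
      using Cons.prems(3)[OF that] proj_teq[OF eq, of a] by (auto split: if_splits)
  qed
  then have "l # x \<equiv>\<^sub>t l # A @ B" using teq_ctxt[where A = "[l]" and B = "[]"] by simp
  with eq show ?case by (meson equivclp_sym equivclp_trans)
qed

end

section \<open>Twisted rotations of pilings\<close>

text \<open>The equation makes \<open>W\<close> a prefix of \<open>U U U ...\<close>. Every full
  copy of \<open>U\<close> contains \<open>c\<close>, so \<open>W\<close> holds at most
  \<open>k\<close> full copies, and a last partial copy adds at most one more share of
  \<open>b\<close>.\<close>

lemma count_list_periodic:
  assumes "W @ U' = U @ W" "count_list U c > 0" "count_list W c \<le> k * count_list U c"
  shows "count_list W b \<le> Suc k * count_list U b"
  using assms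
proof (induction "length W" arbitrary: W k rule: less_induct)
  case less
  show ?case
  proof (cases "length W \<le> length U")
    case True
    then have "U = W @ drop (length W) U"
      using less.prems(1) by (metis append_eq_append_conv_if append_take_drop_id)
    then have "count_list W b \<le> count_list U b" by (metis count_list_append le_add1)
    then show ?thesis by simp
  next
    case False
    then obtain W1 where W1: "W = U @ W1"
      using less.prems(1) by (metis append_eq_append_conv_if append_take_drop_id nat_le_linear)
    obtain k' where k: "k = Suc k'"
      using less.prems(2,3) W1 by (cases k) auto
    have "count_list W1 b \<le> Suc k' * count_list U b"
    proof (rule less.hyps)
      show "length W1 < length W" using W1 less.prems(2) by (cases U) auto
    qed (use less.prems W1 k in auto)
    then show ?thesis using W1 k by simp
  qed
qed

context raag
begin

lemma ceq_mset: "x \<approx> y \<Longrightarrow> mset (map fst x) = mset (map fst y)"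
proof (erule equivclp_invariant)
  show "mset (map fst x) = mset (map fst y)" if "cyc fst tw x y" for x y :: "letter list"
    using that by cases (simp_all add: swap_ids)
qed

lemma ceq_length: "x \<approx> y \<Longrightarrow> length x = length y"
  by (drule ceq_mset) (metis length_map size_mset)

lemma ceq_fst: "x \<approx> y \<Longrightarrow> fst ` set x = fst ` set y"
  by (drule ceq_mset) (metis set_map set_mset_mset)

lemma teq_pair_word:
  assumes "x \<equiv>\<^sub>t y" "\<not> E b c"
  shows "map fst (filter (\<lambda>l. fst l \<in> {b, c}) x) = map fst (filter (\<lambda>l. fst l \<in> {b, c}) y)"
  using assms(1)
proof (rule equivclp_invariant)
  fix x y :: "letter list" assume "swap fst x y"
  then show "map fst (filter (\<lambda>l. fst l \<in> {b, c}) x) = map fst (filter (\<lambda>l. fst l \<in> {b, c}) y)"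
  proof induction
    case (swapI k l p q)
    then have "\<not> (fst k \<in> {b, c} \<and> fst l \<in> {b, c})" using assms(2) E_commute[of c b] by auto
    then show ?case by auto
  qed
qed

definition acc :: "nat \<Rightarrow> (nat \<Rightarrow> nat list) \<Rightarrow> bool" where
  "acc b \<sigma> \<longleftrightarrow> \<sigma> b \<noteq> [] \<and> hd (\<sigma> b) \<noteq> 0"

definition td :: "nat \<Rightarrow> nat \<Rightarrow> nat" where
  "td b d = (if b \<in> S then 3 - d else d)"

lemma dg_tw: "dg (snd (tw l)) = td (fst l) (dg (snd l))"
  by (simp add: tw_def td_def inv_letter_def)

definition noncomm :: "nat set \<Rightarrow> nat \<Rightarrow> nat \<Rightarrow> bool" where
  "noncomm V b c \<longleftrightarrow> b \<in> V \<and> c \<in> V \<and> b \<noteq> c \<and> \<not> E b c"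

end

text \<open>\<open>\<kappa>\<close> bounds the distance from the root \<open>a\<close> in the
  non-commutation graph on \<open>D\<close>; it becomes the factor in the number of rotations
  possible without the root.\<close>

locale raag_component = raag +
  fixes D :: "nat list" and a \<kappa> :: nat
  assumes a: "a \<in> set D"
    and reach: "b \<in> set D \<Longrightarrow> \<exists>j\<le>\<kappa>. (noncomm (set D) ^^ j) a b"
begin

definition rot :: "nat \<Rightarrow> (nat \<Rightarrow> nat list) \<Rightarrow> nat \<Rightarrow> nat list" where
  "rot b \<sigma> = (\<lambda>c. if c \<notin> set D \<or> E b c then \<sigma> c
     else tl (\<sigma> c) @ [if c = b then td b (hd (\<sigma> c)) else 0])"

definition pil :: "letter list \<Rightarrow> nat \<Rightarrow> nat list" where
  "pil x = (\<lambda>c. if c \<in> set D then proj c x else [])"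

abbreviation over :: "letter list \<Rightarrow> bool" where
  "over x \<equiv> fst ` set x \<subseteq> set D"

lemma pil_teq: "x \<equiv>\<^sub>t y \<Longrightarrow> pil x = pil y"
  by (rule ext) (simp add: pil_def proj_teq[of x y])

lemma pil_eq_iff: "over x \<Longrightarrow> over y \<Longrightarrow> pil x = pil y \<longleftrightarrow> x \<equiv>\<^sub>t y"
proof
  assume "over x" "over y" "pil x = pil y"
  show "x \<equiv>\<^sub>t y"
  proof (rule teq_if_proj[OF \<open>over x\<close> \<open>over y\<close>])
    show "proj b x = proj b y" if "b \<in> set D" for b
      using fun_cong[OF \<open>pil x = pil y\<close>, of b] that by (simp add: pil_def)
  qed
qed (rule pil_teq)

lemma rot_pil: "fst l \<in> set D \<Longrightarrow> rot (fst l) (pil (l # m)) = pil (m @ [tw l])"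
  by (rule ext) (auto simp: rot_def pil_def dg_tw E_commute)

lemma acc_pil:
  assumes "b \<in> set D" "acc b (pil x)"
  obtains l m where "fst l = b" "x \<equiv>\<^sub>t l # m" "rot b (pil x) = pil (m @ [tw l])"
proof -
  have "proj b x = hd (proj b x) # tl (proj b x)" "hd (proj b x) \<noteq> 0"
    using assms by (simp_all add: acc_def pil_def)
  from proj_first[OF this] obtain A l B where *: "x = A @ l # B" "fst l = b" "\<forall>m\<in>set A. E b (fst m)"
    by blast
  then have "x \<equiv>\<^sub>t l # A @ B"
    using equivclp_sym[OF swap_past'[where v = fst and a = l and M = A and A = "[]" and B = B]] by simp
  moreover from this have "pil x = pil (l # A @ B)" by (rule pil_teq)
  then have "rot b (pil x) = pil ((A @ B) @ [tw l])"
    using rot_pil[of l "A @ B"] assms(1) *(2) by simp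
  ultimately show thesis using that *(2) by blast
qed

text \<open>If they did not commute, a letter of \<open>b\<close> at the front would put a spacer on
  top of the stack over \<open>c\<close>.\<close>

lemma acc_acc:
  assumes "b \<in> set D" "c \<in> set D" "acc b (pil x)" "acc c (pil x)" "b \<noteq> c"
  shows "E b c"
proof -
  obtain l m where "fst l = b" "x \<equiv>\<^sub>t l # m" using acc_pil[OF assms(1,3)] by metis
  then have "pil x c = proj c (l # m)" using assms(2) pil_teq by (metis pil_def)
  then show ?thesis using assms(4,5) \<open>fst l = b\<close> by (auto simp: acc_def E_commute split: if_splits)
qed

lemma acc_rot: "E b c \<Longrightarrow> acc c (rot b \<sigma>) = acc c \<sigma>"
  by (simp add: acc_def rot_def)

lemma rot_commute: "E b c \<Longrightarrow> rot b (rot c \<sigma>) = rot c (rot b \<sigma>)"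
  by (rule ext) (auto simp: rot_def E_commute)

section \<open>Runs of rotations\<close>

fun run :: "nat list \<Rightarrow> (nat \<Rightarrow> nat list) \<Rightarrow> (nat \<Rightarrow> nat list) \<Rightarrow> bool" where
  "run [] \<sigma> \<tau> \<longleftrightarrow> \<sigma> = \<tau>"
| "run (b # bs) \<sigma> \<tau> \<longleftrightarrow> b \<in> set D \<and> acc b \<sigma> \<and> run bs (rot b \<sigma>) \<tau>"

lemma run_append: "run (bs @ cs) \<sigma> \<tau> \<longleftrightarrow> (\<exists>\<rho>. run bs \<sigma> \<rho> \<and> run cs \<rho> \<tau>)"
  by (induction bs arbitrary: \<sigma>) auto

lemma run_set: "run bs \<sigma> \<tau> \<Longrightarrow> set bs \<subseteq> set D"
  by (induction bs arbitrary: \<sigma>) auto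

text \<open>Rotating another accessible vertex leaves \<open>b\<close> accessible, as the two
  commute. So if \<open>b\<close> is blocked at the end, it was rotated on the way, and its first
  rotation can be commuted to the start of the run.\<close>

lemma run_move:
  assumes "run bs (pil x) \<tau>" "b \<in> set D" "acc b (pil x)" "\<not> acc b \<tau>"
  shows "b \<in> set bs \<and> run (remove1 b bs) (rot b (pil x)) \<tau>"
  using assms
proof (induction bs arbitrary: x)
  case (Cons c bs)
  show ?case
  proof (cases "c = b")
    case False
    then have bc: "E c b" using acc_acc[of c b x] Cons.prems by auto
    obtain m where m: "rot c (pil x) = pil m"
      using acc_pil[of c x] Cons.prems(1) by (metis run.simps(2))
    have "b \<in> set bs \<and> run (remove1 b bs) (rot b (pil m)) \<tau>"
      using Cons.IH[of m] Cons.prems m acc_rot[OF bc] by (metis run.simps(2))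
    moreover have "acc c (rot b (pil x))" using acc_rot[OF E_sym[OF bc]] Cons.prems(1) by simp
    ultimately show ?thesis using False Cons.prems(1) m[symmetric] rot_commute[OF bc] by simp
  qed (use Cons.prems in simp)
qed simp

section \<open>The orbit of the greedy rotation\<close>

definition pyr :: "(nat \<Rightarrow> nat list) \<Rightarrow> bool" where
  "pyr \<sigma> \<longleftrightarrow> (\<forall>b\<in>set D - {a}. \<not> acc b \<sigma>)"

definition next_acc :: "(nat \<Rightarrow> nat list) \<Rightarrow> nat option" where
  "next_acc \<sigma> = find (\<lambda>b. acc b \<sigma>) (removeAll a D)"

definition nonroot_step :: "(nat \<Rightarrow> nat list) \<Rightarrow> nat \<Rightarrow> nat list" where
  "nonroot_step \<sigma> = (case next_acc \<sigma> of Some b \<Rightarrow> rot b \<sigma> | None \<Rightarrow> \<sigma>)"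

definition orbit_step :: "(nat \<Rightarrow> nat list) \<Rightarrow> nat \<Rightarrow> nat list" where
  "orbit_step \<sigma> = (case next_acc \<sigma> of Some b \<Rightarrow> rot b \<sigma> | None \<Rightarrow> if acc a \<sigma> then rot a \<sigma> else \<sigma>)"

lemma next_acc_None: "next_acc \<sigma> = None \<longleftrightarrow> pyr \<sigma>"
  by (auto simp: next_acc_def pyr_def find_None_iff)

lemma next_acc_Some: "next_acc \<sigma> = Some b \<Longrightarrow> b \<in> set D \<and> b \<noteq> a \<and> acc b \<sigma>"
  by (auto simp: next_acc_def find_Some_iff in_set_conv_nth[symmetric] dest!: nth_mem)

text \<open>The greedy choice is never wrong. A non-root vertex that it picks is blocked in
  \<open>\<tau>\<close>, so \<open>run_move\<close> brings it to the start of the run; if no such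
  vertex exists, the run itself has to begin with the root. The number of steps is therefore exactly
  the length of the run.\<close>

lemma orbit_run:
  assumes "run bs (pil x) \<tau>" "pyr \<tau>"
  shows "(orbit_step ^^ length bs) (pil x) = \<tau>"
  using assms
proof (induction "length bs" arbitrary: bs x)
  case (Suc k)
  have "\<exists>b cs. b \<in> set D \<and> acc b (pil x) \<and> orbit_step (pil x) = rot b (pil x) \<and> run cs (rot b (pil x)) \<tau> \<and> length cs = k"
  proof (cases "next_acc (pil x)")
    case None
    then have "pyr (pil x)" by (simp add: next_acc_None)
    obtain b cs where bs: "bs = b # cs" using Suc.hyps(2) by (cases bs) auto
    with Suc.prems(1) \<open>pyr (pil x)\<close> have "b = a" by (auto simp: pyr_def)
    then show ?thesis using bs Suc.prems(1) Suc.hyps(2) None by (auto simp: orbit_step_def)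
  next
    case (Some b)
    from next_acc_Some[OF this] have b: "b \<in> set D" "b \<noteq> a" "acc b (pil x)" by auto
    with Suc.prems(2) have "\<not> acc b \<tau>" by (auto simp: pyr_def)
    from run_move[OF Suc.prems(1) b(1,3) this] b Some Suc.hyps(2) show ?thesis
      by (intro exI[of _ b] exI[of _ "remove1 b bs"]) (auto simp: orbit_step_def length_remove1)
  qed
  then obtain b cs where *: "b \<in> set D" "acc b (pil x)" "orbit_step (pil x) = rot b (pil x)"
    "run cs (rot b (pil x)) \<tau>" "length cs = k" by blast
  obtain m where m: "rot b (pil x) = pil m" using acc_pil[OF *(1,2)] by metis
  have "(orbit_step ^^ length cs) (pil m) = \<tau>"
    using Suc.hyps(1)[of cs m] * m Suc.prems(2) by simp
  then show ?case using * m Suc.hyps(2)[symmetric] by (simp add: funpow_swap1)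
qed simp

lemma run_word: "over A \<Longrightarrow> run (map fst A) (pil (A @ x)) (pil (x @ map tw A))"
proof (induction A arbitrary: x)
  case (Cons l A)
  then have "run (map fst A) (pil (A @ x @ [tw l])) (pil ((x @ [tw l]) @ map tw A))"
    using Cons.IH[of "x @ [tw l]"] by simp
  then show ?case using Cons.prems rot_pil[of l "A @ x"]
    by (auto simp: acc_def pil_def)
qed simp

text \<open>One full turn applies \<open>tw\<close> to every letter, and \<open>tw\<close> is an
  involution.\<close>

lemma run_period: "over x \<Longrightarrow> run (map fst x @ map fst x) (pil x) (pil x)"
  using run_word[of x "[]"] run_word[of "map tw x" "[]"]
  by (auto simp: run_append image_image comp_def)

lemma ceq_run: "x \<approx> y \<Longrightarrow> over x \<Longrightarrow> \<exists>bs. run bs (pil x) (pil y)"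
proof (induction rule: equivclp_induct)
  case base
  show ?case by (intro exI[of _ "[]"]) simp
next
  case (step y z)
  have over: "over y" "over z"
    using ceq_fst[OF step.hyps(1)] step.prems step.hyps(2) ceq_fst[of y z]
    by (auto intro: r_into_equivclp equivclp_sym)
  have swap: "run [] (pil u) (pil w)" if "swap fst u w \<or> swap fst w u" for u w
    using that pil_teq[of u w] by (auto intro: r_into_equivclp equivclp_sym)
  have "\<exists>bs. run bs (pil y) (pil z)"
    using step.hyps(2)
  proof (elim disjE cyc.cases)
    fix l p assume *: "y = l # p" "z = p @ [tw l]"
    then show ?thesis using run_word[of "[l]" p] over by (intro exI[of _ "[fst l]"]) simp
  next
    \<comment> \<open>A rotation taken backwards is replaced by forward ones: a full turn, followed
      by all letters but the last, one rotation short of the period.\<close>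
    fix l p assume *: "z = l # p" "y = p @ [tw l]"
    have "run (map fst y) (pil y) (pil (map tw y))" using run_word[of y "[]"] over by simp
    moreover have "run (map fst p) (pil (map tw y)) (pil (l # p))"
      using run_word[of "map tw p" "[l]"] over * by (simp add: image_image comp_def)
    ultimately show ?thesis using * by (metis run_append)
  qed (metis swap)+
  then show ?case using step.IH step.prems by (metis run_append)
qed

text \<open>The word \<open>w\<close> of rotated letters satisfies a conjugation equation between
  \<open>x\<close> and \<open>x'\<close>; \<open>run_count\<close> reads it as periodicity.\<close>

lemma run_words:
  assumes "run bs (pil x) \<tau>" "over x"
  shows "\<exists>w x'. map fst w = bs \<and> \<tau> = pil x' \<and> x \<approx> x' \<and> w @ x' \<equiv>\<^sub>t x @ map tw w"
  using assms
proof (induction bs arbitrary: x)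
  case Nil
  then show ?case by (intro exI[of _ "[]"] exI[of _ x]) auto
next
  case (Cons b bs)
  then obtain l m where l: "fst l = b" "x \<equiv>\<^sub>t l # m" "rot b (pil x) = pil (m @ [tw l])"
    using acc_pil[of b x] by (metis run.simps(2))
  have "over (m @ [tw l])" using ceq_fst[OF teq_ceq[OF l(2)]] Cons.prems(2) by auto
  then obtain w x' where w: "map fst w = bs" "\<tau> = pil x'" "m @ [tw l] \<approx> x'"
    "w @ x' \<equiv>\<^sub>t (m @ [tw l]) @ map tw w"
    using Cons.IH[of "m @ [tw l]"] Cons.prems(1) l(3) by (metis run.simps(2))
  have "x \<approx> x'" using teq_ceq[OF l(2)] ceq_rotate[of l m] w(3) by (meson equivclp_trans)
  moreover have "l # w @ x' \<equiv>\<^sub>t l # m @ tw l # map tw w"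
    using teq_ctxt[OF w(4), of "[l]" "[]"] by simp
  then have "l # w @ x' \<equiv>\<^sub>t x @ map tw (l # w)"
    using teq_ctxt[OF equivclp_sym[OF l(2)], of "[]" "map tw (l # w)"] equivclp_trans by fastforce
  ultimately show ?case using w l(1) by (intro exI[of _ "l # w"] exI[of _ x']) auto
qed

definition full :: "letter list \<Rightarrow> bool" where
  "full x \<longleftrightarrow> fst ` set x = set D"

text \<open>Induction on the distance from the root, which is not rotated at all. On the two
  non-commuting vertices \<open>b\<close> and \<open>c\<close> the equation of
  \<open>run_words\<close> becomes an equation of words of vertices, so
  \<open>count_list_periodic\<close> carries the bound from \<open>c\<close> to \<open>b\<close> at
  the price of one more turn.\<close>

lemma run_count:
  assumes "run bs (pil x) \<tau>" "full x" "a \<notin> set bs" "(noncomm (set D) ^^ j) a b"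
  shows "count_list bs b \<le> j * count_list (map fst x) b"
  using assms(4)
proof (induction j arbitrary: b)
  case 0
  then show ?case using assms(3) by (simp add: count_notin)
next
  case (Suc j)
  then obtain c where c: "(noncomm (set D) ^^ j) a c" "noncomm (set D) c b" by auto
  obtain w x' where w: "map fst w = bs" "w @ x' \<equiv>\<^sub>t x @ map tw w"
    using run_words[OF assms(1)] assms(2) unfolding full_def by blast
  let ?f = "\<lambda>z. map fst (filter (\<lambda>l. fst l \<in> {b, c}) z)"
  have cnt: "count_list (?f z) e = count_list (map fst z) e" if "e \<in> {b, c}" for z e
    using that by (induction z) auto
  have "?f (w @ x') = ?f (x @ map tw w)"
    by (rule teq_pair_word[OF w(2)]) (use c(2) in \<open>simp add: noncomm_def E_commute\<close>)
  moreover have "?f (map tw w) = ?f w" by (induction w) auto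
  ultimately have "?f w @ ?f x' = ?f x @ ?f w" by simp
  moreover have "count_list (?f x) c > 0"
    using c(2) assms(2) count_list_0_iff[of "map fst x" c] cnt[of c x]
    by (simp add: noncomm_def full_def)
  moreover have "count_list (?f w) c \<le> j * count_list (?f x) c"
    using Suc.IH[OF c(1)] w(1) cnt[of c w] cnt[of c x] by simp
  ultimately have "count_list (?f w) b \<le> Suc j * count_list (?f x) b" by (rule count_list_periodic)
  then show ?case using w(1) cnt[of b w] cnt[of b x] by simp
qed

lemma run_length:
  assumes "run bs (pil x) \<tau>" "full x" "a \<notin> set bs"
  shows "length bs \<le> \<kappa> * length x"
proof -
  have "count_list bs b \<le> \<kappa> * count_list (map fst x) b" if b: "b \<in> set D" for b
  proof -
    obtain j where j: "j \<le> \<kappa>" "(noncomm (set D) ^^ j) a b" using reach[OF b] by blast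
    have "count_list bs b \<le> j * count_list (map fst x) b" by (rule run_count[OF assms j(2)])
    also have "\<dots> \<le> \<kappa> * count_list (map fst x) b" using j(1) by simp
    finally show ?thesis .
  qed
  then have "(\<Sum>b\<in>set D. count_list bs b) \<le> (\<Sum>b\<in>set D. \<kappa> * count_list (map fst x) b)"
    by (rule sum_mono)
  moreover have "(\<Sum>b\<in>set D. count_list bs b) = length bs"
    by (rule sum_count_set) (use run_set[OF assms(1)] in auto)
  moreover have "(\<Sum>b\<in>set D. count_list (map fst x) b) = length (map fst x)"
    by (rule sum_count_set) (use assms(2) in \<open>auto simp: full_def\<close>)
  ultimately show ?thesis by (simp add: sum_distrib_left[symmetric])
qed

lemma orbit_nonroot:
  assumes "\<And>i. i < t \<Longrightarrow> \<not> pyr ((orbit_step ^^ i) (pil x))"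
  shows "(nonroot_step ^^ t) (pil x) = (orbit_step ^^ t) (pil x) \<and>
    (\<exists>bs. run bs (pil x) ((orbit_step ^^ t) (pil x)) \<and> length bs = t \<and> a \<notin> set bs)"
  using assms
proof (induction t)
  case (Suc t)
  let ?s = "(orbit_step ^^ t) (pil x)"
  from Suc obtain bs where bs: "run bs (pil x) ?s" "length bs = t" "a \<notin> set bs"
    and eq: "(nonroot_step ^^ t) (pil x) = ?s" by auto
  from Suc.prems[of t] obtain b where b: "next_acc ?s = Some b"
    using next_acc_None[of ?s] by (cases "next_acc ?s") auto
  have "run (bs @ [b]) (pil x) (rot b ?s)"
    using bs(1) next_acc_Some[OF b] by (auto simp: run_append)
  moreover have "a \<notin> set (bs @ [b])" using bs(3) next_acc_Some[OF b] by auto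
  moreover have "orbit_step ?s = rot b ?s" "nonroot_step ?s = rot b ?s"
    using b by (simp_all add: orbit_step_def nonroot_step_def)
  ultimately show ?case using bs(2) eq by (intro conjI exI[of _ "bs @ [b]"]) auto
qed simp

text \<open>A greedy walk without a pyramid never uses the root, so by \<open>run_length\<close> it
  has at most \<open>\<kappa> * length x\<close> steps.\<close>

lemma reach_pyramid:
  assumes "full x"
  obtains t where "t \<le> \<kappa> * length x" "pyr ((orbit_step ^^ t) (pil x))"
    "(nonroot_step ^^ t) (pil x) = (orbit_step ^^ t) (pil x)"
proof -
  let ?P = "\<lambda>t. pyr ((orbit_step ^^ t) (pil x))"
  have ex: "\<exists>t. ?P t \<and> t \<le> \<kappa> * length x"
  proof (rule ccontr)
    assume "\<not> ?thesis"
    then have "\<not> ?P i" if "i < Suc (\<kappa> * length x)" for i using that by auto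
    from orbit_nonroot[OF this] obtain bs where "run bs (pil x) ((orbit_step ^^ Suc (\<kappa> * length x)) (pil x))"
      "length bs = Suc (\<kappa> * length x)" "a \<notin> set bs" by blast
    with run_length[of bs x] assms show False by auto
  qed
  \<comment> \<open>Up to the first pyramid the root is not rotated, so \<open>nonroot_step\<close>
    and \<open>orbit_step\<close> agree that far.\<close>
  define t where "t = (LEAST t. ?P t)"
  have "?P t" unfolding t_def using ex by (metis LeastI)
  moreover have "t \<le> \<kappa> * length x" unfolding t_def using ex by (metis Least_le order_trans)
  moreover have "\<not> ?P i" if "i < t" for i using that unfolding t_def by (rule not_less_Least)
  note orbit_nonroot[OF this]
  ultimately show thesis using that by blast
qed

lemma iterate_words:
  assumes f: "\<And>x. \<exists>bs. run bs (pil x) (f (pil x))" and "over x"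
  shows "\<exists>x'. (f ^^ t) (pil x) = pil x' \<and> x \<approx> x'"
proof (induction t)
  case (Suc t)
  then obtain x' where x': "(f ^^ t) (pil x) = pil x'" "x \<approx> x'" by blast
  obtain bs where "run bs (pil x') (f (pil x'))" using f by blast
  from run_words[OF this] obtain x'' where "f (pil x') = pil x''" "x' \<approx> x''"
    using ceq_fst[OF x'(2)] assms by auto
  then show ?case using x' by (auto intro: equivclp_trans)
qed auto

lemma orbit_words: "over x \<Longrightarrow> \<exists>x'. (orbit_step ^^ t) (pil x) = pil x' \<and> x \<approx> x'"
proof (rule iterate_words)
  show "\<exists>bs. run bs (pil x) (orbit_step (pil x))" for x
  proof (cases "next_acc (pil x)")
    case None
    then show ?thesis using a
      by (intro exI[of _ "if acc a (pil x) then [a] else []"]) (auto simp: orbit_step_def)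
  next
    case (Some b)
    then show ?thesis using next_acc_Some[OF Some]
      by (intro exI[of _ "[b]"]) (auto simp: orbit_step_def)
  qed
qed

lemma nonroot_words: "over x \<Longrightarrow> \<exists>x'. (nonroot_step ^^ t) (pil x) = pil x' \<and> x \<approx> x'"
proof (rule iterate_words)
  show "\<exists>bs. run bs (pil x) (nonroot_step (pil x))" for x
  proof (cases "next_acc (pil x)")
    case None
    then show ?thesis by (intro exI[of _ "[]"]) (auto simp: nonroot_step_def)
  next
    case (Some b)
    then show ?thesis using next_acc_Some[OF Some]
      by (intro exI[of _ "[b]"]) (auto simp: nonroot_step_def)
  qed
qed

text \<open>Pyramids are fixed points, so a machine loop with a fixed number of rounds may
  overshoot.\<close>

lemma nonroot_pyr: "pyr \<sigma> \<Longrightarrow> (nonroot_step ^^ t) \<sigma> = \<sigma>"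
  using next_acc_None[of \<sigma>] by (induction t) (auto simp: nonroot_step_def)

text \<open>\<open>T\<close> leaves room for \<open>\<kappa> * length x\<close> steps to a pyramid
  and one period of \<open>2 * length x\<close> steps, and for the descent of \<open>y\<close> to a
  pyramid.\<close>

theorem ceq_iff_orbit:
  assumes x: "full x" and y: "full y"
    and T: "(\<kappa> + 2) * length x < T" "\<kappa> * length y \<le> T"
  shows "x \<approx> y \<longleftrightarrow> (\<exists>t<T. (orbit_step ^^ t) (pil x) = (nonroot_step ^^ T) (pil y))"
proof -
  have over: "over x" "over y" using x y by (simp_all add: full_def)
  obtain ty where ty: "ty \<le> \<kappa> * length y" "pyr ((orbit_step ^^ ty) (pil y))"
    "(nonroot_step ^^ ty) (pil y) = (orbit_step ^^ ty) (pil y)"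
    using reach_pyramid[OF y] by metis
  obtain ry where ry: "T = ry + ty" using ty(1) T(2) by (metis add.commute le_Suc_ex order_trans)
  let ?p = "(nonroot_step ^^ T) (pil y)"
  have p: "?p = (orbit_step ^^ ty) (pil y)"
    unfolding ry funpow_add using ty(2,3) nonroot_pyr by simp
  obtain y' where y': "?p = pil y'" "y \<approx> y'" using orbit_words[OF over(2), of ty] p by auto
  show ?thesis
  proof
    assume "x \<approx> y"
    then have "x \<approx> y'" using y'(2) by (rule equivclp_trans)
    then obtain bs where "run bs (pil x) ?p" using ceq_run[OF _ over(1)] y'(1) by metis
    moreover have pyrp: "pyr ?p" using p ty(2) by simp
    ultimately have hit: "(orbit_step ^^ length bs) (pil x) = ?p" by (rule orbit_run)
    obtain t where t: "t \<le> \<kappa> * length x" "pyr ((orbit_step ^^ t) (pil x))"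
      using reach_pyramid[OF x] by metis
    let ?q = "(orbit_step ^^ t) (pil x)"
    obtain x' where x': "?q = pil x'" "x \<approx> x'" using orbit_words[OF over(1)] by blast
    then have len: "length x' = length x" "over x'" using ceq_length ceq_fst over(1) by auto
    \<comment> \<open>\<open>orbit_run\<close> needs a pyramid as its target, so periodicity is
      available from \<open>?q\<close> on, not from \<open>pil x\<close>.\<close>
    have per: "(orbit_step ^^ (2 * length x)) ?q = ?q"
      using orbit_run[OF run_period[OF len(2)]] t(2) x'(1) len(1) by (simp add: mult_2)
    have pos: "2 * length x > 0" using x a by (cases x) (auto simp: full_def)
    show "\<exists>t<T. (orbit_step ^^ t) (pil x) = ?p"
    proof (cases "length bs \<le> t")
      case True
      then have "length bs < T" using t(1) T(1) by (simp add: algebra_simps)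
      then show ?thesis using hit by blast
    next
      case False
      define r where "r = (length bs - t) mod (2 * length x)"
      have "?p = (orbit_step ^^ (length bs - t)) ?q"
        using hit False by (metis comp_apply funpow_add le_add_diff_inverse2 linorder_le_cases)
      also have "\<dots> = (orbit_step ^^ r) ?q" unfolding r_def by (rule funpow_mod_eq[OF per, symmetric])
      finally have "(orbit_step ^^ (r + t)) (pil x) = ?p" by (simp add: funpow_add)
      moreover have "r < 2 * length x" unfolding r_def using pos by simp
      then have "r + t < T" using t(1) T(1) by (simp add: algebra_simps)
      ultimately show ?thesis by blast
    qed
  next
    assume "\<exists>t<T. (orbit_step ^^ t) (pil x) = ?p"
    then obtain t where t: "(orbit_step ^^ t) (pil x) = ?p" by blast
    obtain x' where x': "(orbit_step ^^ t) (pil x) = pil x'" "x \<approx> x'" using orbit_words[OF over(1)] by blast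
    then have "pil x' = pil y'" using t y'(1) by simp
    moreover have "over x'" "over y'" using ceq_fst[OF x'(2)] ceq_fst[OF y'(2)] over by auto
    ultimately have "x' \<approx> y'" using teq_ceq[OF pil_eq_iff[THEN iffD1]] by blast
    then show "x \<approx> y" using x'(2) y'(2) by (meson equivclp_sym equivclp_trans)
  qed
qed

end

section \<open>Splitting a class over the components of the support\<close>

context raag
begin

definition component :: "nat set \<Rightarrow> nat \<Rightarrow> nat set" where
  "component V a = {b. (noncomm V)\<^sup>*\<^sup>* a b}"

abbreviation restr :: "nat set \<Rightarrow> letter list \<Rightarrow> letter list" where
  "restr D \<equiv> filter (\<lambda>l. fst l \<in> D)"

lemma restr_ceq: "x \<approx> y \<Longrightarrow> restr D x \<approx> restr D y"
  by (rule equivclp_cyc_filter) simp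

text \<open>Inside \<open>x @ z\<close> a rotated letter of \<open>x\<close> arrives behind
  \<open>z\<close> and has to be brought back past it, which is why the two supports must
  commute.\<close>

lemma ceq_append_left:
  assumes "x \<approx> y" "\<forall>l\<in>set x. \<forall>m\<in>set z. E (fst l) (fst m)"
  shows "x @ z \<approx> y @ z"
  using assms
proof (induction rule: equivclp_induct)
  case (step x' y')
  have cyc: "u @ z \<approx> w @ z" if "cyc fst tw u w" "\<forall>l\<in>fst ` set u. \<forall>m\<in>set z. E l (fst m)" for u w
    using that
  proof (cases rule: cyc.cases)
    case cyc_swap
    then show ?thesis using swap_ctxt[of fst u w "[]" z]
      by (auto intro!: r_into_equivclp cyc.cyc_swap)
  next
    case (cyc_rot l p)
    have "l # p @ z \<approx> p @ z @ [tw l]" using ceq_rotate[of l "p @ z"] by simp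
    moreover have "p @ z @ [tw l] \<equiv>\<^sub>t p @ tw l # z"
      using equivclp_sym[OF swap_past'[where v = fst and a = "tw l" and M = z and A = p and B = "[]"]]
        that(2) cyc_rot by simp
    ultimately show ?thesis using cyc_rot teq_ceq equivclp_trans by fastforce
  qed
  have "fst ` set x' = fst ` set x" "fst ` set y' = fst ` set x"
    using ceq_fst[OF step.hyps(1)] ceq_fst[OF r_into_equivclp, of x' y'] ceq_fst[OF r_into_equivclp, of y' x']
      step.hyps(2) by auto
  then have "x' @ z \<approx> y' @ z"
    using step.hyps(2) cyc[of x' y'] cyc[of y' x'] step.prems by (auto intro: equivclp_sym)
  with step show ?case by (auto intro: equivclp_trans)
qed simp

lemma append_commute_teq:
  "\<forall>l\<in>set x. \<forall>m\<in>set z. E (fst l) (fst m) \<Longrightarrow> x @ z \<equiv>\<^sub>t z @ x"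
proof (induction x arbitrary: z)
  case (Cons l x)
  have "l # x @ z \<equiv>\<^sub>t l # z @ x" using teq_ctxt[OF Cons.IH[of z], of "[l]" "[]"] Cons.prems by simp
  moreover have "l # z @ x \<equiv>\<^sub>t z @ l # x"
    using swap_past'[where v = fst and a = l and M = z and A = "[]" and B = x] Cons.prems by simp
  ultimately show ?case by (auto intro: equivclp_trans)
qed simp

lemma restr_Un:
  assumes "C \<inter> D = {}" "\<forall>b\<in>C. \<forall>c\<in>D. b \<in> V \<longrightarrow> c \<in> V \<longrightarrow> E b c" "fst ` set x \<subseteq> V"
  shows "restr (C \<union> D) x \<equiv>\<^sub>t restr C x @ restr D x"
  using assms(3)
proof (induction x)
  case (Cons l x)
  then have IH: "restr (C \<union> D) x \<equiv>\<^sub>t restr C x @ restr D x" by simp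
  consider "fst l \<in> C" "fst l \<notin> D" | "fst l \<in> D" "fst l \<notin> C" | "fst l \<notin> C" "fst l \<notin> D"
    using assms(1) by blast
  then show ?case
  proof cases
    case 1
    then show ?thesis using teq_ctxt[OF IH, of "[l]" "[]"] by simp
  next
    case 2
    have "l # restr C x @ restr D x \<equiv>\<^sub>t restr C x @ l # restr D x"
      using swap_past'[where v = fst and a = l and M = "restr C x" and A = "[]" and B = "restr D x"]
        2 assms(2) Cons.prems E_sym by fastforce
    then show ?thesis using teq_ctxt[OF IH, of "[l]" "[]"] 2 by (auto intro: equivclp_trans)
  qed (use IH in simp)
qed simp

lemma component_closed: "b \<in> component V a \<Longrightarrow> noncomm V b c \<Longrightarrow> c \<in> component V a"
  by (auto simp: component_def)

lemma noncomm_sym: "noncomm V b c \<Longrightarrow> noncomm V c b"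
  by (auto simp: noncomm_def E_commute)

lemma component_subset: "a \<in> V \<Longrightarrow> component V a \<subseteq> V"
proof
  fix b assume "a \<in> V" "b \<in> component V a"
  then have "(noncomm V)\<^sup>*\<^sup>* a b" by (simp add: component_def)
  then show "b \<in> V" by induction (auto simp: \<open>a \<in> V\<close> noncomm_def)
qed

lemma ceq_if_components:
  assumes "fst ` set x = V" "fst ` set y = V"
    and comp: "\<And>a. a \<in> V \<Longrightarrow> restr (component V a) x \<approx> restr (component V a) y"
  shows "x \<approx> y"
proof -
  \<comment> \<open>Generalised from \<open>V\<close> to unions of components, so that components
    can be split off one at a time.\<close>
  have "restr U x \<approx> restr U y" if "U \<subseteq> V" "\<forall>b\<in>U. \<forall>c. noncomm V b c \<longrightarrow> c \<in> U" for U
    using finite_subset[of U V] that assms(1)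
  proof (induction U rule: measure_induct_rule[of card])
    case (less U)
    show ?case
    proof (cases "U = {}")
      case False
      then obtain a where a: "a \<in> U" by blast
      let ?C = "component V a"
      let ?D = "U - ?C"
      have CU: "?C \<subseteq> U"
      proof
        fix b assume "b \<in> ?C"
        then have "(noncomm V)\<^sup>*\<^sup>* a b" by (simp add: component_def)
        then show "b \<in> U" by induction (use a less.prems in auto)
      qed
      have aC: "a \<in> ?C" by (simp add: component_def)
      have finU: "finite U" using less.prems finite_subset by blast
      have D: "restr ?D x \<approx> restr ?D y"
      proof (rule less.IH)
        show "card ?D < card U" using finU a aC by (intro psubset_card_mono) auto
        show "\<forall>b\<in>?D. \<forall>c. noncomm V b c \<longrightarrow> c \<in> ?D"
          using less.prems component_closed noncomm_sym by blast
      qed (use less.prems finU in auto)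
      have C: "restr ?C x \<approx> restr ?C y" using comp a less.prems by blast
      have comm: "\<forall>b\<in>?C. \<forall>c\<in>?D. E b c"
      proof (intro ballI, rule ccontr)
        fix b c assume "b \<in> ?C" "c \<in> ?D" "\<not> E b c"
        then have "noncomm V b c" using CU less.prems by (auto simp: noncomm_def)
        then show False using \<open>b \<in> ?C\<close> \<open>c \<in> ?D\<close> component_closed by blast
      qed
      have U: "?C \<union> ?D = U" using CU by blast
      have split: "restr U z \<equiv>\<^sub>t restr ?C z @ restr ?D z" for z
        using restr_Un[of ?C ?D UNIV z] comm unfolding U by blast
      have "restr U x \<approx> restr ?C x @ restr ?D x" by (rule teq_ceq[OF split])
      \<comment> \<open>Only the left factor can be replaced, so the factors trade places between
        the two replacements.\<close>
      also have "\<dots> \<approx> restr ?C y @ restr ?D x" by (rule ceq_append_left[OF C]) (use comm in auto)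
      also have "\<dots> \<approx> restr ?D x @ restr ?C y"
        by (rule teq_ceq, rule append_commute_teq) (use comm in auto)
      also have "\<dots> \<approx> restr ?D y @ restr ?C y"
        by (rule ceq_append_left[OF D]) (use comm in \<open>auto simp: E_commute\<close>)
      also have "\<dots> \<approx> restr ?C y @ restr ?D y"
        by (rule teq_ceq, rule append_commute_teq) (use comm in \<open>auto simp: E_commute\<close>)
      also have "\<dots> \<approx> restr U y" by (rule equivclp_sym[OF teq_ceq[OF split]])
      finally (equivclp_trans) show ?thesis .
    qed simp
  qed
  from this[of V] have "restr V x \<approx> restr V y" by (auto simp: noncomm_def)
  moreover have "restr V x = x" "restr V y = y" using assms(1,2) by (auto simp: filter_id_conv)
  ultimately show ?thesis by simp
qed

end

section \<open>Structured programs for the random access machine\<close>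

datatype bop = Plus | Minus | Times | Quot | Rem

datatype aexp = N int | V nat | Bin bop aexp aexp

fun bval :: "bop \<Rightarrow> int \<Rightarrow> int \<Rightarrow> int" where
  "bval Plus i j = i + j"
| "bval Minus i j = i - j"
| "bval Times i j = i * j"
| "bval Quot i j = i div j"
| "bval Rem i j = i mod j"

fun binstr :: "bop \<Rightarrow> nat \<Rightarrow> nat \<Rightarrow> nat \<Rightarrow> instr" where
  "binstr Plus = Add"
| "binstr Minus = Sub"
| "binstr Times = Mul"
| "binstr Quot = Div"
| "binstr Rem = Mod"

fun aval :: "aexp \<Rightarrow> (nat \<Rightarrow> int) \<Rightarrow> int" where
  "aval (N k) s = k"
| "aval (V x) s = s x"
| "aval (Bin b e1 e2) s = bval b (aval e1 s) (aval e2 s)"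

fun avars :: "aexp \<Rightarrow> nat set" where
  "avars (N k) = {}"
| "avars (V x) = {x}"
| "avars (Bin b e1 e2) = avars e1 \<union> avars e2"

lemma aval_cong: "(\<And>x. x \<in> avars e \<Longrightarrow> s x = s' x) \<Longrightarrow> aval e s = aval e s'"
  by (induction e) auto

datatype com = Skip | Assign nat aexp | Seq com com | If aexp com com | Loop aexp com

text \<open>A loop evaluates its repetition count once; the compiler keeps the count in a register
  that the body cannot touch.\<close>

primrec sem :: "com \<Rightarrow> (nat \<Rightarrow> int) \<Rightarrow> nat \<Rightarrow> int" where
  "sem Skip s = s"
| "sem (Assign x e) s = s(x := aval e s)"
| "sem (Seq c1 c2) s = sem c2 (sem c1 s)"
| "sem (If e c1 c2) s = (if aval e s \<noteq> 0 then sem c1 s else sem c2 s)"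
| "sem (Loop e c) s = (sem c ^^ nat (aval e s)) s"

fun cvars :: "com \<Rightarrow> nat set" where
  "cvars Skip = {}"
| "cvars (Assign x e) = insert x (avars e)"
| "cvars (Seq c1 c2) = cvars c1 \<union> cvars c2"
| "cvars (If e c1 c2) = avars e \<union> cvars c1 \<union> cvars c2"
| "cvars (Loop e c) = avars e \<union> cvars c"

lemma cvars_bounded: "\<exists>T>0. cvars c \<subseteq> {..<T}"
proof -
  have "finite (avars e)" for e by (induction e) auto
  then have "finite (cvars c)" by (induction c) auto
  then obtain T where "cvars c \<subseteq> {..<T}" by (auto simp: finite_nat_set_iff_bounded)
  then show ?thesis by (intro exI[of _ "Suc T"]) auto
qed

fun wvars :: "com \<Rightarrow> nat set" where
  "wvars Skip = {}"
| "wvars (Assign x e) = {x}"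
| "wvars (Seq c1 c2) = wvars c1 \<union> wvars c2"
| "wvars (If e c1 c2) = wvars c1 \<union> wvars c2"
| "wvars (Loop e c) = wvars c"

lemma funpow_invariant: "(\<And>s. g (f s) = g s) \<Longrightarrow> g ((f ^^ k) s) = g s"
  by (induction k) auto

lemma sem_wvars: "x \<notin> wvars c \<Longrightarrow> sem c s x = s x"
proof (induction c arbitrary: s)
  case (Loop e c)
  then show ?case using funpow_invariant[where g = "\<lambda>s. s x" and f = "sem c"] by simp
qed auto

text \<open>There is no copy instruction, so a variable is read as \<open>0 + M x\<close>.
  Intermediate values occupy the registers from \<open>t\<close> upwards.\<close>

fun acode :: "aexp \<Rightarrow> nat \<Rightarrow> instr list" where
  "acode (N k) t = [LoadC t k]"
| "acode (V x) t = [LoadC t 0, Add t x t]"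
| "acode (Bin b e1 e2) t = acode e1 t @ acode e2 (Suc t) @ [binstr b t t (Suc t)]"

fun asize :: "aexp \<Rightarrow> nat" where
  "asize (N k) = 1"
| "asize (V x) = 2"
| "asize (Bin b e1 e2) = asize e1 + asize e2 + 1"

lemma length_acode [simp]: "length (acode e t) = asize e"
  by (induction e arbitrary: t) auto

text \<open>Jump targets are absolute, hence the start address \<open>p\<close>. The exit through
  \<open>Jneg\<close> treats a negative count as 0, in accordance with \<open>nat\<close> in
  \<open>sem\<close>.\<close>

fun ccode :: "com \<Rightarrow> nat \<Rightarrow> nat \<Rightarrow> instr list" where
  "ccode Skip t p = []"
| "ccode (Assign x e) t p = acode e t @ [LoadC (Suc t) 0, Add x t (Suc t)]"
| "ccode (Seq c1 c2) t p = (let C1 = ccode c1 t p in C1 @ ccode c2 t (p + length C1))"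
| "ccode (If e c1 c2) t p =
    (let p1 = p + asize e + 1; C1 = ccode c1 t p1; p2 = p1 + length C1 + 1; C2 = ccode c2 t p2
     in acode e t @ [Jz t p2] @ C1 @ [Jmp (p2 + length C2)] @ C2)"
| "ccode (Loop e c) t p =
    (let h = p + asize e; C = ccode c (Suc t) (h + 2); fin = h + 2 + length C + 3
     in acode e t @ [Jz t fin, Jneg t fin] @ C @ [LoadC (Suc t) 1, Sub t t (Suc t), Jmp h])"

definition code_at :: "instr list \<Rightarrow> nat \<Rightarrow> instr list \<Rightarrow> bool" where
  "code_at P p C \<longleftrightarrow> (\<forall>i<length C. p + i < length P \<and> P ! (p + i) = C ! i)"

lemma code_at_append [simp]:
  "code_at P p (A @ B) \<longleftrightarrow> code_at P p A \<and> code_at P (p + length A) B"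
  unfolding code_at_def
proof (intro iffI conjI allI impI; (elim conjE)?)
  fix i assume *: "\<forall>i<length (A @ B). p + i < length P \<and> P ! (p + i) = (A @ B) ! i"
  { assume "i < length A"
    with *[rule_format, of i] show "p + i < length P" "P ! (p + i) = A ! i"
      by (simp_all add: nth_append) }
  { assume "i < length B"
    with *[rule_format, of "length A + i"] show "p + length A + i < length P" "P ! (p + length A + i) = B ! i"
      by (simp_all add: nth_append add.assoc) }
next
  fix i assume *: "\<forall>i<length A. p + i < length P \<and> P ! (p + i) = A ! i"
    "\<forall>i<length B. p + length A + i < length P \<and> P ! (p + length A + i) = B ! i"
    and i: "i < length (A @ B)"
  show "p + i < length P" "P ! (p + i) = (A @ B) ! i"
    using *(1)[rule_format, of i] *(2)[rule_format, of "i - length A"] i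
    by (cases "i < length A"; simp add: nth_append)+
qed

lemma code_at_Cons: "code_at P p (i # C) \<longleftrightarrow> p < length P \<and> P ! p = i \<and> code_at P (Suc p) C"
  using code_at_append[of P p "[i]" C] by (simp add: code_at_def)

lemma code_at_Nil [simp]: "code_at P p []"
  by (simp add: code_at_def)

definition goes :: "instr list \<Rightarrow> config \<Rightarrow> nat \<Rightarrow> config \<Rightarrow> bool" where
  "goes P c k c' \<longleftrightarrow> (ram_step P ^^ k) c = c'"

lemma goes_0: "goes P c 0 c"
  by (simp add: goes_def)

lemma goes_0_iff [simp]: "goes P c 0 c' \<longleftrightarrow> c = c'"
  by (simp add: goes_def)

lemma goes_trans: "goes P c k c' \<Longrightarrow> goes P c' m c'' \<Longrightarrow> goes P c (k + m) c''"
  unfolding goes_def by (simp add: add.commute[of k] funpow_add)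

lemma goes_step:
  assumes "p < length P" "P ! p = i" "i \<noteq> Halt" "goes P (exec i (p, M)) k c"
  shows "goes P (p, M) (Suc k) c"
proof -
  have "ram_step P (p, M) = exec i (p, M)" using assms by (simp add: ram_step_def ram_halted_def)
  then show ?thesis using assms(4) by (simp add: goes_def funpow_swap1)
qed

lemma exec_binstr: "exec (binstr b r x y) (p, M) = (Suc p, M(r := bval b (M x) (M y)))"
  by (cases b) auto

lemma binstr_Halt [simp]: "binstr b r x y \<noteq> Halt"
  by (cases b) auto

lemma acode_correct:
  assumes "code_at P p (acode e t)" "avars e \<subseteq> {..<t}"
  shows "\<exists>M'. goes P (p, M) (asize e) (p + asize e, M') \<and> M' t = aval e M \<and> (\<forall>x<t. M' x = M x)"
  using assms
proof (induction e arbitrary: p t M)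
  case (N k)
  then show ?case
    by (intro exI[of _ "M(t := k)"]) (auto simp: code_at_Cons fun_eq_iff intro!: goes_step)
next
  case (V x)
  then show ?case
    by (intro exI[of _ "M(t := M x)"])
       (auto simp: code_at_Cons numeral_2_eq_2 fun_eq_iff intro!: goes_step)
next
  case (Bin b e1 e2)
  from Bin.prems have 1: "code_at P p (acode e1 t)" "code_at P (p + asize e1) (acode e2 (Suc t))"
    and b: "p + asize e1 + asize e2 < length P" "P ! (p + asize e1 + asize e2) = binstr b t t (Suc t)"
    by (auto simp: code_at_Cons)
  have sub: "avars e1 \<subseteq> {..<t}" "avars e2 \<subseteq> {..<Suc t}" using Bin.prems(2) by auto
  obtain M1 where M1: "goes P (p, M) (asize e1) (p + asize e1, M1)" "M1 t = aval e1 M" "\<forall>x<t. M1 x = M x"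
    using Bin.IH(1)[OF 1(1) sub(1)] by blast
  obtain M2 where M2: "goes P (p + asize e1, M1) (asize e2) (p + asize e1 + asize e2, M2)"
    "M2 (Suc t) = aval e2 M1" "\<forall>x<Suc t. M2 x = M1 x"
    using Bin.IH(2)[OF 1(2) sub(2)] by blast
  have e2: "aval e2 M1 = aval e2 M"
    by (rule aval_cong) (use M1(3) Bin.prems(2) in auto)
  have "goes P (p + asize e1 + asize e2, M2) (Suc 0)
    (p + asize (Bin b e1 e2), M2(t := bval b (M2 t) (M2 (Suc t))))"
    by (rule goes_step[OF b binstr_Halt]) (simp add: exec_binstr goes_0)
  from goes_trans[OF goes_trans[OF M1(1) M2(1)] this]
  have "goes P (p, M) (asize (Bin b e1 e2)) (p + asize (Bin b e1 e2), M2(t := bval b (M2 t) (M2 (Suc t))))"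
    by simp
  moreover have "(M2(t := bval b (M2 t) (M2 (Suc t)))) t = aval (Bin b e1 e2) M"
    "\<forall>x<t. (M2(t := bval b (M2 t) (M2 (Suc t)))) x = M x"
    using M1(2,3) M2(2,3) e2 by auto
  ultimately show ?case by blast
qed

text \<open>An upper bound: 2 for \<open>Jz\<close> and \<open>Jmp\<close> of a conditional, 2 for
  the final test of a loop, and 5 per round for both tests, the decrement and the jump back.\<close>

fun cost :: "com \<Rightarrow> (nat \<Rightarrow> int) \<Rightarrow> nat" where
  "cost Skip s = 0"
| "cost (Assign x e) s = asize e + 2"
| "cost (Seq c1 c2) s = cost c1 s + cost c2 (sem c1 s)"
| "cost (If e c1 c2) s = asize e + 2 + (if aval e s \<noteq> 0 then cost c1 s else cost c2 s)"
| "cost (Loop e c) s = asize e + 2 + (\<Sum>i<nat (aval e s). cost c ((sem c ^^ i) s) + 5)"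

text \<open>The program variables lie below \<open>T0\<close>. Registers from \<open>T0\<close> up
  to \<open>t\<close> hold the counters of enclosing loops and must survive; those from
  \<open>t\<close> on are scratch.\<close>

lemma ccode_correct:
  assumes "code_at P p (ccode c t p)" "cvars c \<subseteq> {..<T0}" "T0 \<le> t" "\<And>x. x < T0 \<Longrightarrow> M x = s x"
  shows "\<exists>k M'. k \<le> cost c s \<and> goes P (p, M) k (p + length (ccode c t p), M') \<and>
    (\<forall>x<T0. M' x = sem c s x) \<and> (\<forall>x. T0 \<le> x \<longrightarrow> x < t \<longrightarrow> M' x = M x)"
  using assms
proof (induction c arbitrary: p t M s)
  case Skip
  then show ?case by (auto intro: goes_0)
next
  case (Assign x e)
  have sub: "avars e \<subseteq> {..<t}" using Assign.prems(2,3) by auto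
  obtain M1 where M1: "goes P (p, M) (asize e) (p + asize e, M1)" "M1 t = aval e M" "\<forall>x<t. M1 x = M x"
    using acode_correct[of P p e t M] Assign.prems(1) sub by auto
  have ae: "aval e M = aval e s" by (rule aval_cong) (use Assign.prems in auto)
  have "goes P (p + asize e, M1) 2 (p + asize e + 2, M1(Suc t := 0, x := M1 t))"
    using Assign.prems(1) by (auto simp: code_at_Cons numeral_2_eq_2 intro!: goes_step goes_0)
  from goes_trans[OF M1(1) this]
  have "goes P (p, M) (cost (Assign x e) s) (p + length (ccode (Assign x e) t p), M1(Suc t := 0, x := M1 t))"
    by simp
  moreover have "\<forall>y<T0. (M1(Suc t := 0, x := M1 t)) y = sem (Assign x e) s y"
    "\<forall>y. T0 \<le> y \<longrightarrow> y < t \<longrightarrow> (M1(Suc t := 0, x := M1 t)) y = M y"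
    using M1(2,3) ae Assign.prems by auto
  ultimately show ?case by blast
next
  case (Seq c1 c2)
  let ?C1 = "ccode c1 t p"
  let ?C2 = "ccode c2 t (p + length ?C1)"
  obtain k1 M1 where 1: "k1 \<le> cost c1 s" "goes P (p, M) k1 (p + length ?C1, M1)"
    "\<forall>x<T0. M1 x = sem c1 s x" "\<forall>x. T0 \<le> x \<longrightarrow> x < t \<longrightarrow> M1 x = M x"
    using Seq.IH(1)[of p t M s] Seq.prems by (auto simp: Let_def)
  obtain k2 M2 where 2: "k2 \<le> cost c2 (sem c1 s)"
    "goes P (p + length ?C1, M1) k2 (p + length ?C1 + length ?C2, M2)"
    "\<forall>x<T0. M2 x = sem c2 (sem c1 s) x" "\<forall>x. T0 \<le> x \<longrightarrow> x < t \<longrightarrow> M2 x = M1 x"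
    using Seq.IH(2)[of "p + length ?C1" t M1 "sem c1 s"] Seq.prems 1(3) by (auto simp: Let_def)
  show ?case using 1 2 goes_trans[OF 1(2) 2(2)]
    by (intro exI[of _ "k1 + k2"] exI[of _ M2]) (auto simp: Let_def add.assoc)
next
  case (If e c1 c2)
  have sub: "avars e \<subseteq> {..<t}" using If.prems(2,3) by auto
  let ?p1 = "p + asize e + 1"
  let ?C1 = "ccode c1 t ?p1"
  let ?p2 = "?p1 + length ?C1 + 1"
  let ?C2 = "ccode c2 t ?p2"
  have code: "code_at P p (acode e t)" "p + asize e < length P" "P ! (p + asize e) = Jz t ?p2"
    "code_at P ?p1 ?C1" "?p1 + length ?C1 < length P" "P ! (?p1 + length ?C1) = Jmp (?p2 + length ?C2)"
    "code_at P ?p2 ?C2"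
    using If.prems(1) by (simp_all add: Let_def code_at_Cons)
  have len: "length (ccode (If e c1 c2) t p) = asize e + 1 + length ?C1 + 1 + length ?C2"
    by (simp add: Let_def)
  obtain M1 where M1: "goes P (p, M) (asize e) (p + asize e, M1)" "M1 t = aval e M" "\<forall>x<t. M1 x = M x"
    using acode_correct[OF code(1), of M] sub by auto
  have ae: "aval e M = aval e s" by (rule aval_cong) (use If.prems in auto)
  have eq1: "M1 x = s x" if "x < T0" for x using M1(3) If.prems(3,4) that by simp
  show ?case
  proof (cases "aval e s = 0")
    case True
    obtain k2 M2 where 2: "k2 \<le> cost c2 s" "goes P (?p2, M1) k2 (?p2 + length ?C2, M2)"
      "\<forall>x<T0. M2 x = sem c2 s x" "\<forall>x. T0 \<le> x \<longrightarrow> x < t \<longrightarrow> M2 x = M1 x"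
      using If.IH(2)[OF code(7), of M1 s] If.prems eq1 by auto
    have "goes P (p + asize e, M1) (Suc k2) (?p2 + length ?C2, M2)"
      by (rule goes_step[OF code(2,3)]) (use True M1(2) ae 2(2) in auto)
    from goes_trans[OF M1(1) this] show ?thesis
      using True 2 M1(3) len by (intro exI[of _ "asize e + Suc k2"] exI[of _ M2]) (auto simp: add.assoc)
  next
    case False
    obtain k2 M2 where 2: "k2 \<le> cost c1 s" "goes P (?p1, M1) k2 (?p1 + length ?C1, M2)"
      "\<forall>x<T0. M2 x = sem c1 s x" "\<forall>x. T0 \<le> x \<longrightarrow> x < t \<longrightarrow> M2 x = M1 x"
      using If.IH(1)[OF code(4), of M1 s] If.prems eq1 by auto
    have "goes P (?p1 + length ?C1, M2) (Suc 0) (?p2 + length ?C2, M2)"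
      by (rule goes_step[OF code(5,6)]) (simp_all add: goes_0)
    from goes_trans[OF 2(2) this]
    have "goes P (p + asize e, M1) (Suc (k2 + Suc 0)) (?p2 + length ?C2, M2)"
      by (intro goes_step[OF code(2,3)]) (use False M1(2) ae in auto)
    from goes_trans[OF M1(1) this] show ?thesis
      using False 2 M1(3) len
      by (intro exI[of _ "asize e + Suc (k2 + Suc 0)"] exI[of _ M2]) (auto simp: add.assoc)
  qed
next
  case (Loop e c)
  have sub: "avars e \<subseteq> {..<t}" using Loop.prems(2,3) by auto
  let ?h = "p + asize e"
  let ?C = "ccode c (Suc t) (?h + 2)"
  let ?fin = "?h + 2 + length ?C + 3"
  let ?e = "?h + 2 + length ?C"
  have code: "code_at P p (acode e t)" "?h < length P" "P ! ?h = Jz t ?fin"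
    "Suc ?h < length P" "P ! Suc ?h = Jneg t ?fin" "code_at P (?h + 2) ?C"
    "?e < length P" "P ! ?e = LoadC (Suc t) 1" "Suc ?e < length P" "P ! Suc ?e = Sub t t (Suc t)"
    "Suc (Suc ?e) < length P" "P ! Suc (Suc ?e) = Jmp ?h"
    using Loop.prems(1) by (simp_all add: Let_def code_at_Cons)
  have len: "p + length (ccode (Loop e c) t p) = ?fin"
    by (simp add: Let_def)
  obtain M1 where M1: "goes P (p, M) (asize e) (?h, M1)" "M1 t = aval e M" "\<forall>x<t. M1 x = M x"
    using acode_correct[OF code(1), of M] sub by auto
  have ae: "aval e M = aval e s" by (rule aval_cong) (use Loop.prems in auto)
  have eq1: "M1 x = s x" if "x < T0" for x using M1(3) Loop.prems(3,4) that by simp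
  have iter: "\<exists>k M'. k \<le> 2 + (\<Sum>i<j. cost c ((sem c ^^ i) s) + 5) \<and> goes P (?h, M1) k (?fin, M') \<and>
      (\<forall>x<T0. M' x = (sem c ^^ j) s x) \<and> (\<forall>x. T0 \<le> x \<longrightarrow> x < t \<longrightarrow> M' x = M1 x)"
    if "j = nat (M1 t)" "\<And>x. x < T0 \<Longrightarrow> M1 x = s x" for j M1 s
    using that
  proof (induction j arbitrary: M1 s)
    case 0
    show ?case
    proof (cases "M1 t = 0")
      case True
      have "goes P (?h, M1) (Suc 0) (?fin, M1)"
        by (rule goes_step[OF code(2,3)]) (use True in \<open>auto intro: goes_0\<close>)
      then show ?thesis using 0 by (intro exI[of _ "Suc 0"] exI[of _ M1]) auto
    next
      case False
      have "goes P (?h, M1) (Suc (Suc 0)) (?fin, M1)"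
        using goes_step[OF code(4,5), of M1 0 "(?fin, M1)"] False 0
        by (intro goes_step[OF code(2,3)]) simp_all
      then show ?thesis using 0 by (intro exI[of _ "Suc (Suc 0)"] exI[of _ M1]) auto
    qed
  next
    case (Suc j)
    have pos: "M1 t > 0" using Suc.prems(1) by simp
    obtain k2 M2 where 2: "k2 \<le> cost c s" "goes P (?h + 2, M1) k2 (?e, M2)"
      "\<forall>x<T0. M2 x = sem c s x" "\<forall>x. T0 \<le> x \<longrightarrow> x < Suc t \<longrightarrow> M2 x = M1 x"
      using Loop.IH[OF code(6), of M1 s] Loop.prems Suc.prems by auto
    let ?M3 = "M2(Suc t := 1, t := M2 t - 1)"
    have t2: "M2 t = M1 t" using 2(4) Loop.prems(3) by simp
    have "\<exists>k M'. k \<le> 2 + (\<Sum>i<j. cost c ((sem c ^^ i) (sem c s)) + 5) \<and> goes P (?h, ?M3) k (?fin, M') \<and>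
      (\<forall>x<T0. M' x = (sem c ^^ j) (sem c s) x) \<and> (\<forall>x. T0 \<le> x \<longrightarrow> x < t \<longrightarrow> M' x = ?M3 x)"
      by (rule Suc.IH) (use Suc.prems t2 2(3) Loop.prems(3) in auto)
    then obtain k3 M4 where 3: "k3 \<le> 2 + (\<Sum>i<j. cost c ((sem c ^^ i) (sem c s)) + 5)"
      "goes P (?h, ?M3) k3 (?fin, M4)" "\<forall>x<T0. M4 x = (sem c ^^ j) (sem c s) x"
      "\<forall>x. T0 \<le> x \<longrightarrow> x < t \<longrightarrow> M4 x = ?M3 x" by blast
    have "goes P (Suc (Suc ?e), ?M3) (Suc k3) (?fin, M4)"
      by (rule goes_step[OF code(11,12)]) (use 3(2) in simp_all)
    then have "goes P (Suc ?e, M2(Suc t := 1)) (Suc (Suc k3)) (?fin, M4)"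
      by (intro goes_step[OF code(9,10)]) simp_all
    then have "goes P (?e, M2) (Suc (Suc (Suc k3))) (?fin, M4)"
      by (intro goes_step[OF code(7,8)]) simp_all
    from goes_trans[OF 2(2) this]
    have "goes P (Suc ?h, M1) (Suc (k2 + Suc (Suc (Suc k3)))) (?fin, M4)"
      by (intro goes_step[OF code(4,5)]) (use pos in simp_all)
    then have "goes P (?h, M1) (Suc (Suc (k2 + Suc (Suc (Suc k3))))) (?fin, M4)"
      by (intro goes_step[OF code(2,3)]) (use pos in simp_all)
    moreover have "(\<Sum>i<Suc j. cost c ((sem c ^^ i) s) + 5) =
      cost c s + 5 + (\<Sum>i<j. cost c ((sem c ^^ i) (sem c s)) + 5)"
      unfolding sum.lessThan_Suc_shift by (simp add: funpow_swap1)
    ultimately show ?case using 2 3 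
      by (intro exI[of _ "Suc (Suc (k2 + Suc (Suc (Suc k3))))"] exI[of _ M4])
         (auto simp: funpow_swap1)
  qed
  obtain k M' where "k \<le> 2 + (\<Sum>i<nat (aval e s). cost c ((sem c ^^ i) s) + 5)" "goes P (?h, M1) k (?fin, M')"
      "\<forall>x<T0. M' x = (sem c ^^ nat (aval e s)) s x" "\<forall>x. T0 \<le> x \<longrightarrow> x < t \<longrightarrow> M' x = M1 x"
    using iter[of "nat (aval e s)" M1 s] M1(2) ae eq1 by auto
  then show ?case using goes_trans[OF M1(1)] M1(3) unfolding len
    by (intro exI[of _ "asize e + k"] exI[of _ M']) auto
qed

section \<open>Linear time for programs without nested loops\<close>

fun csize :: "com \<Rightarrow> nat" where
  "csize Skip = 0"
| "csize (Assign x e) = asize e + 2"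
| "csize (Seq c1 c2) = csize c1 + csize c2"
| "csize (If e c1 c2) = asize e + 2 + csize c1 + csize c2"
| "csize (Loop e c) = asize e + 7 + csize c"

fun loopfree :: "com \<Rightarrow> bool" where
  "loopfree (Seq c1 c2) \<longleftrightarrow> loopfree c1 \<and> loopfree c2"
| "loopfree (If e c1 c2) \<longleftrightarrow> loopfree c1 \<and> loopfree c2"
| "loopfree (Loop e c) \<longleftrightarrow> False"
| "loopfree _ \<longleftrightarrow> True"

text \<open>All loops share the bound \<open>X\<close> and have bodies of bounded cost. If nothing
  writes \<open>X\<close>, the total cost is linear in its initial value.\<close>

fun linear_in :: "nat \<Rightarrow> com \<Rightarrow> bool" where
  "linear_in X (Seq c1 c2) \<longleftrightarrow> linear_in X c1 \<and> linear_in X c2"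
| "linear_in X (If e c1 c2) \<longleftrightarrow> linear_in X c1 \<and> linear_in X c2"
| "linear_in X (Loop e c) \<longleftrightarrow> e = V X \<and> loopfree c"
| "linear_in X _ \<longleftrightarrow> True"

lemma cost_loopfree: "loopfree c \<Longrightarrow> cost c s \<le> csize c"
proof (induction c arbitrary: s)
  case (Seq c1 c2)
  then show ?case using add_mono[of "cost c1 s" "csize c1" "cost c2 (sem c1 s)" "csize c2"] by simp
next
  case (If e c1 c2)
  then show ?case by (auto simp: trans_le_add1 trans_le_add2)
qed auto

lemma cost_linear:
  "linear_in X c \<Longrightarrow> X \<notin> wvars c \<Longrightarrow> cost c s \<le> csize c * Suc (nat (s X))"
proof (induction c arbitrary: s)
  case (Seq c1 c2)
  have "cost c1 s \<le> csize c1 * Suc (nat (s X))" using Seq by simp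
  moreover have "cost c2 (sem c1 s) \<le> csize c2 * Suc (nat (s X))"
    using Seq.IH(2)[of "sem c1 s"] Seq.prems sem_wvars[of X c1 s] by simp
  ultimately show ?case by (simp add: add_mult_distrib)
next
  case (If e c1 c2)
  have "cost c1 s \<le> csize c1 * Suc (nat (s X))" "cost c2 s \<le> csize c2 * Suc (nat (s X))"
    using If by simp_all
  then show ?case by (auto simp: add_mult_distrib)
next
  case (Loop e c)
  then have lf: "loopfree c" "e = V X" by auto
  have "(\<Sum>i<nat (s X). cost c ((sem c ^^ i) s) + 5) \<le> (\<Sum>i<nat (s X). csize c + 5)"
    by (rule sum_mono) (use cost_loopfree[OF lf(1)] in auto)
  then show ?case using lf(2) by (simp add: algebra_simps)
qed auto

section \<open>Folding the input\<close>

text \<open>Registers and input share the memory, so the input is first folded into the single integer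
  \<open>\<Sum>i. letter i * \<beta> ^ i\<close>. The first six letters are added up by hand, which frees the registers
  that the folding loop needs.\<close>

definition fold_head :: "nat \<Rightarrow> instr list" where
  "fold_head \<beta> =
     [LoadC 3 (int \<beta> ^ 2), Mul 4 4 3, Add 2 2 4, LoadC 3 (int \<beta> ^ 3), Mul 5 5 3, Add 2 2 5,
      LoadC 3 (int \<beta> ^ 4), Mul 6 6 3, Add 2 2 6, LoadC 3 (int \<beta> ^ 5), Mul 7 7 3, Add 2 2 7,
      Add 1 0 1, LoadC 5 2, Add 1 1 5, LoadC 3 8, LoadC 4 (int \<beta> ^ 6), LoadC 6 (int \<beta>), LoadC 7 1]"

definition fold_loop :: "nat \<Rightarrow> instr list" where
  "fold_loop h = [Sub 5 1 3, Jz 5 (h + 9), Jneg 5 (h + 9), LoadI 5 3, Mul 5 5 4, Add 2 2 5,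
     Mul 4 4 6, Add 3 3 7, Jmp h]"

text \<open>Register 3 still holds the second letter and any other cell may hold input, so there is
  no place for the factor \<open>\<beta>\<close>. Repeating one addition \<open>\<beta>\<close>
  times multiplies without it and makes register 3 free for \<open>fold_head\<close>.\<close>

definition fold_input :: "nat \<Rightarrow> instr list" where
  "fold_input \<beta> = replicate \<beta> (Add 2 2 3) @ fold_head \<beta> @ fold_loop (\<beta> + 19)"

lemma length_fold_head [simp]: "length (fold_head \<beta>) = 19"
  by (simp add: fold_head_def)

lemma length_fold_input [simp]: "length (fold_input \<beta>) = \<beta> + 28"
  by (simp add: fold_input_def fold_head_def fold_loop_def)

lemma goes_replicate_Add:
  "code_at P p (replicate b (Add 2 2 3)) \<Longrightarrow>
    goes P (p, M) b (p + b, M(2 := M 2 + int b * M 3))"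
proof (induction b arbitrary: p M)
  case (Suc b)
  then have code: "p < length P" "P ! p = Add 2 2 3" "code_at P (Suc p) (replicate b (Add 2 2 3))"
    by (simp_all add: code_at_Cons)
  show ?case
    by (rule goes_step[OF code(1,2)])
       (use Suc.IH[OF code(3), of "M(2 := M 2 + M 3)"] in
         \<open>simp_all add: algebra_simps fun_upd_other fun_upd_same del: fun_upd_apply\<close>)
qed simp

lemma goes_fold_head:
  assumes "code_at P p (fold_head \<beta>)"
  shows "\<exists>M'. goes P (p, M) 19 (p + 19, M') \<and> M' 0 = M 0 \<and> M' 1 = M 0 + M 1 + 2 \<and>
    M' 2 = M 2 + M 4 * int \<beta> ^ 2 + M 5 * int \<beta> ^ 3 + M 6 * int \<beta> ^ 4 + M 7 * int \<beta> ^ 5 \<and>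
    M' 3 = 8 \<and> M' 4 = int \<beta> ^ 6 \<and> M' 6 = int \<beta> \<and> M' 7 = 1 \<and> (\<forall>x\<ge>8. M' x = M x)"
proof -
  let ?C = "fold_head \<beta>"
  have *: "goes P (p, M) (length C) (p + length C, snd (fold exec C (p, M)))"
    if "code_at P p C" "\<forall>i\<in>set C. i \<noteq> Halt \<and> (\<forall>p M. fst (exec i (p, M)) = Suc p)" for C p M
    using that
  proof (induction C arbitrary: p M)
    case (Cons i C)
    obtain M1 where M1: "exec i (p, M) = (Suc p, M1)"
      using Cons.prems(2) by (metis list.set_intros(1) prod.collapse)
    from Cons.prems(1) have code: "p < length P" "P ! p = i" "code_at P (Suc p) C"
      by (simp_all add: code_at_Cons)
    show ?case
      using goes_step[OF code(1,2), of M "length C" "(p + length (i # C), snd (fold exec (i # C) (p, M)))"]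
        Cons.IH[OF code(3), of M1] Cons.prems(2) M1 by simp
  qed simp
  have "goes P (p, M) (length ?C) (p + length ?C, snd (fold exec ?C (p, M)))"
    by (rule *[OF assms]) (simp add: fold_head_def)
  then have "goes P (p, M) 19 (p + 19, snd (fold exec ?C (p, M)))"
    unfolding length_fold_head .
  then show ?thesis
    by (intro exI[of _ "snd (fold exec ?C (p, M))"] conjI) (simp_all add: fold_head_def)
qed

lemma goes_Suc: "goes P c (Suc k) c' \<longleftrightarrow> goes P (ram_step P c) k c'"
  by (simp add: goes_def funpow_swap1)

text \<open>\<open>m\<close> may exceed \<open>L\<close>, because six cells have been added whatever
  the length of the input.\<close>

lemma goes_fold_loop:
  assumes code: "code_at P h (fold_loop h)"
    and "M 1 = int L + 2" "M 3 = int j + 2" "M 4 = int \<beta> ^ j" "M 6 = int \<beta>" "M 7 = 1"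
    and "M 2 = (\<Sum>i<j. inp (2 + i) * int \<beta> ^ i)" "\<forall>x\<ge>8. M x = inp x" "j \<ge> 6"
  shows "\<exists>k M' m. k \<le> 9 * (L - j) + 3 \<and> goes P (h, M) k (h + 9, M') \<and> M' 0 = M 0 \<and> M' 1 = M 1 \<and>
    M' 2 = (\<Sum>i<m. inp (2 + i) * int \<beta> ^ i) \<and> m \<ge> L"
proof -
  have "Suc (Suc (Suc (Suc (Suc (Suc (Suc (Suc h))))))) < length P"
    using code by (simp add: fold_loop_def code_at_Cons)
  then have len: "\<not> length P \<le> h" "\<not> length P \<le> Suc h" "\<not> length P \<le> Suc (Suc h)"
    "\<not> length P \<le> Suc (Suc (Suc h))" "\<not> length P \<le> Suc (Suc (Suc (Suc h)))"
    "\<not> length P \<le> Suc (Suc (Suc (Suc (Suc h))))" "\<not> length P \<le> Suc (Suc (Suc (Suc (Suc (Suc h)))))"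
    "\<not> length P \<le> Suc (Suc (Suc (Suc (Suc (Suc (Suc h))))))"
    "\<not> length P \<le> Suc (Suc (Suc (Suc (Suc (Suc (Suc (Suc h)))))))"
    by linarith+
  have instrs: "P ! h = Sub 5 1 3"
    "P ! Suc h = Jz 5 (h + 9)" "P ! Suc (Suc h) = Jneg 5 (h + 9)" "P ! Suc (Suc (Suc h)) = LoadI 5 3"
    "P ! Suc (Suc (Suc (Suc h))) = Mul 5 5 4" "P ! Suc (Suc (Suc (Suc (Suc h)))) = Add 2 2 5"
    "P ! Suc (Suc (Suc (Suc (Suc (Suc h))))) = Mul 4 4 6"
    "P ! Suc (Suc (Suc (Suc (Suc (Suc (Suc h)))))) = Add 3 3 7"
    "P ! Suc (Suc (Suc (Suc (Suc (Suc (Suc (Suc h))))))) = Jmp h"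
    using code by (simp_all add: fold_loop_def code_at_Cons)
  show ?thesis
  using assms(2-)
proof (induction "L - j" arbitrary: j M)
  case 0
  let ?M = "M(5 := int L - int j)"
  show ?case
  proof (cases "L = j")
    case True
    have "goes P (h, M) (Suc (Suc 0)) (h + 9, ?M)"
      using 0 True by (simp add: goes_Suc ram_step_def ram_halted_def instrs len)
    then show ?thesis using 0 by - (rule exI[of _ "Suc (Suc 0)"], rule exI[of _ ?M], rule exI[of _ j], simp add: fun_upd_def)
  next
    case False
    have "goes P (h, M) (Suc (Suc (Suc 0))) (h + 9, ?M)"
      using 0 False by (simp add: goes_Suc ram_step_def ram_halted_def instrs len)
    then show ?thesis using 0 by - (rule exI[of _ "Suc (Suc (Suc 0))"], rule exI[of _ ?M], rule exI[of _ j], simp add: fun_upd_def)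
  qed
next
  case (Suc r)
  let ?M = "M(5 := inp (2 + j) * int \<beta> ^ j, 2 := M 2 + inp (2 + j) * int \<beta> ^ j,
    4 := int \<beta> ^ Suc j, 3 := int (Suc j) + 2)"
  have M3: "nat (M 3) = 2 + j" "M (2 + j) = inp (2 + j)" using Suc.prems by auto
  have pos: "int L - int j > 0" using Suc.hyps(2) by simp
  have "goes P (h, M) (Suc (Suc (Suc (Suc (Suc (Suc (Suc (Suc (Suc 0))))))))) (h, ?M)"
    using Suc.prems M3 pos
    by (simp add: goes_Suc ram_step_def ram_halted_def instrs len fun_eq_iff)
  then have step: "goes P (h, M) 9 (h, ?M)" by (simp only: eval_nat_numeral BitM.simps)
  have "\<exists>k M' m. k \<le> 9 * (L - Suc j) + 3 \<and> goes P (h, ?M) k (h + 9, M') \<and> M' 0 = ?M 0 \<and> M' 1 = ?M 1 \<and>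
    M' 2 = (\<Sum>i<m. inp (2 + i) * int \<beta> ^ i) \<and> m \<ge> L"
    by (rule Suc.hyps(1)) (use Suc.hyps(2) Suc.prems in auto)
  then obtain k M' m where *: "k \<le> 9 * (L - Suc j) + 3" "goes P (h, ?M) k (h + 9, M')" "M' 0 = ?M 0" "M' 1 = ?M 1"
    "M' 2 = (\<Sum>i<m. inp (2 + i) * int \<beta> ^ i)" "m \<ge> L" by blast
  show ?case using * goes_trans[OF step *(2)] Suc.hyps(2)
    by - (rule exI[of _ "9 + k"], rule exI[of _ M'], rule exI[of _ m], simp)
qed
qed

definition digits_val :: "int \<Rightarrow> int list \<Rightarrow> int" where
  "digits_val \<beta> ds = foldr (\<lambda>d a. d + \<beta> * a) ds 0"

lemma digits_val_simps [simp]: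
  "digits_val \<beta> [] = 0" "digits_val \<beta> (d # ds) = d + \<beta> * digits_val \<beta> ds"
  by (simp_all add: digits_val_def)

lemma digits_val_sum: "digits_val \<beta> ds = (\<Sum>i<length ds. ds ! i * \<beta> ^ i)"
  by (induction ds) (simp_all add: sum.lessThan_Suc_shift sum_distrib_left algebra_simps del: sum.lessThan_Suc)

lemma ram_input_letters:
  "ram_input u v (Suc (Suc i)) = (if i < length (u @ v) then map enc_letter (u @ v) ! i else 0)"
  by (auto simp: ram_input_def nth_append)

lemma goes_fold_input:
  assumes "code_at P 0 (fold_input \<beta>)"
  shows "\<exists>k M'. k \<le> \<beta> + 22 + 9 * length (u @ v) \<and> goes P (0, ram_input u v) k (\<beta> + 28, M') \<and>
    M' 0 = int (length u) \<and> M' 1 = int (length (u @ v)) + 2 \<and>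
    M' 2 = digits_val (int \<beta>) (map enc_letter (u @ v))"
proof -
  let ?I = "ram_input u v"
  let ?L = "length (u @ v)"
  from assms have code: "code_at P 0 (replicate \<beta> (Add 2 2 3))" "code_at P \<beta> (fold_head \<beta>)"
    "code_at P (\<beta> + 19) (fold_loop (\<beta> + 19))"
    by (simp_all add: fold_input_def)
  define M1 where "M1 = ?I(2 := ?I 2 + int \<beta> * ?I 3)"
  have 1: "goes P (0, ?I) \<beta> (\<beta>, M1)"
    using goes_replicate_Add[OF code(1), of ?I] by (simp add: M1_def)
  obtain M2 where 2: "goes P (\<beta>, M1) 19 (\<beta> + 19, M2)" "M2 0 = M1 0" "M2 1 = M1 0 + M1 1 + 2"
    "M2 2 = M1 2 + M1 4 * int \<beta> ^ 2 + M1 5 * int \<beta> ^ 3 + M1 6 * int \<beta> ^ 4 + M1 7 * int \<beta> ^ 5"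
    "M2 3 = 8" "M2 4 = int \<beta> ^ 6" "M2 6 = int \<beta>" "M2 7 = 1" "\<forall>x\<ge>8. M2 x = M1 x"
    using goes_fold_head[OF code(2), of M1] by blast
  have I: "?I 0 = int (length u)" "?I 1 = int (length v)" by (simp_all add: ram_input_def)
  have sum6: "M2 2 = (\<Sum>i<6. ?I (2 + i) * int \<beta> ^ i)"
    using 2(4) by (simp add: M1_def eval_nat_numeral)
  have "\<exists>k M' m. k \<le> 9 * (?L - 6) + 3 \<and> goes P (\<beta> + 19, M2) k (\<beta> + 19 + 9, M') \<and> M' 0 = M2 0 \<and>
    M' 1 = M2 1 \<and> M' 2 = (\<Sum>i<m. ?I (2 + i) * int \<beta> ^ i) \<and> m \<ge> ?L"
    by (rule goes_fold_loop[OF code(3)]) (use 2 I sum6 in \<open>auto simp: M1_def\<close>)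
  then obtain k M3 m where 3: "k \<le> 9 * (?L - 6) + 3" "goes P (\<beta> + 19, M2) k (\<beta> + 19 + 9, M3)"
    "M3 0 = M2 0" "M3 1 = M2 1" "M3 2 = (\<Sum>i<m. ?I (2 + i) * int \<beta> ^ i)" "m \<ge> ?L" by blast
  \<comment> \<open>Cells behind the input are 0, so the cells added in excess for short inputs
    contribute nothing.\<close>
  have "(\<Sum>i<m. ?I (2 + i) * int \<beta> ^ i) = (\<Sum>i<?L. ?I (2 + i) * int \<beta> ^ i)"
    by (rule sum.mono_neutral_right) (use 3(6) in \<open>auto simp: ram_input_letters\<close>)
  also have "\<dots> = digits_val (int \<beta>) (map enc_letter (u @ v))"
    unfolding digits_val_sum by (rule sum.cong) (auto simp: ram_input_letters simp del: map_append)
  finally have "M3 2 = digits_val (int \<beta>) (map enc_letter (u @ v))" using 3(5) by simp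
  moreover have "goes P (0, ?I) (\<beta> + 19 + k) (\<beta> + 28, M3)"
    using goes_trans[OF goes_trans[OF 1 2(1)] 3(2)] by (simp add: add.assoc)
  moreover have "\<beta> + 19 + k \<le> \<beta> + 22 + 9 * ?L" using 3(1) by simp
  moreover have "M3 0 = int (length u)" "M3 1 = int ?L + 2" using 3 2 I by (simp_all add: M1_def)
  ultimately show ?thesis by blast
qed

definition ram_of :: "nat \<Rightarrow> com \<Rightarrow> nat \<Rightarrow> instr list" where
  "ram_of \<beta> c T = fold_input \<beta> @ ccode c T (\<beta> + 28) @ [Halt]"

theorem ram_of_correct:
  assumes "cvars c \<subseteq> {..<T}" "0 < T"
  shows "\<exists>s k M. s 0 = int (length u) \<and> s 1 = int (length (u @ v)) + 2 \<and>
    s 2 = digits_val (int \<beta>) (map enc_letter (u @ v)) \<and>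
    k \<le> \<beta> + 22 + 9 * length (u @ v) + cost c s \<and>
    ram_halts_within (ram_of \<beta> c T) (ram_input u v) k M \<and> M 0 = sem c s 0"
proof -
  let ?P = "ram_of \<beta> c T" and ?C = "ccode c T (\<beta> + 28)"
  have "code_at ?P 0 ?P" by (simp add: code_at_def)
  then have code: "code_at ?P 0 (fold_input \<beta>)" "code_at ?P (\<beta> + 28) ?C"
    and halt: "?P ! (\<beta> + 28 + length ?C) = Halt"
    unfolding ram_of_def by (auto simp: code_at_Cons)
  obtain k s where 1: "k \<le> \<beta> + 22 + 9 * length (u @ v)" "goes ?P (0, ram_input u v) k (\<beta> + 28, s)"
    "s 0 = int (length u)" "s 1 = int (length (u @ v)) + 2"
    "s 2 = digits_val (int \<beta>) (map enc_letter (u @ v))"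
    using goes_fold_input[OF code(1)] by blast
  obtain k' M where 2: "k' \<le> cost c s" "goes ?P (\<beta> + 28, s) k' (\<beta> + 28 + length ?C, M)"
    "\<forall>x<T. M x = sem c s x"
    using ccode_correct[OF code(2) assms(1) order_refl, of s s] by auto
  have "ram_halts_within ?P (ram_input u v) (k + k') M"
    using goes_trans[OF 1(2) 2(2)] halt by (simp add: goes_def ram_halts_within_def ram_halted_def)
  then show ?thesis using 1 2 assms(2)
    by (intro exI[of _ s] exI[of _ "k + k'"] exI[of _ M]) auto
qed

section \<open>Registers and letter insertion\<close>

text \<open>The front of the stack is the most significant digit: a push at the back is
  \<open>3 * x + d\<close>, while the front needs the power of 3. As spacers are zeros, the integer
  alone does not determine the height.\<close>

fun enc :: "nat list \<Rightarrow> int" where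
  "enc [] = 0"
| "enc (d # ds) = int d * 3 ^ length ds + enc ds"

definition ternary :: "nat list \<Rightarrow> bool" where
  "ternary ds \<longleftrightarrow> (\<forall>d\<in>set ds. d < 3)"

lemma ternary_simps [simp]:
  "ternary []" "ternary (d # ds) \<longleftrightarrow> d < 3 \<and> ternary ds" "ternary (xs @ ys) \<longleftrightarrow> ternary xs \<and> ternary ys"
  by (auto simp: ternary_def)

lemma enc_append: "enc (xs @ ys) = enc xs * 3 ^ length ys + enc ys"
  by (induction xs) (simp_all add: algebra_simps power_add)

lemma enc_bounds: "ternary ds \<Longrightarrow> 0 \<le> enc ds \<and> enc ds < 3 ^ length ds"
proof (induction ds)
  case (Cons d ds)
  then have "int d * 3 ^ length ds \<le> 2 * 3 ^ length ds" by (intro mult_right_mono) auto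
  moreover have "0 \<le> int d * 3 ^ length ds" by simp
  moreover have "0 \<le> enc ds \<and> enc ds < 3 ^ length ds" using Cons by simp
  ultimately show ?case unfolding enc.simps list.size power_Suc add_Suc_right add_0_right by linarith
qed simp

lemma enc_front: "ternary ds \<Longrightarrow> enc ds div (3 ^ length ds div 3) = (if ds = [] then 0 else int (hd ds))"
  using enc_bounds by (cases ds) (auto simp: div_eq_0_iff)

lemma enc_tl: "ternary ds \<Longrightarrow> enc ds mod (3 ^ length ds div 3) = enc (tl ds)"
  using enc_bounds by (cases ds) auto

lemma enc_last: "ternary ds \<Longrightarrow> enc ds mod 3 = (if ds = [] then 0 else int (last ds))"
  by (cases ds rule: rev_cases) (auto simp: enc_append)

lemma enc_snoc_div: "d < 3 \<Longrightarrow> enc (ds @ [d]) div 3 = enc ds"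
  by (simp add: enc_append)

lemma enc_inject:
  assumes "ternary xs" "ternary ys" "length xs = length ys"
  shows "enc xs = enc ys \<longleftrightarrow> xs = ys"
  using assms(3,1,2)
proof (induction xs ys rule: list_induct2)
  case (Cons x xs y ys)
  have front: "enc (x # xs) div 3 ^ length xs = int x" "enc (y # ys) div 3 ^ length ys = int y"
    using enc_front[of "x # xs"] enc_front[of "y # ys"] Cons.prems by simp_all
  show ?case
  proof
    assume eq: "enc (x # xs) = enc (y # ys)"
    then have "int x = int y" using front Cons.hyps by metis
    then show "x # xs = y # ys" using eq Cons by simp
  qed simp
qed simp

text \<open>Register 0 holds the length of the first word and in the end the verdict, 1 the input length
  plus 2, 2 the folded input, 3 the bound for all loops, 4 and 5 the numbers of letters still to be read,
  6 the current letter, 7 the digit being rotated, 8 the flag for a match. Every vertex has a bank of 8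
  registers: stack, power of 3 encoding its height and number of letters for the first word (0-2) and for
  the second (3-5), and scratch copies of both stacks (6, 7). The junk value
  \<open>x div 0 = 0\<close> makes the front digit of an empty stack 0, like that of a spacer.\<close>

definition reg :: "nat \<Rightarrow> nat \<Rightarrow> nat" where
  "reg k b = 16 + 8 * b + k"

lemma reg_eq_iff [simp]: "k < 8 \<Longrightarrow> k' < 8 \<Longrightarrow> reg k b = reg k' c \<longleftrightarrow> k = k' \<and> b = c"
  unfolding reg_def by presburger

lemma reg_neq [simp]: "x < 16 \<Longrightarrow> reg k b \<noteq> x" "x < 16 \<Longrightarrow> x \<noteq> reg k b"
  by (auto simp: reg_def)

definition bank :: "nat \<Rightarrow> nat set" where
  "bank b = {reg k b |k. k < 8}"

lemma bank_simps [simp]: "k < 8 \<Longrightarrow> reg k b \<in> bank c \<longleftrightarrow> b = c" "x < 16 \<Longrightarrow> x \<notin> bank c"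
  by (auto simp: bank_def)

lemma bank_disjoint: "x \<in> bank b \<Longrightarrow> x \<in> bank c \<Longrightarrow> b = c"
  by (auto simp: bank_def)

definition seqs :: "com list \<Rightarrow> com" where
  "seqs cs = foldr Seq cs Skip"

lemma seqs_simps [simp]:
  "sem (seqs []) s = s" "sem (seqs (c # cs)) s = sem (seqs cs) (sem c s)"
  "sem (seqs (cs @ ds)) s = sem (seqs ds) (sem (seqs cs) s)"
  "cvars (seqs cs) = (\<Union>c\<in>set cs. cvars c)" "wvars (seqs cs) = (\<Union>c\<in>set cs. wvars c)"
  "loopfree (seqs cs) \<longleftrightarrow> (\<forall>c\<in>set cs. loopfree c)"
  "linear_in X (seqs cs) \<longleftrightarrow> (\<forall>c\<in>set cs. linear_in X c)"
proof -
  show "sem (seqs (cs @ ds)) s = sem (seqs ds) (sem (seqs cs) s)"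
    by (induction cs arbitrary: s) (simp_all add: seqs_def)
  show "cvars (seqs cs) = (\<Union>c\<in>set cs. cvars c)" "wvars (seqs cs) = (\<Union>c\<in>set cs. wvars c)"
    "loopfree (seqs cs) \<longleftrightarrow> (\<forall>c\<in>set cs. loopfree c)"
    "linear_in X (seqs cs) \<longleftrightarrow> (\<forall>c\<in>set cs. linear_in X c)"
    by (induction cs) (simp_all add: seqs_def)
qed (simp_all add: seqs_def)

lemma sem_cong:
  assumes "cvars c \<subseteq> A" "\<And>x. x \<in> A \<Longrightarrow> s x = s' x" "x \<in> A"
  shows "sem c s x = sem c s' x"
  using assms
proof (induction c arbitrary: s s' x)
  case (Assign y e)
  have "aval e s = aval e s'" by (rule aval_cong) (use Assign in auto)
  then show ?case using Assign by simp
next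
  case (Seq c1 c2)
  have vars: "cvars c1 \<subseteq> A" "cvars c2 \<subseteq> A" using Seq.prems(1) by auto
  have 1: "sem c1 s y = sem c1 s' y" if "y \<in> A" for y
    by (rule Seq.IH(1)[OF vars(1) Seq.prems(2) that])
  show ?case unfolding sem.simps by (rule Seq.IH(2)[OF vars(2) 1 Seq.prems(3)])
next
  case (If e c1 c2)
  have "aval e s = aval e s'" by (rule aval_cong) (use If in auto)
  moreover have "sem c1 s x = sem c1 s' x" "sem c2 s x = sem c2 s' x"
    using If.IH[OF _ If.prems(2,3)] If.prems(1) by simp_all
  ultimately show ?case by simp
next
  case (Loop e c)
  have e: "aval e s = aval e s'" by (rule aval_cong) (use Loop in auto)
  have "(sem c ^^ k) s x = (sem c ^^ k) s' x" if "x \<in> A" for k x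
    using that
  proof (induction k arbitrary: x)
    case (Suc k)
    have "cvars c \<subseteq> A" using Loop.prems(1) by simp
    then show ?case unfolding funpow.simps comp_apply by (rule Loop.IH[OF _ Suc.IH Suc.prems])
  qed (use Loop.prems in auto)
  then show ?case using e Loop.prems(3) by simp
qed auto

text \<open>Each command writes only its own bank and reads only that bank and the small registers,
  which none of them writes. So the sequence acts on all banks as if simultaneously.\<close>

lemma sem_banks:
  assumes "distinct bs" "\<And>b. wvars (f b) \<subseteq> bank b" "\<And>b. cvars (f b) \<subseteq> bank b \<union> {..<16}"
  shows "(\<forall>b\<in>set bs. \<forall>x\<in>bank b. sem (seqs (map f bs)) s x = sem (f b) s x) \<and>
    (\<forall>x. (\<forall>b\<in>set bs. x \<notin> bank b) \<longrightarrow> sem (seqs (map f bs)) s x = s x)"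
  using assms(1)
proof (induction bs arbitrary: s)
  case (Cons b bs)
  let ?s = "sem (f b) s"
  have out: "?s x = s x" if "x \<notin> bank b" for x using sem_wvars that assms(2) by blast
  have IH: "\<forall>b\<in>set bs. \<forall>x\<in>bank b. sem (seqs (map f bs)) ?s x = sem (f b) ?s x"
    "\<forall>x. (\<forall>b\<in>set bs. x \<notin> bank b) \<longrightarrow> sem (seqs (map f bs)) ?s x = ?s x"
    using Cons by auto
  have "sem (f c) ?s x = sem (f c) s x" if "c \<in> set bs" "x \<in> bank c" for c x
  proof (rule sem_cong[OF assms(3)])
    fix y assume "y \<in> bank c \<union> {..<16}"
    moreover have "c \<noteq> b" using that Cons.prems by auto
    ultimately have "y \<notin> bank b" using bank_disjoint by auto
    then show "?s y = s y" by (rule out)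
  qed (use that in auto)
  moreover have "x \<notin> bank c" if "c \<in> set bs" "x \<in> bank b" for c x
    using that Cons.prems bank_disjoint by auto
  ultimately show ?case using IH out by auto
qed simp

text \<open>For loops with a fixed number of rounds: the measure may drop faster than by one, and
  the finished state has to survive the remaining rounds.\<close>

lemma funpow_reach_0:
  assumes "\<And>s. I 0 s \<Longrightarrow> I 0 (f s)" "\<And>m s. I (Suc m) s \<Longrightarrow> \<exists>m'\<le>m. I m' (f s)" "I m s" "m \<le> (k::nat)"
  shows "I 0 ((f ^^ k) s)"
  using assms(3,4)
proof (induction k arbitrary: m s)
  case (Suc k)
  have "\<exists>m'\<le>k. I m' (f s)"
  proof (cases m)
    case 0
    then show ?thesis using assms(1) Suc.prems by blast
  next
    case (Suc m')
    then show ?thesis using assms(2)[of m' s] Suc.prems by (meson Suc_le_mono le_trans)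
  qed
  then show ?case using Suc.IH by (metis comp_apply funpow_Suc_right)
qed simp

abbreviation "sub \<equiv> Bin Minus"

locale raag_alg = raag +
  fixes n :: nat
begin

lemma ternary_proj [simp]: "ternary (proj a w)"
  by (induction w) auto

definition repr :: "nat \<Rightarrow> letter list \<Rightarrow> (nat \<Rightarrow> int) \<Rightarrow> bool" where
  "repr k w s \<longleftrightarrow> (\<forall>b<n. s (reg k b) = enc (proj b w) \<and> s (reg (k + 1) b) = 3 ^ length (proj b w) \<and>
     s (reg (k + 2) b) = int (count_list (map fst w) b))"

definition front_e :: "nat \<Rightarrow> nat \<Rightarrow> nat \<Rightarrow> aexp" where
  "front_e v p b = Bin Quot (V (reg v b)) (Bin Quot (V (reg p b)) (N 3))"

definition back_e :: "nat \<Rightarrow> nat \<Rightarrow> aexp" where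
  "back_e v b = Bin Rem (V (reg v b)) (N 3)"

definition push_bank :: "nat \<Rightarrow> nat \<Rightarrow> nat \<Rightarrow> nat \<Rightarrow> com" where
  "push_bank k b d c = (if E b c then Skip else
     Seq (Assign (reg k c) (Bin Plus (Bin Times (N 3) (V (reg k c))) (N (if c = b then int d else 0))))
     (Seq (Assign (reg (k + 1) c) (Bin Times (N 3) (V (reg (k + 1) c))))
     (if c = b then Assign (reg (k + 2) c) (Bin Plus (V (reg (k + 2) c)) (N 1)) else Skip)))"

definition pop_bank :: "nat \<Rightarrow> nat \<Rightarrow> nat \<Rightarrow> com" where
  "pop_bank k b c = (if E b c then Skip else
     Seq (Assign (reg k c) (Bin Quot (V (reg k c)) (N 3)))
     (Seq (Assign (reg (k + 1) c) (Bin Quot (V (reg (k + 1) c)) (N 3)))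
     (if c = b then Assign (reg (k + 2) c) (sub (V (reg (k + 2) c)) (N 1)) else Skip)))"

text \<open>A zero back digit, from a spacer or an empty stack, never equals \<open>3 - d\<close>.
  So a letter is popped only if it is the inverse and can be moved to the end of the word.\<close>

definition push :: "nat \<Rightarrow> nat \<Rightarrow> nat \<Rightarrow> com" where
  "push k b d = If (sub (back_e k b) (N (3 - int d)))
     (seqs (map (push_bank k b d) [0..<n])) (seqs (map (pop_bank k b) [0..<n]))"

lemma sem_banks_upt:
  assumes "\<And>b. wvars (f b) \<subseteq> bank b" "\<And>b. cvars (f b) \<subseteq> bank b \<union> {..<16}" "b < n" "k < 8"
  shows "sem (seqs (map f [0..<n])) s (reg k b) = sem (f b) s (reg k b)"
  using sem_banks[of "[0..<n]" f s] assms by simp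

lemma push_bank_vars [simp]:
  assumes "k + 2 < 8"
  shows "wvars (push_bank k b d c) \<subseteq> bank c" "cvars (push_bank k b d c) \<subseteq> bank c"
    "wvars (pop_bank k b c) \<subseteq> bank c" "cvars (pop_bank k b c) \<subseteq> bank c"
  using assms by (auto simp: push_bank_def pop_bank_def)

lemma teq_raag_eq: "x \<equiv>\<^sub>t y \<Longrightarrow> set x \<subseteq> letters n \<Longrightarrow> raag_eq n E x y"
proof (induction rule: equivclp_induct)
  case (step y z)
  have "set y = set x"
    using step.hyps(1) by (rule equivclp_invariant[symmetric]) (rule swap_letters)
  then have "raag_eq n E y z"
    using step.hyps(2) step.prems swap_raag_eq[of y z] swap_raag_eq[of z y] swap_letters[of z y]
    by (auto intro: raag_eq_sym)
  then show ?case using step raag_eq_trans by blast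
qed simp

text \<open>A new cancelling pair must end in \<open>l\<close>, and then its partner is the last
  digit of the stack over the same vertex.\<close>

lemma red_snoc:
  assumes "red w" "last (proj (fst l) w) \<noteq> 3 - dg (snd l) \<or> proj (fst l) w = []"
  shows "red (w @ [l])"
  unfolding red_def
proof (intro notI, elim exE conjE)
  fix A p M B assume *: "w @ [l] = A @ p # M @ inv_letter p # B" "\<forall>m\<in>set M. E (fst p) (fst m)"
  show False
  proof (cases B rule: rev_cases)
    case Nil
    with * have w: "w = A @ p # M" "l = inv_letter p" by auto
    have "proj (fst p) M = []" using *(2) by (induction M) auto
    then show False using w assms(2) by (auto simp: inv_letter_def dg_def split: if_splits)
  next
    case (snoc B' l')
    with * have "w = A @ p # M @ inv_letter p # B'" by auto
    then show False using assms(1) *(2) unfolding red_def by blast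
  qed
qed

lemma sem_push:
  assumes k: "k + 2 < 8" and l: "fst l < n" and w: "red w" "set w \<subseteq> letters n" and s: "repr k w s"
  shows "\<exists>w'. red w' \<and> set w' \<subseteq> letters n \<and> length w' \<le> Suc (length w) \<and> raag_eq n E (w @ [l]) w' \<and>
    repr k w' (sem (push k (fst l) (dg (snd l))) s)"
proof -
  let ?b = "fst l" and ?d = "dg (snd l)"
  let ?s = "sem (push k ?b ?d) s"
  have last: "aval (back_e k ?b) s = (if proj ?b w = [] then 0 else int (last (proj ?b w)))"
    using s l by (simp add: back_e_def repr_def enc_last)
  show ?thesis
  proof (cases "proj ?b w \<noteq> [] \<and> last (proj ?b w) = 3 - ?d")
    case True
    then have "proj ?b w = butlast (proj ?b w) @ [3 - ?d]" by (metis append_butlast_last_id)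
    moreover have "3 - ?d \<noteq> 0" by (simp add: dg_def)
    ultimately obtain A l' B where w': "w = A @ l' # B" "fst l' = ?b"
      "dg (snd l') = 3 - ?d" "\<forall>m\<in>set B. E ?b (fst m)" using proj_last by blast
    have l': "l' = inv_letter l" using w'(2,3) by (auto simp: inv_letter_def prod_eq_iff dg_def split: if_splits)
    have eq: "w \<equiv>\<^sub>t (A @ B) @ [l']"
      using swap_past'[where v = fst and a = l' and M = B and A = A and B = "[]"] w' by simp
    have proj: "proj c w = proj c (A @ B) @ proj c [l']" for c
      using proj_teq[OF eq, of c] by simp
    have sem: "?s = sem (seqs (map (pop_bank k ?b) [0..<n])) s"
      using True last by (auto simp: push_def dg_def)
    have "?s (reg i c) = sem (pop_bank k ?b c) s (reg i c)" if "c < n" "i < 8" for i c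
      unfolding sem by (rule sem_banks_upt) (use push_bank_vars[OF k] that in blast)+
    moreover have "count_list (map fst w) c = count_list (map fst (A @ B)) c + (if c = ?b then 1 else 0)" for c
      using w'(1,2) by simp
    moreover have "proj c w = proj c (A @ B) @ (if E ?b c then [] else [if c = ?b then dg (snd l') else 0])" for c
      unfolding proj using w'(2) by (auto simp: E_commute)
    ultimately have "repr k (A @ B) ?s"
      using s k unfolding repr_def pop_bank_def
      by (auto simp: enc_snoc_div simp del: proj_simps(2))
    moreover have "red (A @ B)" by (rule red_remove[of A l' B]) (use w w' in auto)
    moreover have "raag_eq n E (w @ [l]) (A @ B)"
    proof -
      have "raag_eq n E (w @ [l]) (((A @ B) @ [l']) @ [l])"
      proof -
        show ?thesis using raag_eq_ctxt[OF teq_raag_eq[OF eq w(2)], of "[]" "[l]"] by simp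
      qed
      moreover have "raag_eq n E ((A @ B) @ inv_word [l] @ [l] @ []) ((A @ B) @ [])"
        by (rule raag_eq_inverse_left) (use l in \<open>auto simp: letters_def\<close>)
      ultimately show ?thesis using l' by (auto intro: raag_eq_trans)
    qed
    ultimately show ?thesis using w w' by (intro exI[of _ "A @ B"]) auto
  next
    case False
    have sem: "?s = sem (seqs (map (push_bank k ?b ?d) [0..<n])) s"
      using False last by (auto simp: push_def dg_def split: if_splits)
    have "?s (reg i c) = sem (push_bank k ?b ?d c) s (reg i c)" if "c < n" "i < 8" for i c
      unfolding sem by (rule sem_banks_upt) (use push_bank_vars[OF k] that in blast)+
    then have "repr k (w @ [l]) ?s"
      using s k by (auto simp: repr_def push_bank_def enc_append E_commute[of _ "fst l"])
    moreover have "red (w @ [l])" by (rule red_snoc) (use w False in auto)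
    ultimately show ?thesis using w l by (intro exI[of _ "w @ [l]"]) (auto simp: letters_def)
  qed
qed

definition push_letter :: "nat \<Rightarrow> com" where
  "push_letter k = seqs (map (\<lambda>b. Seq (If (sub (V 6) (N (int b + 1))) Skip (push k b 1))
     (If (Bin Plus (V 6) (N (int b + 1))) Skip (push k b 2))) [0..<n])"

definition read :: "nat \<Rightarrow> nat \<Rightarrow> com" where
  "read k J = If (V J) (seqs
     [Assign 6 (sub (Bin Rem (Bin Plus (V 2) (N (int n))) (N (2 * int n + 1))) (N (int n))),
      Assign 2 (Bin Quot (sub (V 2) (V 6)) (N (2 * int n + 1))),
      push_letter k, Assign J (sub (V J) (N 1))]) Skip"

definition kregs :: "nat \<Rightarrow> nat set" where
  "kregs k = (\<Union>c<n. {reg k c, reg (k + 1) c, reg (k + 2) c})"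

lemma push_wvars:
  assumes "k + 2 < 8"
  shows "wvars (push k b d) \<subseteq> kregs k"
  using assms by (auto simp: push_def push_bank_def pop_bank_def back_e_def kregs_def split: if_splits)

lemma small_kregs: "x < 16 \<Longrightarrow> x \<notin> kregs k"
  by (auto simp: kregs_def)

lemma push_small: "k + 2 < 8 \<Longrightarrow> x < 16 \<Longrightarrow> sem (push k b d) s x = s x"
  using push_wvars[of k b d] small_kregs by (intro sem_wvars) blast

lemma sem_push_letter:
  assumes "s 6 = enc_letter l" "fst l < n" "k + 2 < 8"
  shows "sem (push_letter k) s = sem (push k (fst l) (dg (snd l))) s"
proof -
  define f where "f b = Seq (If (sub (V 6) (N (int b + 1))) Skip (push k b 1))
     (If (Bin Plus (V 6) (N (int b + 1))) Skip (push k b 2))" for b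
  have skip: "sem (f b) s = s" if "s 6 = enc_letter l" "b \<noteq> fst l" for b s
    using that by (auto simp: f_def enc_letter_def)
  have hit: "sem (f (fst l)) s = sem (push k (fst l) (dg (snd l))) s" if "s 6 = enc_letter l" for s
    using that assms push_small[of k 6 "fst l"] by (auto simp: f_def enc_letter_def dg_def)
  have skips: "sem (seqs (map f bs)) s = s" if "s 6 = enc_letter l" "fst l \<notin> set bs" for bs s
    using that by (induction bs) (auto simp: skip)
  have "[0..<n] = [0..<fst l] @ fst l # [Suc (fst l)..<n]"
    using assms(2) by (metis upt_conv_Cons upt_add_eq_append le_add_diff_inverse less_imp_le_nat zero_le)
  then have "sem (push_letter k) s = sem (seqs (map f [Suc (fst l)..<n]))
    (sem (f (fst l)) (sem (seqs (map f [0..<fst l])) s))"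
    unfolding push_letter_def f_def[symmetric] by (simp del: upt_Suc)
  also have "\<dots> = sem (push k (fst l) (dg (snd l))) s"
    using assms push_small[of k 6 "fst l"]
    by (simp del: upt_Suc add: skips hit)
  finally show ?thesis .
qed

text \<open>Letters are digits between \<open>-n\<close> and \<open>n\<close>, so base
  \<open>2 * n + 1\<close> is balanced; shifting by \<open>n\<close> makes \<open>mod\<close> return
  the signed digit.\<close>

lemma digits_val_decode:
  assumes "fst l < n"
  shows "(digits_val (2 * int n + 1) (enc_letter l # ds) + int n) mod (2 * int n + 1) - int n = enc_letter l"
proof -
  have "0 \<le> enc_letter l + int n" "enc_letter l + int n < 2 * int n + 1"
    using assms by (auto simp: enc_letter_def)
  then have "(enc_letter l + int n) mod (2 * int n + 1) = enc_letter l + int n"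
    by (rule mod_pos_pos_trivial)
  moreover have "digits_val (2 * int n + 1) (enc_letter l # ds) + int n =
    enc_letter l + int n + (2 * int n + 1) * digits_val (2 * int n + 1) ds" by simp
  ultimately show ?thesis by (metis add_diff_cancel_right' mod_mult_self2)
qed

lemma repr_cong: "repr k w s \<Longrightarrow> (\<And>i b. b < n \<Longrightarrow> i \<in> {k, k + 1, k + 2} \<Longrightarrow> s' (reg i b) = s (reg i b)) \<Longrightarrow> repr k w s'"
  by (simp add: repr_def)

lemma read_loop:
  assumes k: "k + 2 < 8" and J: "J \<in> {4, 5}" and u: "set u \<subseteq> letters n"
    and s: "s J = int (length u)" "s 2 = digits_val (2 * int n + 1) (map enc_letter (u @ v))" "repr k [] s"
    and X: "length u \<le> X"
  shows "\<exists>w. red w \<and> set w \<subseteq> letters n \<and> length w \<le> length u \<and> raag_eq n E u w \<and>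
    repr k w ((sem (read k J) ^^ X) s) \<and>
    (sem (read k J) ^^ X) s 2 = digits_val (2 * int n + 1) (map enc_letter v)"
proof -
  let ?\<beta> = "2 * int n + 1"
  define I where "I m s \<longleftrightarrow> (\<exists>pre suf w. u = pre @ suf \<and> length suf = m \<and> s J = int m \<and>
    s 2 = digits_val ?\<beta> (map enc_letter (suf @ v)) \<and> red w \<and> set w \<subseteq> letters n \<and>
    length w \<le> length pre \<and> raag_eq n E pre w \<and> repr k w s)" for m s
  have "I 0 ((sem (read k J) ^^ X) s)"
  proof (rule funpow_reach_0[where I = I and f = "sem (read k J)", OF _ _ _ X])
    show "I 0 (sem (read k J) s)" if "I 0 s" for s
      using that by (auto simp: I_def read_def)
  next
    fix m s assume "I (Suc m) s"
    then obtain pre suf w where *: "u = pre @ suf" "length suf = Suc m" "s J = int (Suc m)"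
      "s 2 = digits_val ?\<beta> (map enc_letter (suf @ v))" "red w" "set w \<subseteq> letters n"
      "length w \<le> length pre" "raag_eq n E pre w" "repr k w s"
      unfolding I_def by blast
    then obtain l suf' where l: "suf = l # suf'" by (cases suf) auto
    have fl: "fst l < n" using u *(1) l by (auto simp: letters_def)
    define s1 where "s1 = s(6 := enc_letter l, 2 := digits_val ?\<beta> (map enc_letter (suf' @ v)))"
    have dec: "(s 2 + int n) mod ?\<beta> - int n = enc_letter l"
      using digits_val_decode[OF fl] *(4) l by simp
    have "(s 2 - enc_letter l) div ?\<beta> = digits_val ?\<beta> (map enc_letter (suf' @ v))"
      using *(4) l by simp
    then have read: "sem (read k J) s = (\<lambda>s. s(J := s J - 1)) (sem (push k (fst l) (dg (snd l))) s1)"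
      using dec *(3) sem_push_letter[of s1 l k] fl k
      by (simp add: read_def s1_def algebra_simps)
    have "repr k w s1" by (rule repr_cong[OF *(9)]) (use k in \<open>auto simp: s1_def\<close>)
    from sem_push[OF k fl *(5,6) this] obtain w' where w': "red w'" "set w' \<subseteq> letters n"
      "length w' \<le> Suc (length w)" "raag_eq n E (w @ [l]) w'" "repr k w' (sem (push k (fst l) (dg (snd l))) s1)"
      by blast
    have "repr k w' (sem (read k J) s)" unfolding read
      by (rule repr_cong[OF w'(5)]) (use k J in auto)
    moreover have "raag_eq n E (pre @ [l]) w'"
      using raag_eq_ctxt[OF *(8), of "[]" "[l]"] w'(4) raag_eq_trans by fastforce
    moreover have "sem (read k J) s J = int m" "sem (read k J) s 2 = digits_val ?\<beta> (map enc_letter (suf' @ v))"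
      unfolding read using *(3) J push_small[OF k, of J "fst l" _ s1] push_small[OF k, of 2 "fst l" _ s1]
      by (auto simp: s1_def)
    ultimately have "I m (sem (read k J) s)"
      unfolding I_def using * l w' by (intro exI[of _ "pre @ [l]"] exI[of _ suf'] exI[of _ w']) auto
    then show "\<exists>m'\<le>m. I m' (sem (read k J) s)" by blast
  next
    show "I (length u) s" unfolding I_def using s
      by (intro exI[of _ "[]"] exI[of _ u]) (auto simp: red_def)
  qed
  then show ?thesis unfolding I_def by auto
qed

end

section \<open>Cyclic reduction\<close>

context raag_alg
begin

definition td_e :: "nat \<Rightarrow> aexp \<Rightarrow> aexp" where
  "td_e b e = (if b \<in> S then sub (N 3) e else e)"

definition cyc_bank :: "nat \<Rightarrow> nat \<Rightarrow> nat \<Rightarrow> com" where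
  "cyc_bank k b c = (if E b c then Skip else
     Seq (Assign (reg k c) (Bin Quot (Bin Rem (V (reg k c)) (Bin Quot (V (reg (k + 1) c)) (N 3))) (N 3)))
     (Seq (Assign (reg (k + 1) c) (Bin Quot (V (reg (k + 1) c)) (N 9)))
     (if c = b then Assign (reg (k + 2) c) (sub (V (reg (k + 2) c)) (N 2)) else Skip)))"

text \<open>The test against 3 excludes stacks of height 1: over a vertex in \<open>S\<close> a
  single letter is both front and back and would otherwise pass the last test together with
  itself.\<close>

definition cyc_cancel :: "nat \<Rightarrow> nat \<Rightarrow> com" where
  "cyc_cancel k b = If (front_e k (k + 1) b) (If (back_e k b) (If (sub (V (reg (k + 1) b)) (N 3))
     (If (sub (Bin Plus (td_e b (front_e k (k + 1) b)) (back_e k b)) (N 3)) Skip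
       (seqs (map (cyc_bank k b) [0..<n]))) Skip) Skip) Skip"

definition cyc_pass :: "nat \<Rightarrow> com" where
  "cyc_pass k = seqs (map (cyc_cancel k) [0..<n])"

lemma cyc_bank_vars:
  assumes "k + 2 < 8"
  shows "wvars (cyc_bank k b c) \<subseteq> bank c" "cvars (cyc_bank k b c) \<subseteq> bank c"
  using assms by (auto simp: cyc_bank_def)

lemma cyc_pass_wvars: "wvars (cyc_pass k) \<subseteq> kregs k"
  by (auto simp: cyc_pass_def cyc_cancel_def cyc_bank_def kregs_def split: if_splits)

lemma proj_commuting: "\<forall>m\<in>set A. E b (fst m) \<Longrightarrow> proj b A = []"
  by (induction A) auto

lemma dg_inv_tw: "dg (snd (tw (inv_letter q))) = 3 - td (fst q) (dg (snd q))"
  unfolding tw_simps(3)[symmetric] by (simp add: inv_letter_def dg_tw del: tw_simps)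

lemma td_cases: "d < 3 \<Longrightarrow> d \<noteq> 0 \<Longrightarrow> td b d \<in> {1, 2}"
  by (auto simp: td_def)

lemma end_pair_iff:
  "end_pair b w \<longleftrightarrow> proj b w \<noteq> [] \<and> hd (proj b w) \<noteq> 0 \<and> last (proj b w) \<noteq> 0 \<and>
     length (proj b w) \<noteq> 1 \<and> td b (hd (proj b w)) + last (proj b w) = 3"
proof
  assume "end_pair b w"
  then obtain A q M B where w: "fst q = b" "w = A @ q # M @ inv_letter (tw q) # B"
    "\<forall>m\<in>set A \<union> set B. E b (fst m)" unfolding end_pair_def by auto
  then have "proj b w = dg (snd q) # proj b M @ [3 - td b (dg (snd q))]"
    using proj_commuting[of A b] proj_commuting[of B b] dg_inv_tw[of q] by simp
  moreover have "td b (dg (snd q)) \<in> {1, 2}" by (rule td_cases) simp_all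
  ultimately show "proj b w \<noteq> [] \<and> hd (proj b w) \<noteq> 0 \<and> last (proj b w) \<noteq> 0 \<and>
     length (proj b w) \<noteq> 1 \<and> td b (hd (proj b w)) + last (proj b w) = 3" by auto
next
  assume *: "proj b w \<noteq> [] \<and> hd (proj b w) \<noteq> 0 \<and> last (proj b w) \<noteq> 0 \<and>
     length (proj b w) \<noteq> 1 \<and> td b (hd (proj b w)) + last (proj b w) = 3"
  then obtain d r where dr: "proj b w = d # r" "d \<noteq> 0" by (cases "proj b w") auto
  from proj_first[OF this] obtain A q R where w: "w = A @ q # R" "fst q = b" "dg (snd q) = d"
    "\<forall>m\<in>set A. E b (fst m)" by blast
  then have r: "r = proj b R" using dr(1) proj_commuting[of A b] by simp
  have "r \<noteq> []" "last r \<noteq> 0" using * dr by auto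
  then obtain r' where "proj b R = r' @ [last r]" "last r \<noteq> 0" using r by (metis append_butlast_last_id)
  from proj_last[OF this] obtain M p B where R: "R = M @ p # B" "fst p = b" "dg (snd p) = last r"
    "\<forall>m\<in>set B. E b (fst m)" by blast
  have "dg (snd p) = dg (snd (inv_letter (tw q)))"
    using * dr R(3) w(2,3) \<open>r \<noteq> []\<close> by (simp add: dg_inv_tw) linarith
  then have "p = inv_letter (tw q)" using R(2) w(2) by (simp add: prod_eq_iff)
  then show "end_pair b w" unfolding end_pair_def using w R
    by (intro exI[of _ A] exI[of _ q] exI[of _ M] exI[of _ B]) auto
qed

definition shrunk :: "nat \<Rightarrow> letter list \<Rightarrow> (nat \<Rightarrow> int) \<Rightarrow> bool" where
  "shrunk k w s \<longleftrightarrow> (\<exists>w'. red w' \<and> set w' \<subseteq> letters n \<and> length w' + 2 \<le> length w \<and> tconj n w w' \<and>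
     repr k w' s)"

lemma sem_cyc_cancel:
  assumes k: "k + 2 < 8" and b: "b < n" and w: "red w" "set w \<subseteq> letters n" and s: "repr k w s"
  shows "sem (cyc_cancel k b) s = s \<and> \<not> end_pair b w \<or>
    end_pair b w \<and> shrunk k w (sem (cyc_cancel k b) s)"
proof -
  let ?p = "proj b w"
  have front: "aval (front_e k (k + 1) b) s = (if ?p = [] then 0 else int (hd ?p))"
    using s b by (simp add: front_e_def repr_def enc_front)
  have last: "aval (back_e k b) s = (if ?p = [] then 0 else int (last ?p))"
    using s b by (simp add: back_e_def repr_def enc_last)
  have pow: "s (reg (k + 1) b) = 3 ^ length ?p" using s b by (simp add: repr_def)
  have pow3: "(3::int) ^ length ?p = 3 \<longleftrightarrow> length ?p = 1"
    using power_inject_exp[of "3::int" "length ?p" 1] by simp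
  have td: "aval (td_e b (front_e k (k + 1) b)) s = int (td b (hd ?p))" if "?p \<noteq> []"
  proof -
    have "hd ?p < 3" using ternary_proj[of b w] that by (auto simp: ternary_def)
    then show ?thesis using that front by (auto simp: td_e_def td_def)
  qed
  show ?thesis
  proof (cases "end_pair b w")
    case False
    then have "sem (cyc_cancel k b) s = s"
      unfolding end_pair_iff using front last pow pow3 td by (auto simp: cyc_cancel_def)
    then show ?thesis using False by blast
  next
    case True
    have cond: "?p \<noteq> []" "hd ?p \<noteq> 0" "last ?p \<noteq> 0" "length ?p \<noteq> 1" "td b (hd ?p) + last ?p = 3"
      using True[unfolded end_pair_iff] by auto
    have td3: "int (td b (hd ?p)) + int (last ?p) = 3" using cond(5) by linarith
    have sem: "sem (cyc_cancel k b) s = sem (seqs (map (cyc_bank k b) [0..<n])) s"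
      using front last pow pow3 td cond(1-4) td3 by (simp add: cyc_cancel_def)
    obtain A q M B where q: "fst q = b" "w = A @ q # M @ inv_letter (tw q) # B"
      "\<forall>m\<in>set A \<union> set B. E b (fst m)" using True unfolding end_pair_def by auto
    let ?w = "A @ M @ B" and ?q' = "inv_letter (tw q)"
    have "w \<equiv>\<^sub>t q # A @ M @ ?q' # B"
      using equivclp_sym[OF swap_past'[where v = fst and a = q and M = A and A = "[]" and B = "M @ ?q' # B"]]
        q by simp
    moreover have "q # A @ M @ ?q' # B \<equiv>\<^sub>t q # ?w @ [?q']"
      using swap_past'[where v = fst and a = ?q' and M = B and A = "q # A @ M" and B = "[]"] q by simp
    ultimately have eq: "w \<equiv>\<^sub>t q # ?w @ [?q']" by (rule equivclp_trans)
    have proj: "proj c w = (if E b c then proj c ?w else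
        (if c = b then dg (snd q) else 0) # proj c ?w @ [if c = b then dg (snd ?q') else 0])" for c
      using proj_teq[OF eq, of c] q(1) by (auto simp: E_commute)
    have cnt: "count_list (map fst w) c = count_list (map fst ?w) c + (if c = b then 2 else 0)" for c
      using q(1,2) by simp
    have bank: "sem (cyc_cancel k b) s (reg i c) = sem (cyc_bank k b c) s (reg i c)" if "c < n" "i < 8" for i c
      unfolding sem by (rule sem_banks_upt) (use cyc_bank_vars[OF k] that in blast)+
    have "repr k ?w (sem (cyc_cancel k b) s)"
      unfolding repr_def
    proof (intro allI impI)
      fix c assume c: "c < n"
      let ?d = "if c = b then dg (snd q) else 0" and ?e = "if c = b then dg (snd ?q') else 0" and ?ds = "proj c ?w"
      have s_c: "s (reg k c) = enc (proj c w)" "s (reg (k + 1) c) = 3 ^ length (proj c w)"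
        "s (reg (k + 2) c) = int (count_list (map fst w) c)"
        using s c by (simp_all add: repr_def)
      note banks = bank[OF c, of k] bank[OF c, of "k + 1"] bank[OF c, of "k + 2"]
      show "sem (cyc_cancel k b) s (reg k c) = enc ?ds \<and>
        sem (cyc_cancel k b) s (reg (k + 1) c) = 3 ^ length ?ds \<and>
        sem (cyc_cancel k b) s (reg (k + 2) c) = int (count_list (map fst ?w) c)"
      proof (cases "E b c")
        case True
        then have "c \<noteq> b" by auto
        then show ?thesis using banks k s_c True proj[of c] cnt[of c]
          by (simp add: cyc_bank_def del: proj_simps)
      next
        case False
        have p: "proj c w = ?d # ?ds @ [?e]" unfolding proj using False by simp
        have "enc (tl (proj c w)) div 3 = enc ?ds"
          unfolding p list.sel by (rule enc_snoc_div) (simp add: dg_def)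
        then have "s (reg k c) mod (s (reg (k + 1) c) div 3) div 3 = enc ?ds"
          using s_c enc_tl[OF ternary_proj[of c w]] by simp
        moreover have "length (proj c w) = Suc (Suc (length ?ds))" unfolding p by simp
        then have "s (reg (k + 1) c) div 9 = 3 ^ length ?ds" using s_c(2) by simp
        ultimately show ?thesis using banks k s_c(3) False cnt[of c]
          by (cases "c = b") (simp_all add: cyc_bank_def del: proj_simps)
      qed
    qed
    moreover have "red ?w"
    proof -
      have "red (A @ M @ ?q' # B)" by (rule red_remove[of A q]) (use w q in auto)
      then show ?thesis using red_remove[of "A @ M" ?q' B] q by auto
    qed
    moreover have "tconj n w ?w"
    proof -
      have "w \<approx> ?w @ [?q', tw q]"
        using equivclp_trans[OF teq_ceq[OF eq] ceq_rotate[of q "?w @ [?q']"]] by simp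
      from ceq_tconj[OF this w(2)] have "tconj n w (?w @ [?q', tw q])" .
      moreover have "raag_eq n E (?w @ inv_word [tw q] @ [tw q] @ []) (?w @ [])"
        by (rule raag_eq_inverse_left) (use q b in \<open>auto simp: letters_def\<close>)
      then have "tconj n (?w @ [?q', tw q]) ?w"
        by (intro tconj_raag_eq raag_eq_sym[of n E "?w @ [?q', tw q]"]) simp
      ultimately show ?thesis by (rule tconj_trans)
    qed
    ultimately show ?thesis using w(2) q(2) True unfolding shrunk_def by (intro disjI2 conjI exI[of _ ?w]) auto
  qed
qed

text \<open>If no vertex fires, all tests were made on the same word, which certifies
  \<open>end_red\<close>. Otherwise the pass may leave new pairs behind, but at least two letters
  are gone.\<close>

lemma sem_cyc_pass:
  assumes k: "k + 2 < 8" and w: "red w" "set w \<subseteq> letters n" and s: "repr k w s"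
  shows "sem (cyc_pass k) s = s \<and> end_red w \<or>
    \<not> end_red w \<and> shrunk k w (sem (cyc_pass k) s)"
proof -
  have "sem (seqs (map (cyc_cancel k) bs)) s = s \<and> (\<forall>b\<in>set bs. \<not> end_pair b w) \<or>
    \<not> end_red w \<and> shrunk k w (sem (seqs (map (cyc_cancel k) bs)) s)" if "set bs \<subseteq> {..<n}" for bs
    using that w s
  proof (induction bs arbitrary: w s)
    case (Cons b bs)
    have IH: "sem (seqs (map (cyc_cancel k) bs)) s = s \<and> (\<forall>b\<in>set bs. \<not> end_pair b w) \<or>
    \<not> end_red w \<and> shrunk k w (sem (seqs (map (cyc_cancel k) bs)) s)"
      if "red w" "set w \<subseteq> letters n" "repr k w s" for w s
      using Cons.IH[OF _ that] Cons.prems(1) by simp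
    have "b < n" using Cons.prems(1) by simp
    from sem_cyc_cancel[OF k this Cons.prems(2-4), unfolded shrunk_def] show ?case
    proof (elim disjE exE conjE)
      assume "sem (cyc_cancel k b) s = s" "\<not> end_pair b w"
      then show ?thesis using IH[OF Cons.prems(2-4)] by simp
    next
      fix w1 assume "end_pair b w" and w1: "red w1" "set w1 \<subseteq> letters n" "length w1 + 2 \<le> length w" "tconj n w w1"
        "repr k w1 (sem (cyc_cancel k b) s)"
      then have "\<not> end_red w" unfolding end_red_def by blast
      from IH[OF w1(1,2,5), unfolded shrunk_def] show ?thesis
      proof (elim disjE exE conjE)
        assume "sem (seqs (map (cyc_cancel k) bs)) (sem (cyc_cancel k b) s) = sem (cyc_cancel k b) s"
        then show ?thesis using w1 \<open>\<not> end_red w\<close> unfolding shrunk_def by (intro disjI2 conjI exI[of _ w1]) simp_all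
      next
        fix w2 assume w2: "red w2" "set w2 \<subseteq> letters n" "length w2 + 2 \<le> length w1" "tconj n w1 w2"
          "repr k w2 (sem (seqs (map (cyc_cancel k) bs)) (sem (cyc_cancel k b) s))"
        then show ?thesis using w1 tconj_trans[OF w1(4) w2(4)] \<open>\<not> end_red w\<close>
          unfolding shrunk_def by (intro disjI2 conjI exI[of _ w2]) simp_all
      qed
    qed
  qed simp
  from this[of "[0..<n]"]
  have "sem (cyc_pass k) s = s \<and> (\<forall>b<n. \<not> end_pair b w) \<or>
    \<not> end_red w \<and> shrunk k w (sem (cyc_pass k) s)" unfolding cyc_pass_def by fastforce
  moreover have "end_red w" if "\<forall>b<n. \<not> end_pair b w"
  proof -
    have "b < n" if "end_pair b w" for b
      using that w(2) unfolding end_pair_def by (auto simp: letters_def)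
    then show ?thesis using that unfolding end_red_def by blast
  qed
  ultimately show ?thesis by blast
qed

text \<open>An effective pass shortens the word and an idle one means it is done; the empty word is
  done as well. Hence \<open>length w\<close> passes suffice.\<close>

lemma cyc_loop:
  assumes k: "k + 2 < 8" and w: "red w" "set w \<subseteq> letters n" and s: "repr k w s"
    and X: "length w \<le> X"
  shows "\<exists>w'. red w' \<and> end_red w' \<and> set w' \<subseteq> letters n \<and> length w' \<le> length w \<and> tconj n w w' \<and>
    repr k w' ((sem (cyc_pass k) ^^ X) s)"
proof -
  define I where "I m s \<longleftrightarrow> (\<exists>w'. red w' \<and> set w' \<subseteq> letters n \<and> (end_red w' \<or> length w' \<le> m) \<and>
    length w' \<le> length w \<and> tconj n w w' \<and> repr k w' s)" for m s
  have "I 0 ((sem (cyc_pass k) ^^ X) s)"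
  proof (rule funpow_reach_0[where I = I and f = "sem (cyc_pass k)", OF _ _ _ X])
    have step: "I (m - 1) (sem (cyc_pass k) s)" if I: "I m s" for m s
    proof -
      obtain w' where w': "red w'" "set w' \<subseteq> letters n" "end_red w' \<or> length w' \<le> m"
        "length w' \<le> length w" "tconj n w w'" "repr k w' s" using I unfolding I_def by blast
      from sem_cyc_pass[OF k w'(1,2,6), unfolded shrunk_def] show ?thesis
      proof (elim disjE exE conjE)
        assume "sem (cyc_pass k) s = s" "end_red w'"
        then show ?thesis unfolding I_def using w' by auto
      next
        fix w2 assume w2: "red w2" "set w2 \<subseteq> letters n" "length w2 + 2 \<le> length w'" "tconj n w' w2"
          "repr k w2 (sem (cyc_pass k) s)"
        assume "\<not> end_red w'"
        then show ?thesis unfolding I_def using w' w2 tconj_trans[OF w'(5) w2(4)]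
          by (intro exI[of _ w2]) auto
      qed
    qed
    show "I 0 (sem (cyc_pass k) s)" if "I 0 s" for s using step[OF that] by simp
    show "\<exists>m'\<le>m. I m' (sem (cyc_pass k) s)" if "I (Suc m) s" for m s
      using step[OF that] by auto
    show "I (length w) s" unfolding I_def using w s
      by (intro exI[of _ w]) (auto intro: tconj_raag_eq)
  qed
  then obtain w' where "red w'" "set w' \<subseteq> letters n" "end_red w' \<or> w' = []"
    "length w' \<le> length w" "tconj n w w'" "repr k w' ((sem (cyc_pass k) ^^ X) s)"
    unfolding I_def by auto
  moreover have "end_red []" by (simp add: end_red_def end_pair_def)
  ultimately show ?thesis by blast
qed

end

section \<open>Deciding one component\<close>

lemma reg_image [simp]: "k < 8 \<Longrightarrow> i < 8 \<Longrightarrow> reg k b \<in> reg i ` A \<longleftrightarrow> k = i \<and> b \<in> A"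
  by (auto simp: image_iff)

lemma small_reg_image [simp]: "x < 16 \<Longrightarrow> x \<notin> reg i ` A"
  by (auto simp: image_iff)

context raag
begin

text \<open>Heights depend on the letter counts only, so words of one class have stacks of equal
  heights and their integers can be compared directly.\<close>

lemma length_proj: "length (proj b x) = size (filter_mset (\<lambda>c. \<not> E b c) (mset (map fst x)))"
  by (induction x) auto

text \<open>Over a component the stacks of the whole word are already those of the restricted word,
  so restriction needs no computation.\<close>

lemma proj_restr:
  assumes "\<And>l. l \<in> set x \<Longrightarrow> fst l \<notin> D \<Longrightarrow> E b (fst l)"
  shows "proj b (restr D x) = proj b x"
  unfolding proj_def filter_filter by (rule arg_cong[OF filter_cong]) (use assms in auto)

end

context raag_alg
begin

text \<open>A rotation keeps all heights, so no power of 3 is updated and a scratch copy can use the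
  power registers of the original stack.\<close>

definition rot_bank :: "nat \<Rightarrow> nat \<Rightarrow> nat \<Rightarrow> nat \<Rightarrow> com" where
  "rot_bank v p b c = (if E b c then Skip else
     Assign (reg v c) (Bin Plus (Bin Times (N 3) (Bin Rem (V (reg v c)) (Bin Quot (V (reg p c)) (N 3))))
       (if c = b then V 7 else N 0)))"

definition rot_com :: "nat \<Rightarrow> nat \<Rightarrow> nat list \<Rightarrow> nat \<Rightarrow> com" where
  "rot_com v p D b = Seq (Assign 7 (td_e b (front_e v p b))) (seqs (map (rot_bank v p b) D))"

definition walk :: "nat \<Rightarrow> nat \<Rightarrow> nat list \<Rightarrow> nat list \<Rightarrow> com \<Rightarrow> com" where
  "walk v p D bs c = foldr (\<lambda>b c. If (front_e v p b) (rot_com v p D b) c) bs c"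

definition nonroot_com :: "nat \<Rightarrow> nat \<Rightarrow> nat list \<Rightarrow> nat \<Rightarrow> com" where
  "nonroot_com v p D a = walk v p D (removeAll a D) Skip"

definition orbit_com :: "nat \<Rightarrow> nat \<Rightarrow> nat list \<Rightarrow> nat \<Rightarrow> com" where
  "orbit_com v p D a = walk v p D (removeAll a D @ [a]) Skip"

definition compare :: "nat list \<Rightarrow> com" where
  "compare D = foldr (\<lambda>b c. If (sub (V (reg 6 b)) (V (reg 7 b))) Skip c) D (Assign 8 (N 1))"

definition copy_bank :: "nat \<Rightarrow> com" where
  "copy_bank b = Seq (Assign (reg 6 b) (V (reg 0 b))) (Assign (reg 7 b) (V (reg 3 b)))"

text \<open>The second word is moved to a pyramid without using the root; the first then walks along
  its orbit in search of that pyramid. Both work on scratch copies, as later phases need the stacks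
  again.\<close>

definition phase_body :: "nat list \<Rightarrow> nat \<Rightarrow> com" where
  "phase_body D a = seqs
    [seqs (map copy_bank D), Loop (V 3) (nonroot_com 7 4 D a), Assign 8 (N 0),
     Loop (V 3) (Seq (compare D) (orbit_com 6 1 D a)), If (V 8) Skip (Assign 0 (N 0))]"

text \<open>A run-time test on the letter counts of the first word: every vertex of \<open>D\<close>
  occurs, and no vertex occurs outside \<open>D\<close> that fails to commute with
  \<open>D\<close>.\<close>

definition guard :: "nat list \<Rightarrow> com \<Rightarrow> com" where
  "guard D c = foldr (\<lambda>b c. If (V (reg 2 b)) c Skip) D
     (foldr (\<lambda>b c. If (V (reg 2 b)) Skip c) (filter (\<lambda>c. c \<notin> set D \<and> (\<exists>b\<in>set D. \<not> E b c)) [0..<n]) c)"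

text \<open>Connectedness is absent here because it depends on the graph only;
  \<open>root_components\<close> settles it at compile time.\<close>

definition is_component :: "nat list \<Rightarrow> letter list \<Rightarrow> bool" where
  "is_component D w \<longleftrightarrow> set D \<subseteq> fst ` set w \<and> (\<forall>c\<in>fst ` set w - set D. \<forall>b\<in>set D. E b c)"

lemma rot_com_wvars: "wvars (rot_com v p D b) \<subseteq> insert 7 (reg v ` set D)"
  by (auto simp: rot_com_def rot_bank_def)

lemma walk_wvars: "wvars (walk v p D bs Skip) \<subseteq> insert 7 (reg v ` set D)"
  using rot_com_wvars by (induction bs) (auto simp: walk_def)

lemma sem_guard:
  assumes "repr 0 w s" "set D \<subseteq> {..<n}" "set w \<subseteq> letters n"
  shows "sem (guard D c) s = (if is_component D w then sem c s else s)"
proof -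
  have reg: "s (reg 2 b) = 0 \<longleftrightarrow> b \<notin> fst ` set w" if "b < n" for b
    using assms(1) that by (simp add: repr_def numeral_2_eq_2 count_list_0_iff)
  have 1: "sem (foldr (\<lambda>b c. If (V (reg 2 b)) c Skip) bs c) s = (if set bs \<subseteq> fst ` set w then sem c s else s)"
    if "set bs \<subseteq> {..<n}" for bs c
    using that reg by (induction bs) auto
  have 2: "sem (foldr (\<lambda>b c. If (V (reg 2 b)) Skip c) bs c) s = (if set bs \<inter> fst ` set w = {} then sem c s else s)"
    if "set bs \<subseteq> {..<n}" for bs
    using that reg by (induction bs) auto
  have n: "fst ` set w \<subseteq> {..<n}" using assms(3) by (auto simp: letters_def)
  have "is_component D w \<longleftrightarrow> set D \<subseteq> fst ` set w \<and>
    set (filter (\<lambda>c. c \<notin> set D \<and> (\<exists>b\<in>set D. \<not> E b c)) [0..<n]) \<inter> fst ` set w = {}"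
    unfolding is_component_def using n by auto
  then show ?thesis unfolding guard_def
    by (subst 1[OF assms(2)], subst 2) auto
qed

end

locale raag_phase = raag_component + raag_alg +
  assumes D: "set D \<subseteq> {..<n}" "distinct D"
begin

definition stacks :: "nat \<Rightarrow> nat \<Rightarrow> (nat \<Rightarrow> nat list) \<Rightarrow> (nat \<Rightarrow> int) \<Rightarrow> bool" where
  "stacks v p \<sigma> s \<longleftrightarrow> (\<forall>b\<in>set D. s (reg v b) = enc (\<sigma> b) \<and> s (reg p b) = 3 ^ length (\<sigma> b))"

lemma ternary_pil [simp]: "ternary (pil x b)"
  by (simp add: pil_def)

lemma front_pil:
  assumes "stacks v p (pil x) s" "b \<in> set D"
  shows "aval (front_e v p b) s = (if pil x b = [] then 0 else int (hd (pil x b)))"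
  using assms by (simp add: front_e_def stacks_def enc_front)

lemma front_acc:
  "stacks v p (pil x) s \<Longrightarrow> b \<in> set D \<Longrightarrow> aval (front_e v p b) s \<noteq> 0 \<longleftrightarrow> acc b (pil x)"
  by (simp add: front_pil acc_def)

lemma sem_rot_com:
  assumes vp: "v < 8" "p < 8" "v \<noteq> p" and s: "stacks v p (pil x) s" and b: "b \<in> set D" "acc b (pil x)"
  shows "stacks v p (rot b (pil x)) (sem (rot_com v p D b) s)"
  unfolding stacks_def
proof (intro ballI)
  fix c assume c: "c \<in> set D"
  let ?d = "td b (hd (pil x b))"
  have "hd (pil x b) < 3" using ternary_pil[of x b] b(2) by (auto simp: ternary_def acc_def)
  then have d: "aval (td_e b (front_e v p b)) s = int ?d"
    using front_pil[OF s b(1)] b(2) by (auto simp: td_e_def td_def acc_def)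
  let ?s = "s(7 := int ?d)"
  have banks: "sem (rot_com v p D b) s (reg i c) = sem (rot_bank v p b c) ?s (reg i c)" if "i < 8" for i
    using sem_banks[OF D(2), of "rot_bank v p b" ?s] vp c that d
    by (auto simp: rot_com_def rot_bank_def)
  show "sem (rot_com v p D b) s (reg v c) = enc (rot b (pil x) c) \<and>
    sem (rot_com v p D b) s (reg p c) = 3 ^ length (rot b (pil x) c)"
  proof (cases "E b c")
    case True
    then show ?thesis using banks[of v] banks[of p] vp s c by (simp add: rot_bank_def rot_def stacks_def)
  next
    case False
    \<comment> \<open>Accessibility of \<open>b\<close> makes every stack that the rotation touches
      non-empty, so removing one digit and adding one keeps the height.\<close>
    obtain l m where l: "fst l = b" "x \<equiv>\<^sub>t l # m" using acc_pil[OF b] by metis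
    have "pil x c = proj c (l # m)" using pil_teq[OF l(2)] c by (simp add: pil_def)
    then have ne: "pil x c \<noteq> []" using l(1) False by (simp add: E_commute)
    have sc: "s (reg v c) = enc (pil x c)" "s (reg p c) = 3 ^ length (pil x c)"
      using s c by (simp_all add: stacks_def)
    then have "s (reg v c) mod (s (reg p c) div 3) = enc (tl (pil x c))" by (simp add: enc_tl)
    then show ?thesis using banks[of v] banks[of p] vp False c ne sc
      by (auto simp: rot_bank_def rot_def enc_append)
  qed
qed

lemma sem_walk:
  assumes "stacks v p (pil x) s" "set bs \<subseteq> set D"
  shows "sem (walk v p D bs c) s = (case find (\<lambda>b. acc b (pil x)) bs of
    Some b \<Rightarrow> sem (rot_com v p D b) s | None \<Rightarrow> sem c s)"
  using assms(2) front_acc[OF assms(1)] by (induction bs) (auto simp: walk_def)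

lemma sem_walk_nonroot:
  assumes "stacks v p (pil x) s"
  shows "sem (walk v p D (removeAll a D) c) s = (case next_acc (pil x) of
    Some b \<Rightarrow> sem (rot_com v p D b) s | None \<Rightarrow> sem c s)"
  unfolding next_acc_def by (rule sem_walk[OF assms]) auto

lemma sem_nonroot_com:
  assumes vp: "v < 8" "p < 8" "v \<noteq> p" and s: "stacks v p (pil x) s"
  shows "stacks v p (nonroot_step (pil x)) (sem (nonroot_com v p D a) s)"
proof (cases "next_acc (pil x)")
  case None
  then show ?thesis using s by (simp add: nonroot_com_def sem_walk_nonroot[OF s] nonroot_step_def)
next
  case (Some b)
  then show ?thesis using sem_rot_com[OF vp s, of b] next_acc_Some[OF Some]
    by (simp add: nonroot_com_def sem_walk_nonroot[OF s] nonroot_step_def)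
qed

lemma sem_orbit_com:
  assumes vp: "v < 8" "p < 8" "v \<noteq> p" and s: "stacks v p (pil x) s"
  shows "stacks v p (orbit_step (pil x)) (sem (orbit_com v p D a) s)"
proof -
  have "orbit_com v p D a = walk v p D (removeAll a D) (walk v p D [a] Skip)"
    by (simp add: orbit_com_def walk_def)
  then have orbit: "sem (orbit_com v p D a) s = (case next_acc (pil x) of
      Some b \<Rightarrow> sem (rot_com v p D b) s | None \<Rightarrow> if acc a (pil x) then sem (rot_com v p D a) s else s)"
    using sem_walk[OF s, of "[a]" Skip] a by (simp add: sem_walk_nonroot[OF s] split: option.split)
  show ?thesis
  proof (cases "next_acc (pil x)")
    case None
    then show ?thesis using s sem_rot_com[OF vp s a] by (simp add: orbit orbit_step_def)
  next
    case (Some b)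
    then show ?thesis using sem_rot_com[OF vp s, of b] next_acc_Some[OF Some]
      by (simp add: orbit orbit_step_def)
  qed
qed

lemma nonroot_com_loop:
  assumes vp: "v < 8" "p < 8" "v \<noteq> p" and s: "stacks v p (pil x) s" and x: "over x"
  shows "stacks v p ((nonroot_step ^^ t) (pil x)) ((sem (nonroot_com v p D a) ^^ t) s)"
proof (induction t)
  case (Suc t)
  then show ?case using nonroot_words[OF x, of t] sem_nonroot_com[OF vp] by force
qed (use s in simp)

text \<open>Equal letter counts give equal heights, without which leading spacers would make
  \<open>enc\<close> ambiguous.\<close>

lemma sem_compare:
  assumes "stacks 6 1 (pil x) s" "stacks 7 4 (pil y) s" "mset (map fst x) = mset (map fst y)"
  shows "sem (compare D) s = (if pil x = pil y then s(8 := 1) else s)"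
proof -
  have "sem (foldr (\<lambda>b c. If (sub (V (reg 6 b)) (V (reg 7 b))) Skip c) bs (Assign 8 (N 1))) s =
    (if \<forall>b\<in>set bs. pil x b = pil y b then s(8 := 1) else s)" if "set bs \<subseteq> set D" for bs
    using that
  proof (induction bs)
    case (Cons b bs)
    then have b: "b \<in> set D" by simp
    have "length (pil x b) = length (pil y b)"
      using assms(3) by (simp add: pil_def length_proj)
    then have "s (reg 6 b) = s (reg 7 b) \<longleftrightarrow> pil x b = pil y b"
      using assms(1,2) b enc_inject by (simp add: stacks_def)
    then show ?case using Cons by auto
  qed simp
  from this[of D] have "sem (compare D) s = (if \<forall>b\<in>set D. pil x b = pil y b then s(8 := 1) else s)"
    by (simp add: compare_def)
  moreover have "(\<forall>b\<in>set D. pil x b = pil y b) \<longleftrightarrow> pil x = pil y"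
    by (auto simp: fun_eq_iff) (auto simp: pil_def)
  ultimately show ?thesis by simp
qed

text \<open>The comparison precedes the step, so \<open>t\<close> rounds test exactly the iterates
  \<open>i < t\<close>, the start included.\<close>

lemma orbit_loop:
  assumes x: "over x" and s: "stacks 6 1 (pil x) s" "stacks 7 4 (pil y) s" "s 8 = 0"
    and xy: "mset (map fst x) = mset (map fst y)"
    and g: "g = sem (Seq (compare D) (orbit_com 6 1 D a))"
  shows "stacks 6 1 ((orbit_step ^^ t) (pil x)) ((g ^^ t) s) \<and> stacks 7 4 (pil y) ((g ^^ t) s) \<and>
    (g ^^ t) s 8 = (if \<exists>i<t. (orbit_step ^^ i) (pil x) = pil y then 1 else 0)"
proof (induction t)
  case (Suc t)
  let ?s = "(g ^^ t) s"
  obtain x' where x': "(orbit_step ^^ t) (pil x) = pil x'" "x \<approx> x'" using orbit_words[OF x] by blast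
  have IH: "stacks 6 1 (pil x') ?s" "stacks 7 4 (pil y) ?s"
    "?s 8 = (if \<exists>i<t. (orbit_step ^^ i) (pil x) = pil y then 1 else 0)"
    using Suc.IH x' by simp_all
  let ?c = "sem (compare D) ?s"
  have c: "?c = (if pil x' = pil y then ?s(8 := 1) else ?s)"
    by (rule sem_compare[OF IH(1,2)]) (use xy ceq_mset[OF x'(2)] in simp)
  then have st: "stacks 6 1 (pil x') ?c" "stacks 7 4 (pil y) ?c" using IH by (auto simp: stacks_def)
  let ?o = "sem (orbit_com 6 1 D a) ?c"
  have out: "?o y = ?c y" if "y \<noteq> 7" "y \<notin> reg 6 ` set D" for y
    using walk_wvars[of 6 1 D "removeAll a D @ [a]"] that
    by (intro sem_wvars) (auto simp: orbit_com_def)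
  have "stacks 6 1 (orbit_step (pil x')) ?o" by (rule sem_orbit_com[OF _ _ _ st(1)]) simp_all
  moreover have "stacks 7 4 (pil y) ?o" using st(2) out by (auto simp: stacks_def)
  moreover have "?o 8 = (if \<exists>i<Suc t. (orbit_step ^^ i) (pil x) = pil y then 1 else 0)"
    using out[of 8] c IH(3) x'(1) by (auto simp: less_Suc_eq)
  moreover have "(g ^^ Suc t) s = ?o" by (simp add: g)
  ultimately show ?case using x'(1) by simp
qed (use s in simp)

theorem sem_phase_body:
  assumes u: "repr 0 u s" and v: "repr 3 v s"
    and uv: "mset (map fst u) = mset (map fst v)" and comp: "is_component D u"
    and T: "s 3 = int T" "(\<kappa> + 2) * length u < T" "\<kappa> * length v \<le> T"
  shows "sem (phase_body D a) s 0 = (if restr (set D) u \<approx> restr (set D) v then s 0 else 0)"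
proof -
  let ?x = "restr (set D) u" and ?y = "restr (set D) v"
  have fst: "fst ` set u = fst ` set v" using arg_cong[OF uv, of set_mset] by simp
  have full: "full ?x" "full ?y" using comp fst by (auto simp: full_def is_component_def)
  have over: "over ?x" "over ?y" using full by (simp_all add: full_def)
  have "proj b ?x = proj b u" "proj b ?y = proj b v" if "b \<in> set D" for b
    using that comp fst by (auto intro!: proj_restr simp: is_component_def)
  then have pil: "pil ?x b = proj b u" "pil ?y b = proj b v" if "b \<in> set D" for b
    using that by (simp_all add: pil_def)
  have "mset (map fst ?x) = filter_mset (\<lambda>c. c \<in> set D) (mset (map fst u))"
    "mset (map fst ?y) = filter_mset (\<lambda>c. c \<in> set D) (mset (map fst v))"
    by (induction u; simp) (induction v; simp)
  with uv have xy: "mset (map fst ?x) = mset (map fst ?y)" by simp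
  define s1 where "s1 = sem (seqs (map copy_bank D)) s"
  have s1: "s1 (reg i b) = sem (copy_bank b) s (reg i b)" if "b \<in> set D" "i < 8" for b i
    using sem_banks[OF D(2), of copy_bank s] that by (auto simp: s1_def copy_bank_def)
  have s1_small: "s1 z = s z" if "z < 16" for z
    using sem_banks[OF D(2), of copy_bank s] that by (auto simp: s1_def copy_bank_def)
  have st1: "stacks 6 1 (pil ?x) s1" "stacks 7 4 (pil ?y) s1"
    using s1 u v pil D(1) by (auto simp: stacks_def copy_bank_def repr_def)
  define s2 where "s2 = (sem (nonroot_com 7 4 D a) ^^ T) s1"
  have s2_other: "s2 z = s1 z" if "z \<noteq> 7" "z \<notin> reg 7 ` set D" for z
    unfolding s2_def
  proof (rule funpow_invariant[where g = "\<lambda>s. s z"])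
    show "sem (nonroot_com 7 4 D a) s z = s z" for s
      using walk_wvars[of 7 4 D "removeAll a D"] that
      by (intro sem_wvars) (auto simp: nonroot_com_def)
  qed
  obtain y' where y': "(nonroot_step ^^ T) (pil ?y) = pil y'" "?y \<approx> y'"
    using nonroot_words[OF over(2)] by blast
  have "stacks 7 4 (pil y') s2"
    unfolding s2_def y'(1)[symmetric] by (rule nonroot_com_loop[OF _ _ _ st1(2) over(2)]) simp_all
  then have st2: "stacks 6 1 (pil ?x) (s2(8 := 0))" "stacks 7 4 (pil y') (s2(8 := 0))"
    using st1(1) s2_other by (auto simp: stacks_def)
  define s3 where "s3 = (sem (Seq (compare D) (orbit_com 6 1 D a)) ^^ T) (s2(8 := 0))"
  have s3_8: "s3 8 = (if \<exists>i<T. (orbit_step ^^ i) (pil ?x) = pil y' then 1 else 0)"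
    unfolding s3_def using orbit_loop[OF over(1) st2 _ _ refl, of T] xy ceq_mset[OF y'(2)] by auto
  have s3_0: "s3 0 = s 0"
  proof -
    have "s3 0 = (s2(8 := 0)) 0"
      unfolding s3_def
    proof (rule funpow_invariant[where g = "\<lambda>s. s 0"])
      have "0 \<notin> wvars (compare D)" by (induction D) (auto simp: compare_def)
      moreover have "0 \<notin> wvars (orbit_com 6 1 D a)"
        using walk_wvars[of 6 1 D "removeAll a D @ [a]"] by (auto simp: orbit_com_def)
      ultimately show "sem (Seq (compare D) (orbit_com 6 1 D a)) s 0 = s 0" for s
        by (simp add: sem_wvars)
    qed
    then show ?thesis using s2_other[of 0] s1_small by auto
  qed
  have "s1 3 = int T" "(s2(8 := 0)) 3 = int T"
    using s1_small[of 3] s2_other[of 3] T(1) by auto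
  then have "sem (phase_body D a) s 0 = (if s3 8 \<noteq> 0 then s3 0 else 0)"
    by (simp add: phase_body_def s1_def[symmetric] s2_def[symmetric] s3_def)
  also have "\<dots> = (if \<exists>i<T. (orbit_step ^^ i) (pil ?x) = (nonroot_step ^^ T) (pil ?y) then s 0 else 0)"
    using s3_8 s3_0 y'(1) by auto
  also have "(\<exists>i<T. (orbit_step ^^ i) (pil ?x) = (nonroot_step ^^ T) (pil ?y)) \<longleftrightarrow> ?x \<approx> ?y"
  proof (rule ceq_iff_orbit[OF full, symmetric])
    have "(\<kappa> + 2) * length ?x \<le> (\<kappa> + 2) * length u" by (rule mult_le_mono2) simp
    then show "(\<kappa> + 2) * length ?x < T" using T(2) by linarith
    have "\<kappa> * length ?y \<le> \<kappa> * length v" by (rule mult_le_mono2) simp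
    then show "\<kappa> * length ?y \<le> T" using T(3) by linarith
  qed
  finally show ?thesis .
qed

end

section \<open>The decision procedure\<close>

lemma finite_common_bound:
  assumes "finite A" "\<And>x. x \<in> A \<Longrightarrow> \<exists>j::nat. P x j"
  shows "\<exists>k. \<forall>x\<in>A. \<exists>j\<le>k. P x j"
  using assms
proof (induction A)
  case (insert x A)
  then obtain k where k: "\<forall>x\<in>A. \<exists>j\<le>k. P x j" by auto
  obtain j where j: "P x j" using insert.prems by blast
  have "\<forall>y\<in>A. \<exists>i\<le>max k j. P y i" using k by (meson max.coboundedI1)
  moreover have "\<exists>i\<le>max k j. P x i" using j max.cobounded2 by blast
  ultimately show ?case by (intro exI[of _ "max k j"]) simp
qed simp

context raag_alg
begin

text \<open>Every connected vertex set with every choice of root. The list depends on the graph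
  only, so its length is a constant for the running time.\<close>

definition root_components :: "(nat \<times> nat list) list" where
  "root_components = filter (\<lambda>(a, D). a \<in> set D \<and> (\<forall>b\<in>set D. (noncomm (set D))\<^sup>*\<^sup>* a b))
     (List.product [0..<n] (subseqs [0..<n]))"

lemma root_componentsD:
  assumes "(a, D) \<in> set root_components"
  shows "a \<in> set D" "set D \<subseteq> {..<n}" "distinct D" "b \<in> set D \<Longrightarrow> (noncomm (set D))\<^sup>*\<^sup>* a b"
proof -
  have D: "D \<in> set (subseqs [0..<n])" using assms by (auto simp: root_components_def)
  from imageI[OF this, of set] have "set D \<in> Pow (set [0..<n])" unfolding subseqs_powset .
  then show "set D \<subseteq> {..<n}" by auto
  show "distinct D" using subseqs_distinctD[OF D] by simp
qed (use assms in \<open>auto simp: root_components_def\<close>)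

lemma root_components_bound:
  "\<exists>\<kappa>. \<forall>(a, D)\<in>set root_components. \<forall>b\<in>set D. \<exists>j\<le>\<kappa>. (noncomm (set D) ^^ j) a b"
proof -
  let ?A = "{(a, D, b). (a, D) \<in> set root_components \<and> b \<in> set D}"
  have "?A \<subseteq> (\<lambda>((a, D), b). (a, D, b)) ` (set root_components \<times> {..<n})"
    using root_componentsD(2) by force
  then have "finite ?A" by (rule finite_subset) simp
  moreover have "\<exists>j. (noncomm (set (fst (snd x))) ^^ j) (fst x) (snd (snd x))" if "x \<in> ?A" for x
    using that root_componentsD(4) by (auto simp: rtranclp_power)
  ultimately obtain \<kappa> where "\<forall>x\<in>?A. \<exists>j\<le>\<kappa>. (noncomm (set (fst (snd x))) ^^ j) (fst x) (snd (snd x))"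
    using finite_common_bound[of ?A "\<lambda>x j. (noncomm (set (fst (snd x))) ^^ j) (fst x) (snd (snd x))"] by blast
  then show ?thesis by (intro exI[of _ \<kappa>]) auto
qed

text \<open>Each component of the support occurs in the list, with each of its vertices as root, and
  satisfies \<open>is_component\<close>. Conversely, restriction respects classes.\<close>

lemma ceq_iff_root_components:
  assumes V: "fst ` set x = fst ` set y" "set x \<subseteq> letters n"
  shows "x \<approx> y \<longleftrightarrow> (\<forall>(a, D)\<in>set root_components. is_component D x \<longrightarrow> restr (set D) x \<approx> restr (set D) y)"
proof
  assume *: "\<forall>(a, D)\<in>set root_components. is_component D x \<longrightarrow> restr (set D) x \<approx> restr (set D) y"
  let ?V = "fst ` set x"
  have n: "?V \<subseteq> {..<n}" using V(2) by (auto simp: letters_def)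
  show "x \<approx> y"
  proof (rule ceq_if_components[OF refl V(1)[symmetric]])
    fix a assume a: "a \<in> ?V"
    let ?C = "component ?V a"
    have C: "?C \<subseteq> ?V" "a \<in> ?C" using component_subset[OF a] by (simp_all add: component_def)
    then have "?C \<in> set ` set (subseqs [0..<n])"
      unfolding subseqs_powset using order_trans[OF C(1) n] by (simp add: atLeast0LessThan)
    then obtain D where D: "D \<in> set (subseqs [0..<n])" "set D = ?C" by auto
    have "(noncomm ?C)\<^sup>*\<^sup>* a b" if "b \<in> ?C" for b
    proof -
      have "(noncomm ?V)\<^sup>*\<^sup>* a b" using that by (simp add: component_def)
      then have "(noncomm ?C)\<^sup>*\<^sup>* a b \<and> b \<in> ?C"
      proof induction
        case (step b c)
        then have "c \<in> ?C" using component_closed by blast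
        then have "noncomm ?C b c" using step by (simp add: noncomm_def)
        then show ?case using step \<open>c \<in> ?C\<close> by auto
      qed (use C in simp)
      then show ?thesis by simp
    qed
    then have "(a, D) \<in> set root_components"
      using D C a n by (auto simp: root_components_def)
    moreover have "E b c" if "c \<in> ?V - ?C" "b \<in> ?C" for b c
      using that component_closed[of b ?V a c] C(1) by (auto simp: noncomm_def)
    then have "is_component D x" using D C by (simp add: is_component_def)
    ultimately show "restr ?C x \<approx> restr ?C y" using * D(2) by auto
  qed
qed (auto intro: restr_ceq)

section \<open>The program and its correctness\<close>

definition init_bank :: "nat \<Rightarrow> com" where
  "init_bank b = seqs [Assign (reg 0 b) (N 0), Assign (reg 1 b) (N 1), Assign (reg 2 b) (N 0),
     Assign (reg 3 b) (N 0), Assign (reg 4 b) (N 1), Assign (reg 5 b) (N 0)]"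

definition init :: com where
  "init = seqs [seqs (map init_bank [0..<n]), Assign 4 (V 0), Assign 5 (sub (sub (V 1) (N 2)) (V 0))]"

definition reduce :: com where
  "reduce = seqs [Loop (V 3) (read 0 4), Loop (V 3) (read 3 5),
     Loop (V 3) (cyc_pass 0), Loop (V 3) (cyc_pass 3)]"

definition compare_counts :: com where
  "compare_counts = seqs (map (\<lambda>b. If (sub (V (reg 2 b)) (V (reg 5 b))) (Assign 0 (N 0)) Skip) [0..<n])"

definition phases :: "(nat \<times> nat list) list \<Rightarrow> com" where
  "phases cs = seqs (map (\<lambda>(a, D). guard D (phase_body D a)) cs)"

text \<open>The phases start only if both reduced words have the same letter counts: this is
  necessary for equal classes and is what \<open>sem_compare\<close> relies on.\<close>

definition decide :: com where
  "decide = seqs [init, reduce, Assign 0 (N 1), compare_counts, If (V 0) (phases root_components) Skip]"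

text \<open>Register 1 exceeds the input length by 2. The value satisfies the strict bound of
  \<open>ceq_iff_orbit\<close> and is also large enough for reading the words and for the cyclic
  reduction.\<close>

definition set_bound :: "nat \<Rightarrow> com" where
  "set_bound \<kappa> = Assign 3 (Bin Plus (Bin Times (N (int \<kappa> + 2)) (sub (V 1) (N 2))) (N 1))"

lemma sem_compare_counts:
  "sem compare_counts s = (if \<forall>b<n. s (reg 2 b) = s (reg 5 b) then s else s(0 := 0))"
proof -
  have *: "sem (seqs (map (\<lambda>b. If (sub (V (reg 2 b)) (V (reg 5 b))) (Assign 0 (N 0)) Skip) bs)) s =
    (if \<forall>b\<in>set bs. s (reg 2 b) = s (reg 5 b) then s else s(0 := 0))" for bs s
    by (induction bs arbitrary: s) auto
  show ?thesis unfolding compare_counts_def * by auto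
qed

lemma kregs_iff: "i < 8 \<Longrightarrow> k + 2 < 8 \<Longrightarrow> reg i b \<in> kregs k \<longleftrightarrow> b < n \<and> i \<in> {k, k + 1, k + 2}"
  by (auto simp: kregs_def)

lemma read_wvars: "k + 2 < 8 \<Longrightarrow> wvars (read k J) \<subseteq> {2, 6, J} \<union> kregs k"
  using push_wvars by (auto simp: read_def push_letter_def)

lemma funpow_frame: "x \<notin> wvars c \<Longrightarrow> (sem c ^^ t) s x = s x"
  by (rule funpow_invariant[where g = "\<lambda>s. s x"]) (rule sem_wvars)

lemma mset_iff_counts:
  assumes "set u \<subseteq> letters n" "set v \<subseteq> letters n"
  shows "mset (map fst u) = mset (map fst v) \<longleftrightarrow>
    (\<forall>b<n. count_list (map fst u) b = count_list (map fst v) b)"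
proof
  assume *: "\<forall>b<n. count_list (map fst u) b = count_list (map fst v) b"
  have "count_list (map fst u) b = count_list (map fst v) b" for b
  proof (cases "b < n")
    case False
    then have "b \<notin> set (map fst u)" "b \<notin> set (map fst v)" using assms by (auto simp: letters_def)
    then show ?thesis by (simp add: count_notin)
  qed (use * in simp)
  then show "mset (map fst u) = mset (map fst v)" by (metis count_mset multiset_eqI)
next
  assume "mset (map fst u) = mset (map fst v)"
  then show "\<forall>b<n. count_list (map fst u) b = count_list (map fst v) b" by (metis count_mset)
qed

lemma phase_wvars:
  assumes "set D \<subseteq> {..<n}"
  shows "wvars (guard D (phase_body D a)) \<subseteq> {0, 7, 8} \<union> (reg 6 ` {..<n} \<union> reg 7 ` {..<n})"
proof -
  have cmp: "wvars (foldr (\<lambda>b c. If (sub (V (reg 6 b)) (V (reg 7 b))) Skip c) bs (Assign 8 (N 1))) \<subseteq> {8}" for bs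
    by (induction bs) auto
  have grd1: "wvars (foldr (\<lambda>b c. If (V (reg 2 b)) c Skip) bs c) \<subseteq> wvars c" for bs c
    by (induction bs) auto
  have grd2: "wvars (foldr (\<lambda>b c. If (V (reg 2 b)) Skip c) bs c) \<subseteq> wvars c" for bs c
    by (induction bs) auto
  have img: "reg v ` set D \<subseteq> reg v ` {..<n}" for v using assms by (rule image_mono)
  have "wvars (phase_body D a) \<subseteq> {0, 7, 8} \<union> (reg 6 ` set D \<union> reg 7 ` set D)"
    using walk_wvars[of 7 4 D "removeAll a D"] walk_wvars[of 6 1 D "removeAll a D @ [a]"] cmp[of D]
    by (auto simp: phase_body_def nonroot_com_def orbit_com_def compare_def copy_bank_def)
  then show ?thesis unfolding guard_def
    using grd1[of D] grd2[of _ "phase_body D a"] img[of 6] img[of 7] by blast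
qed

lemma sem_phases:
  assumes \<kappa>: "\<forall>(a, D)\<in>set cs. \<forall>b\<in>set D. \<exists>j\<le>\<kappa>. (noncomm (set D) ^^ j) a b"
    and cs: "set cs \<subseteq> set root_components"
    and u: "repr 0 u s" "set u \<subseteq> letters n" and v: "repr 3 v s"
    and uv: "mset (map fst u) = mset (map fst v)"
    and T: "s 3 = int T" "(\<kappa> + 2) * length u < T" "\<kappa> * length v \<le> T"
  shows "sem (phases cs) s 0 =
    (if \<forall>(a, D)\<in>set cs. is_component D u \<longrightarrow> restr (set D) u \<approx> restr (set D) v then s 0 else 0)"
  using \<kappa> cs u(1) v T(1)
proof (induction cs arbitrary: s)
  case (Cons c cs)
  obtain a D where c: "c = (a, D)" by fastforce
  have aD: "(a, D) \<in> set root_components" using Cons.prems(2) c by simp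
  note rD = root_componentsD[OF aD]
  interpret raag_phase E S D a \<kappa> n
    by unfold_locales (use rD Cons.prems(1) c in auto)
  let ?s = "sem (guard D (phase_body D a)) s"
  have guard: "?s = (if is_component D u then sem (phase_body D a) s else s)"
    by (rule sem_guard[OF Cons.prems(3) rD(2) u(2)])
  have s0: "?s 0 = (if is_component D u \<longrightarrow> restr (set D) u \<approx> restr (set D) v then s 0 else 0)"
    using sem_phase_body[OF Cons.prems(3,4) uv _ Cons.prems(5) T(2,3)] guard by auto
  have frame: "?s x = s x" if "x \<notin> {0, 7, 8} \<union> (reg 6 ` {..<n} \<union> reg 7 ` {..<n})" for x
    using phase_wvars[OF rD(2), of a] that by (intro sem_wvars) blast
  have "repr 0 u ?s" by (rule repr_cong[OF Cons.prems(3)]) (auto intro!: frame)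
  moreover have "repr 3 v ?s" by (rule repr_cong[OF Cons.prems(4)]) (auto intro!: frame)
  moreover have "?s 3 = int T" using frame[of 3] Cons.prems(5) by simp
  ultimately have "sem (phases cs) ?s 0 =
    (if \<forall>(a, D)\<in>set cs. is_component D u \<longrightarrow> restr (set D) u \<approx> restr (set D) v then ?s 0 else 0)"
    using Cons.prems(1,2) by (intro Cons.IH) auto
  then show ?case using s0 c by (auto simp: phases_def)
qed (simp add: phases_def)

lemma sem_reduce:
  assumes u: "set u \<subseteq> letters n" and v: "set v \<subseteq> letters n"
    and s: "s 4 = int (length u)" "s 5 = int (length v)"
      "s 2 = digits_val (2 * int n + 1) (map enc_letter (u @ v))" "repr 0 [] s" "repr 3 [] s" "s 3 = int T"
    and T: "length u \<le> T" "length v \<le> T"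
  shows "\<exists>u' v'. set u' \<subseteq> letters n \<and> set v' \<subseteq> letters n \<and> length u' \<le> length u \<and> length v' \<le> length v \<and>
    tconj n u u' \<and> tconj n v v' \<and> (\<forall>z. \<not> cred u' z) \<and> (\<forall>z. \<not> cred v' z) \<and>
    repr 0 u' (sem reduce s) \<and> repr 3 v' (sem reduce s) \<and> sem reduce s 3 = int T"
proof -
  define s1 where "s1 = (sem (read 0 4) ^^ T) s"
  define s2 where "s2 = (sem (read 3 5) ^^ T) s1"
  define s3 where "s3 = (sem (cyc_pass 0) ^^ T) s2"
  define s4 where "s4 = (sem (cyc_pass 3) ^^ T) s3"
  have f1: "s1 x = s x" if "x \<notin> {2, 6, 4} \<union> kregs 0" for x
    unfolding s1_def using read_wvars[of 0 4] that by (intro funpow_frame) auto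
  have f2: "s2 x = s1 x" if "x \<notin> {2, 6, 5} \<union> kregs 3" for x
    unfolding s2_def using read_wvars[of 3 5] that by (intro funpow_frame) auto
  have f3: "s3 x = s2 x" if "x \<notin> kregs 0" for x
    unfolding s3_def using cyc_pass_wvars[of 0] that by (intro funpow_frame) auto
  have f4: "s4 x = s3 x" if "x \<notin> kregs 3" for x
    unfolding s4_def using cyc_pass_wvars[of 3] that by (intro funpow_frame) auto
  obtain u1 where u1: "red u1" "set u1 \<subseteq> letters n" "length u1 \<le> length u" "raag_eq n E u u1"
    "repr 0 u1 s1" "s1 2 = digits_val (2 * int n + 1) (map enc_letter v)"
    unfolding s1_def using read_loop[OF _ _ u s(1,3,4) T(1)] by auto
  have "repr 3 [] s1" by (rule repr_cong[OF s(5)]) (auto intro!: f1 simp: kregs_iff)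
  moreover have "s1 5 = int (length v)" using s(2) f1[of 5] by (simp add: small_kregs)
  moreover have "s1 2 = digits_val (2 * int n + 1) (map enc_letter (v @ []))" using u1(6) by simp
  ultimately obtain v1 where v1: "red v1" "set v1 \<subseteq> letters n" "length v1 \<le> length v" "raag_eq n E v v1"
    "repr 3 v1 s2" unfolding s2_def using read_loop[of 3 5 v s1 "[]" T] v T(2) by auto
  have u2: "repr 0 u1 s2" by (rule repr_cong[OF u1(5)]) (auto intro!: f2 simp: kregs_iff)
  obtain u3 where u3: "red u3" "end_red u3" "set u3 \<subseteq> letters n" "length u3 \<le> length u1" "tconj n u1 u3"
    "repr 0 u3 s3" unfolding s3_def using cyc_loop[OF _ u1(1,2) u2, of T] u1(3) T(1) by auto
  have v3: "repr 3 v1 s3" by (rule repr_cong[OF v1(5)]) (auto intro!: f3 simp: kregs_iff)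
  obtain v4 where v4: "red v4" "end_red v4" "set v4 \<subseteq> letters n" "length v4 \<le> length v1" "tconj n v1 v4"
    "repr 3 v4 s4" unfolding s4_def using cyc_loop[OF _ v1(1,2) v3, of T] v1(3) T(2) by auto
  have u4: "repr 0 u3 s4" by (rule repr_cong[OF u3(6)]) (auto intro!: f4 simp: kregs_iff)
  have X: "s1 3 = int T" "s2 3 = int T" "s3 3 = int T" "s4 3 = int T"
    using s(6) f1[of 3] f2[of 3] f3[of 3] f4[of 3] by (simp_all add: small_kregs)
  have "sem reduce s = s4"
    using X s(6) by (simp add: reduce_def s1_def[symmetric] s2_def[symmetric] s3_def[symmetric] s4_def[symmetric])
  moreover have "tconj n u u3"
    using tconj_trans[OF tconj_sym[OF tconj_raag_eq[OF u1(4)]] u3(5)] .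
  moreover have "tconj n v v4"
    using tconj_trans[OF tconj_sym[OF tconj_raag_eq[OF v1(4)]] v4(5)] .
  ultimately show ?thesis
    using u1(3) u3 v1(3) v4 u4 X irreducible_if_red[OF u3(1,2)] irreducible_if_red[OF v4(1,2)]
    by (intro exI[of _ u3] exI[of _ v4]) auto
qed

lemma sem_init:
  assumes "s 0 = int (length u)" "s 1 = int (length (u @ v)) + 2"
  shows "repr 0 [] (sem init s)" "repr 3 [] (sem init s)" "sem init s 2 = s 2" "sem init s 3 = s 3"
    "sem init s 4 = int (length u)" "sem init s 5 = int (length v)"
proof -
  let ?s = "sem (seqs (map init_bank [0..<n])) s"
  have vars: "wvars (init_bank b) \<subseteq> bank b" "cvars (init_bank b) \<subseteq> bank b \<union> {..<16}" for b
    by (auto simp: init_bank_def)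
  have banks: "?s (reg i b) = sem (init_bank b) s (reg i b)" if "b < n" "i < 8" for b i
    using sem_banks_upt[OF vars that] .
  have small: "?s x = s x" if "x < 16" for x
    using sem_banks[of "[0..<n]" init_bank s] vars that by simp
  have init: "sem init s = ?s(4 := ?s 0, 5 := ?s 1 - 2 - ?s 0)"
    by (simp add: init_def)
  show "repr 0 [] (sem init s)" "repr 3 [] (sem init s)"
    unfolding init repr_def by (auto simp: banks init_bank_def)
  show "sem init s 2 = s 2" "sem init s 3 = s 3"
    "sem init s 4 = int (length u)" "sem init s 5 = int (length v)"
    unfolding init using small[of 0] small[of 1] small[of 2] small[of 3] assms by simp_all
qed

theorem sem_decide:
  assumes u: "set u \<subseteq> letters n" and v: "set v \<subseteq> letters n"
    and \<kappa>: "\<forall>(a, D)\<in>set root_components. \<forall>b\<in>set D. \<exists>j\<le>\<kappa>. (noncomm (set D) ^^ j) a b"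
    and s: "s 0 = int (length u)" "s 1 = int (length (u @ v)) + 2"
      "s 2 = digits_val (2 * int n + 1) (map enc_letter (u @ v))"
      "s 3 = int ((\<kappa> + 2) * length (u @ v) + 1)"
  shows "sem decide s 0 = (if tconj n u v then 1 else 0)"
proof -
  let ?T = "(\<kappa> + 2) * length (u @ v) + 1"
  note init = sem_init[OF s(1,2)]
  have T: "length u \<le> ?T" "length v \<le> ?T" by (simp_all add: algebra_simps)
  obtain u' v' where uv: "set u' \<subseteq> letters n" "set v' \<subseteq> letters n" "length u' \<le> length u" "length v' \<le> length v"
    "tconj n u u'" "tconj n v v'" "\<forall>z. \<not> cred u' z" "\<forall>z. \<not> cred v' z"
    "repr 0 u' (sem reduce (sem init s))" "repr 3 v' (sem reduce (sem init s))"
    "sem reduce (sem init s) 3 = int ?T"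
    using sem_reduce[OF u v init(5,6) _ init(1,2) _ T] init(3,4) s(3,4) by auto
  define s1 where "s1 = (sem reduce (sem init s))(0 := 1)"
  have s1: "repr 0 u' s1" "repr 3 v' s1" "s1 3 = int ?T"
    using uv(11) repr_cong[OF uv(9), of s1] repr_cong[OF uv(10), of s1] by (auto simp: s1_def)
  have counts: "(\<forall>b<n. s1 (reg 2 b) = s1 (reg 5 b)) \<longleftrightarrow> mset (map fst u') = mset (map fst v')"
    unfolding mset_iff_counts[OF uv(1,2)] using s1(1,2) by (auto simp: repr_def numeral_2_eq_2)
  have decide: "sem decide s = (if mset (map fst u') = mset (map fst v') then sem (phases root_components) s1
      else s1(0 := 0))"
    using counts by (simp add: decide_def s1_def[symmetric] sem_compare_counts) (simp add: s1_def)
  have "u' \<approx> v' \<longleftrightarrow> tconj n u v"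
  proof
    assume "u' \<approx> v'"
    from ceq_tconj[OF this uv(1)] show "tconj n u v"
      using uv(5,6) tconj_trans tconj_sym by blast
  next
    assume "tconj n u v"
    then have "tconj n u' v'" using uv(5,6) tconj_trans tconj_sym by blast
    from irreducible_conj[OF tconj_conj_step[OF this]] show "u' \<approx> v'" using uv(7,8) by blast
  qed
  moreover have "sem decide s 0 = (if u' \<approx> v' then 1 else 0)"
  proof (cases "mset (map fst u') = mset (map fst v')")
    case True
    have fst: "fst ` set u' = fst ` set v'" using arg_cong[OF True, of set_mset] by simp
    have len: "(\<kappa> + 2) * length u' \<le> (\<kappa> + 2) * length (u @ v)" "\<kappa> * length v' \<le> (\<kappa> + 2) * length (u @ v)"
      using uv(3,4) by (intro mult_le_mono; simp)+
    have "sem (phases root_components) s1 0 =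
      (if \<forall>(a, D)\<in>set root_components. is_component D u' \<longrightarrow> restr (set D) u' \<approx> restr (set D) v' then s1 0 else 0)"
      by (rule sem_phases[OF \<kappa> order_refl s1(1) uv(1) s1(2) True s1(3)]) (use len in linarith)+
    then show ?thesis unfolding decide ceq_iff_root_components[OF fst uv(1)] using True by (simp add: s1_def)
  next
    case False
    then show ?thesis using decide ceq_mset[of u' v'] by auto
  qed
  ultimately show ?thesis by simp
qed

section \<open>Running time\<close>

lemma loopfree_foldr: "(\<And>b c. loopfree c \<Longrightarrow> loopfree (f b c)) \<Longrightarrow> loopfree c \<Longrightarrow> loopfree (foldr f bs c)"
  by (induction bs) auto

lemma linear_in_foldr: "(\<And>b c. linear_in X c \<Longrightarrow> linear_in X (f b c)) \<Longrightarrow> linear_in X c \<Longrightarrow> linear_in X (foldr f bs c)"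
  by (induction bs) auto

lemma linear_decide: "linear_in 3 decide"
proof -
  have "loopfree (push k b d)" for k b d
    by (auto simp: push_def push_bank_def pop_bank_def)
  then have "loopfree (read k J)" for k J by (auto simp: read_def push_letter_def)
  moreover have "loopfree (cyc_pass k)" for k
    by (auto simp: cyc_pass_def cyc_cancel_def cyc_bank_def)
  ultimately have "linear_in 3 reduce" by (simp add: reduce_def)
  moreover have "linear_in 3 (guard D (phase_body D a))" for D a
  proof -
    have "loopfree (rot_com v p D b)" for v p b by (auto simp: rot_com_def rot_bank_def)
    then have "loopfree (walk v p D bs Skip)" for v p bs
      unfolding walk_def by (intro loopfree_foldr) auto
    moreover have "loopfree (compare D)"
      unfolding compare_def by (intro loopfree_foldr) auto
    ultimately have "linear_in 3 (phase_body D a)"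
      by (auto simp: phase_body_def nonroot_com_def orbit_com_def copy_bank_def)
    then show ?thesis unfolding guard_def by (intro linear_in_foldr) auto
  qed
  then have "linear_in 3 (phases root_components)" by (auto simp: phases_def)
  moreover have "linear_in 3 init" by (auto simp: init_def init_bank_def)
  moreover have "linear_in 3 compare_counts" by (auto simp: compare_counts_def)
  ultimately show ?thesis by (simp add: decide_def)
qed

lemma bound_not_written: "3 \<notin> wvars decide"
proof -
  have "3 \<notin> wvars (guard D (phase_body D a))" if "(a, D) \<in> set root_components" for a D
    using phase_wvars[OF root_componentsD(2)[OF that], of a] by auto
  then have "3 \<notin> wvars (phases root_components)" by (auto simp: phases_def)
  moreover have "3 \<notin> wvars init" "3 \<notin> wvars compare_counts"
    by (auto simp: init_def init_bank_def compare_counts_def)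
  moreover have "3 \<notin> wvars reduce"
    using read_wvars[of 0 4] read_wvars[of 3 5] cyc_pass_wvars[of 0] cyc_pass_wvars[of 3]
      small_kregs[of 3 0] small_kregs[of 3 3] by (auto simp: reduce_def)
  ultimately show ?thesis by (simp add: decide_def)
qed

theorem decides_tconj: "\<exists>P C. decides_TCP_linear_time n E (map tw) P C"
proof -
  obtain \<kappa> where \<kappa>: "\<forall>(a, D)\<in>set root_components. \<forall>b\<in>set D. \<exists>j\<le>\<kappa>. (noncomm (set D) ^^ j) a b"
    using root_components_bound by blast
  let ?c = "Seq (set_bound \<kappa>) decide"
  let ?A = "csize (set_bound \<kappa>)" and ?B = "csize decide"
  obtain T where vars: "cvars ?c \<subseteq> {..<T}" "0 < T" using cvars_bounded by blast
  let ?P = "ram_of (2 * n + 1) ?c T"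
  \<comment> \<open>9 steps per letter for the folding and \<open>\<kappa> + 2\<close> loop rounds
    per letter; the bracket collects the start-up costs. \<open>weaken\<close> merges slope and
    offset into the single constant that the definition asks for.\<close>
  let ?C = "9 + ?B * (\<kappa> + 2) + (2 * n + 23 + ?A + 2 * ?B)"
  have weaken: "a * l + b \<le> (a + b) * l + (a + b)" for a b l :: nat
    by (simp add: algebra_simps)
  have "\<exists>t M. t \<le> ?C * (length u + length v) + ?C \<and> ram_halts_within ?P (ram_input u v) t M \<and>
      M 0 = (if tconj n u v then 1 else 0)"
    if u: "set u \<subseteq> letters n" and v: "set v \<subseteq> letters n" for u v
  proof -
    let ?L = "length (u @ v)"
    obtain s k M where s: "s 0 = int (length u)" "s 1 = int ?L + 2"
      "s 2 = digits_val (int (2 * n + 1)) (map enc_letter (u @ v))"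
      and k: "k \<le> 2 * n + 1 + 22 + 9 * ?L + cost ?c s"
      and M: "ram_halts_within ?P (ram_input u v) k M" "M 0 = sem ?c s 0"
      using ram_of_correct[OF vars, of u v "2 * n + 1"] by auto
    define s1 where "s1 = sem (set_bound \<kappa>) s"
    have s1: "s1 = s(3 := int ((\<kappa> + 2) * ?L + 1))"
      using s(2) by (simp add: s1_def set_bound_def algebra_simps)
    have "sem decide s1 0 = (if tconj n u v then 1 else 0)"
      by (rule sem_decide[OF u v \<kappa>]) (use s in \<open>simp_all add: s1 add.commute\<close>)
    then have M0: "M 0 = (if tconj n u v then 1 else 0)" using M(2) by (simp add: s1_def)
    have "cost ?c s \<le> ?A + ?B * Suc ((\<kappa> + 2) * ?L + 1)"
    proof -
      have "cost (set_bound \<kappa>) s \<le> ?A" by (rule cost_loopfree) (simp add: set_bound_def)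
      moreover have "nat (s1 3) = (\<kappa> + 2) * ?L + 1" unfolding s1 by (simp only: fun_upd_same nat_int)
      then have "cost decide s1 \<le> ?B * Suc ((\<kappa> + 2) * ?L + 1)"
        using cost_linear[OF linear_decide bound_not_written, of s1] by simp
      ultimately show ?thesis by (simp only: cost.simps s1_def)
    qed
    then have "k \<le> 2 * n + 23 + 9 * ?L + (?A + ?B * Suc ((\<kappa> + 2) * ?L + 1))" using k by linarith
    also have "\<dots> = (9 + ?B * (\<kappa> + 2)) * ?L + (2 * n + 23 + ?A + 2 * ?B)" by (simp add: algebra_simps)
    also have "\<dots> \<le> ?C * ?L + ?C" by (rule weaken)
    finally have "k \<le> ?C * (length u + length v) + ?C" by (simp only: length_append)
    then show ?thesis using M(1) M0 by blast
  qed
  then have "decides_TCP_linear_time n E (map tw) ?P ?C" unfolding decides_TCP_linear_time_def by blast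
  then show ?thesis by blast
qed

end

text \<open>Inversions act letterwise and two at the same vertex cancel, so only the parity of the
  occurrences of a vertex matters.\<close>

lemma compose_inversions_eq_map:
  assumes "raag E"
  shows "compose_inversions xs = map (raag.tw {x. odd (count_list xs x)})"
proof (induction xs)
  case Nil
  show ?case by (auto simp: compose_inversions_def raag.tw_def[OF assms] fun_eq_iff)
next
  case (Cons x xs)
  have "compose_inversions (x # xs) = inversion x \<circ> compose_inversions xs"
    by (simp add: compose_inversions_def)
  also have "\<dots> = map ((\<lambda>(y, b). if y = x then (y, \<not> b) else (y, b)) \<circ> raag.tw {x. odd (count_list xs x)})"
    unfolding Cons.IH by (auto simp: inversion_def fun_eq_iff)
  also have "(\<lambda>(y, b). if y = x then (y, \<not> b) else (y, b)) \<circ> raag.tw {x. odd (count_list xs x)} =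
    raag.tw {y. odd (count_list (x # xs) y)}"
    by (auto simp: raag.tw_def[OF assms] inv_letter_def fun_eq_iff)
  finally show ?case .
qed

theorem theorem4p32:
  fixes n :: nat and E :: "nat \<Rightarrow> nat \<Rightarrow> bool" and xs :: "nat list"
  assumes "\<forall>x y. E x y \<longrightarrow> E y x"
    and "\<forall>x. \<not> E x x"
    and "set xs \<subseteq> {..<n}"
  shows "\<exists>P C. decides_TCP_linear_time n E (compose_inversions xs) P C"
proof -
  have raag: "raag E" using assms(1,2) by unfold_locales blast+
  interpret raag_alg E "{x. odd (count_list xs x)}" n
    using raag by (simp add: raag_alg_def)
  show ?thesis unfolding compose_inversions_eq_map[OF raag] by (rule decides_tconj)
qed

end
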